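(* Let $(\mathcal D_F,\mathcal D,\mathcal D_U;i^*,i_*,i^!,j_!,j^*,j_* )$ be a recollement situation, with $t$-structures given on $\mathcal D_U$ and $\mathcal D_F$ with hearts $\mathcal C_U$ and $\mathcal C_F$, and let $\mathcal C$ be the heart of the $t$-structure on $\mathcal D$ obtained by recollement. Suppose given torsion theories $(\mathcal T_F,\mathcal F_F)$ on $\mathcal C_F$ and $(\mathcal T_U,\mathcal F_U)$ on $\mathcal C_U$. Then $$\mathcal T=\{T\in\mathcal C\mid{}^pi^*T\in\mathcal T_F\text{ and }{}^pj^*T\in\mathcal T_U\},\qquad \mathcal F=\{L\in\mathcal C\mid{}^pi^!L\in\mathcal F_F\text{ and }{}^pj^*L\in\mathcal F_U\}$$ defines a torsion theory $(\mathcal T,\mathcal F)$ on $\mathcal C$.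
   Context: Recollement situation: triangulated categories $\mathcal D,\mathcal D_U,\mathcal D_F$ and triangulated functors $i_*:\mathcal D_F\to\mathcal D$, $j^*:\mathcal D\to\mathcal D_U$ such that (i) $i_*$ has triangulated left and right adjoints $i^*$, $i^!$; (ii) $j^*$ has triangulated left and right adjoints $j_!$, $j_*$; (iii) $j^*i_*=0$ (hence $i^*j_!=0$, $i^!j_*=0$); (iv) for every $K\in\mathcal D$ the adjunction morphisms fit into distinguished triangles $j_!j^*K\to K\to i_*i^*K\to$ and $i_*i^!K\to K\to j_*j^*K\to$; (v) $i_*,j_!,j_*$ are fully faithful. Given $t$-structures on $\mathcal D_U$ and $\mathcal D_F$, the $t$-structure on $\mathcal D$ obtained by recollement is $\mathcal D^{\le0}=\{K\mid j^*K\in\mathcal D_U^{\le0},\ i^*K\in\mathcal D_F^{\le0}\}$, $\mathcal D^{\ge0}=\{K\mid j^*K\in\mathcal D_U^{\ge0},\ i^!K\in\mathcal D_F^{\ge0}\}$. For a functor $T$ among $i^*,i_*,i^!,j_!,j^*,j_*$, ${}^pT$ denotes the additive functor between hearts $H^0\circ T\circ\varepsilon$, where $\varepsilon$ is the inclusion of the heart of the source. A torsion theory on an abelian category $\mathcal A$ is a pair $(\mathcal T,\mathcal F)$ of full subcategories, closed under isomorphism, such that (i) $\operatorname{Hom}_{\mathcal A}(T,F)=0$ for all $T\in\mathcal T$, $F\in\mathcal F$; (ii) every $A\in\mathcal A$ sits in a short exact sequence $0\to T\to A\to F\to0$ with $T\in\mathcal T$, $F\in\mathcal F$. *)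

theory Defs
  imports "HOL-Algebra.Group"
begin

section \<open>Categories and functors\<close>

text \<open>
  Equality of objects is equality in the type of objects; a full subcategory is represented by
  its set of objects. Every axiom is relativised to the carriers, so the values of the fields
  outside of them are irrelevant.
\<close>

record ('o, 'm) cat_data =
  Obj :: "'o set"
  Arr :: "'m set"
  Dom :: "'m \<Rightarrow> 'o"
  Cod :: "'m \<Rightarrow> 'o"
  Id :: "'o \<Rightarrow> 'm"
  Comp :: "'m \<Rightarrow> 'm \<Rightarrow> 'm"  (infixr \<open>\<cdot>\<index>\<close> 70)

definition Hom :: "('o, 'm, 'x) cat_data_scheme \<Rightarrow> 'o \<Rightarrow> 'o \<Rightarrow> 'm set" where
  "Hom C X Y = {f \<in> Arr C. Dom C f = X \<and> Cod C f = Y}"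

locale category =
  fixes C :: "('o, 'm, 'x) cat_data_scheme" (structure)
  assumes dom_obj: "f \<in> Arr C \<Longrightarrow> Dom C f \<in> Obj C"
    and cod_obj: "f \<in> Arr C \<Longrightarrow> Cod C f \<in> Obj C"
    and id_hom: "X \<in> Obj C \<Longrightarrow> Id C X \<in> Hom C X X"
    and comp_hom: "\<lbrakk>f \<in> Hom C X Y; g \<in> Hom C Y Z\<rbrakk> \<Longrightarrow> g \<cdot> f \<in> Hom C X Z"
    and id_left: "f \<in> Hom C X Y \<Longrightarrow> Id C Y \<cdot> f = f"
    and id_right: "f \<in> Hom C X Y \<Longrightarrow> f \<cdot> Id C X = f"
    and comp_assoc: "\<lbrakk>f \<in> Hom C W X; g \<in> Hom C X Y; h \<in> Hom C Y Z\<rbrakk>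
      \<Longrightarrow> (h \<cdot> g) \<cdot> f = h \<cdot> (g \<cdot> f)"

definition is_iso :: "('o, 'm, 'x) cat_data_scheme \<Rightarrow> 'm \<Rightarrow> bool" where
  "is_iso C f \<longleftrightarrow> f \<in> Arr C \<and>
    (\<exists>g \<in> Hom C (Cod C f) (Dom C f). g \<cdot>\<^bsub>C\<^esub> f = Id C (Dom C f) \<and> f \<cdot>\<^bsub>C\<^esub> g = Id C (Cod C f))"

definition is_mono :: "('o, 'm, 'x) cat_data_scheme \<Rightarrow> 'm \<Rightarrow> bool" where
  "is_mono C f \<longleftrightarrow> f \<in> Arr C \<and>
    (\<forall>W. \<forall>u \<in> Hom C W (Dom C f). \<forall>v \<in> Hom C W (Dom C f). f \<cdot>\<^bsub>C\<^esub> u = f \<cdot>\<^bsub>C\<^esub> v \<longrightarrow> u = v)"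

definition is_epi :: "('o, 'm, 'x) cat_data_scheme \<Rightarrow> 'm \<Rightarrow> bool" where
  "is_epi C f \<longleftrightarrow> f \<in> Arr C \<and>
    (\<forall>W. \<forall>u \<in> Hom C (Cod C f) W. \<forall>v \<in> Hom C (Cod C f) W. u \<cdot>\<^bsub>C\<^esub> f = v \<cdot>\<^bsub>C\<^esub> f \<longrightarrow> u = v)"

definition zero_object :: "('o, 'm, 'x) cat_data_scheme \<Rightarrow> 'o \<Rightarrow> bool" where
  "zero_object C Z \<longleftrightarrow> Z \<in> Obj C \<and>
    (\<forall>X \<in> Obj C. (\<exists>!f. f \<in> Hom C X Z) \<and> (\<exists>!f. f \<in> Hom C Z X))"

definition iso_closed :: "('o, 'm, 'x) cat_data_scheme \<Rightarrow> 'o set \<Rightarrow> bool" where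
  "iso_closed C S \<longleftrightarrow> S \<subseteq> Obj C \<and> (\<forall>f. is_iso C f \<and> Dom C f \<in> S \<longrightarrow> Cod C f \<in> S)"

record ('o, 'm, 'p, 'n) functor_data =
  Ob :: "'o \<Rightarrow> 'p"
  Ar :: "'m \<Rightarrow> 'n"

definition id_functor :: "('o, 'm, 'o, 'm) functor_data" where
  "id_functor = \<lparr>Ob = \<lambda>X. X, Ar = \<lambda>f. f\<rparr>"

definition comp_functor ::
  "('p, 'n, 'q, 'k) functor_data \<Rightarrow> ('o, 'm, 'p, 'n) functor_data \<Rightarrow> ('o, 'm, 'q, 'k) functor_data"
  (infixr \<open>\<odot>\<close> 70) where
  "G \<odot> F = \<lparr>Ob = \<lambda>X. Ob G (Ob F X), Ar = \<lambda>f. Ar G (Ar F f)\<rparr>"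

definition is_functor ::
  "('o, 'm, 'x) cat_data_scheme \<Rightarrow> ('p, 'n, 'y) cat_data_scheme
    \<Rightarrow> ('o, 'm, 'p, 'n) functor_data \<Rightarrow> bool" where
  "is_functor C D F \<longleftrightarrow>
    (\<forall>X \<in> Obj C. Ob F X \<in> Obj D \<and> Ar F (Id C X) = Id D (Ob F X)) \<and>
    (\<forall>X Y. \<forall>f \<in> Hom C X Y. Ar F f \<in> Hom D (Ob F X) (Ob F Y)) \<and>
    (\<forall>X Y Z. \<forall>f \<in> Hom C X Y. \<forall>g \<in> Hom C Y Z. Ar F (g \<cdot>\<^bsub>C\<^esub> f) = Ar F g \<cdot>\<^bsub>D\<^esub> Ar F f)"

definition fully_faithful ::
  "('o, 'm, 'x) cat_data_scheme \<Rightarrow> ('p, 'n, 'y) cat_data_scheme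
    \<Rightarrow> ('o, 'm, 'p, 'n) functor_data \<Rightarrow> bool" where
  "fully_faithful C D F \<longleftrightarrow>
    (\<forall>X \<in> Obj C. \<forall>Y \<in> Obj C. bij_betw (Ar F) (Hom C X Y) (Hom D (Ob F X) (Ob F Y)))"

definition nat_trans ::
  "('o, 'm, 'x) cat_data_scheme \<Rightarrow> ('p, 'n, 'y) cat_data_scheme \<Rightarrow> ('o, 'm, 'p, 'n) functor_data
    \<Rightarrow> ('o, 'm, 'p, 'n) functor_data \<Rightarrow> ('o \<Rightarrow> 'n) \<Rightarrow> bool" where
  "nat_trans C D F G \<phi> \<longleftrightarrow>
    (\<forall>X \<in> Obj C. \<phi> X \<in> Hom D (Ob F X) (Ob G X)) \<and>
    (\<forall>f \<in> Arr C. \<phi> (Cod C f) \<cdot>\<^bsub>D\<^esub> Ar F f = Ar G f \<cdot>\<^bsub>D\<^esub> \<phi> (Dom C f))"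

text \<open>\<open>F\<close> is left adjoint to \<open>G\<close>, with unit \<open>\<eta>\<close> and counit \<open>\<epsilon>\<close>.\<close>

definition adjunction ::
  "('o, 'm, 'x) cat_data_scheme \<Rightarrow> ('p, 'n, 'y) cat_data_scheme \<Rightarrow> ('o, 'm, 'p, 'n) functor_data
    \<Rightarrow> ('p, 'n, 'o, 'm) functor_data \<Rightarrow> ('o \<Rightarrow> 'm) \<Rightarrow> ('p \<Rightarrow> 'n) \<Rightarrow> bool" where
  "adjunction C D F G \<eta> \<epsilon> \<longleftrightarrow>
    is_functor C D F \<and> is_functor D C G \<and>
    nat_trans C C id_functor (G \<odot> F) \<eta> \<and> nat_trans D D (F \<odot> G) id_functor \<epsilon> \<and>
    (\<forall>X \<in> Obj C. \<epsilon> (Ob F X) \<cdot>\<^bsub>D\<^esub> Ar F (\<eta> X) = Id D (Ob F X)) \<and>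
    (\<forall>Y \<in> Obj D. Ar G (\<epsilon> Y) \<cdot>\<^bsub>C\<^esub> \<eta> (Ob G Y) = Id C (Ob G Y))"


section \<open>Additive and abelian categories\<close>

record ('o, 'm) preadd_data = "('o, 'm) cat_data" +
  Add :: "'m \<Rightarrow> 'm \<Rightarrow> 'm"  (infixl \<open>\<boxplus>\<index>\<close> 65)
  Zero :: "'o \<Rightarrow> 'o \<Rightarrow> 'm"

text \<open>The abelian group of morphisms, in the multiplicative notation of the library.\<close>

definition hom_group :: "('o, 'm, 'x) preadd_data_scheme \<Rightarrow> 'o \<Rightarrow> 'o \<Rightarrow> 'm monoid" where
  "hom_group C X Y = \<lparr>carrier = Hom C X Y, monoid.mult = Add C, one = Zero C X Y\<rparr>"

definition neg :: "('o, 'm, 'x) preadd_data_scheme \<Rightarrow> 'm \<Rightarrow> 'm" where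
  "neg C f = m_inv (hom_group C (Dom C f) (Cod C f)) f"

locale additive_category = category C
  for C :: "('o, 'm, 'x) preadd_data_scheme" (structure) +
  assumes hom_comm_group: "\<lbrakk>X \<in> Obj C; Y \<in> Obj C\<rbrakk> \<Longrightarrow> comm_group (hom_group C X Y)"
    and comp_add_left: "\<lbrakk>f \<in> Hom C X Y; g \<in> Hom C Y Z; g' \<in> Hom C Y Z\<rbrakk>
      \<Longrightarrow> (g \<boxplus> g') \<cdot> f = (g \<cdot> f) \<boxplus> (g' \<cdot> f)"
    and comp_add_right: "\<lbrakk>f \<in> Hom C X Y; f' \<in> Hom C X Y; g \<in> Hom C Y Z\<rbrakk>
      \<Longrightarrow> g \<cdot> (f \<boxplus> f') = (g \<cdot> f) \<boxplus> (g \<cdot> f')"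
    and ex_zero_object: "\<exists>Z. zero_object C Z"
    and ex_biproduct: "\<lbrakk>X \<in> Obj C; Y \<in> Obj C\<rbrakk> \<Longrightarrow>
      \<exists>B \<in> Obj C. \<exists>i \<in> Hom C X B. \<exists>j \<in> Hom C Y B. \<exists>p \<in> Hom C B X. \<exists>q \<in> Hom C B Y.
        p \<cdot> i = Id C X \<and> q \<cdot> j = Id C Y \<and> q \<cdot> i = Zero C X Y \<and> p \<cdot> j = Zero C Y X \<and>
        (i \<cdot> p) \<boxplus> (j \<cdot> q) = Id C B"

definition additive_functor ::
  "('o, 'm, 'x) preadd_data_scheme \<Rightarrow> ('p, 'n, 'y) preadd_data_scheme
    \<Rightarrow> ('o, 'm, 'p, 'n) functor_data \<Rightarrow> bool" where
  "additive_functor C D F \<longleftrightarrow> is_functor C D F \<and>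
    (\<forall>X Y. \<forall>f \<in> Hom C X Y. \<forall>g \<in> Hom C X Y. Ar F (f \<boxplus>\<^bsub>C\<^esub> g) = Ar F f \<boxplus>\<^bsub>D\<^esub> Ar F g)"

definition is_kernel :: "('o, 'm, 'x) preadd_data_scheme \<Rightarrow> 'm \<Rightarrow> 'm \<Rightarrow> bool" where
  "is_kernel C k f \<longleftrightarrow> f \<in> Arr C \<and> k \<in> Arr C \<and> Cod C k = Dom C f \<and>
    f \<cdot>\<^bsub>C\<^esub> k = Zero C (Dom C k) (Cod C f) \<and>
    (\<forall>W. \<forall>u \<in> Hom C W (Dom C f). f \<cdot>\<^bsub>C\<^esub> u = Zero C W (Cod C f)
      \<longrightarrow> (\<exists>!v. v \<in> Hom C W (Dom C k) \<and> k \<cdot>\<^bsub>C\<^esub> v = u))"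

definition is_cokernel :: "('o, 'm, 'x) preadd_data_scheme \<Rightarrow> 'm \<Rightarrow> 'm \<Rightarrow> bool" where
  "is_cokernel C c f \<longleftrightarrow> f \<in> Arr C \<and> c \<in> Arr C \<and> Dom C c = Cod C f \<and>
    c \<cdot>\<^bsub>C\<^esub> f = Zero C (Dom C f) (Cod C c) \<and>
    (\<forall>W. \<forall>u \<in> Hom C (Cod C f) W. u \<cdot>\<^bsub>C\<^esub> f = Zero C (Dom C f) W
      \<longrightarrow> (\<exists>!v. v \<in> Hom C (Cod C c) W \<and> v \<cdot>\<^bsub>C\<^esub> c = u))"

locale abelian_category = additive_category C
  for C :: "('o, 'm, 'x) preadd_data_scheme" (structure) +
  assumes ex_kernel: "f \<in> Arr C \<Longrightarrow> \<exists>k. is_kernel C k f"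
    and ex_cokernel: "f \<in> Arr C \<Longrightarrow> \<exists>c. is_cokernel C c f"
    and mono_normal: "is_mono C f \<Longrightarrow> \<exists>g. is_kernel C f g"
    and epi_normal: "is_epi C f \<Longrightarrow> \<exists>g. is_cokernel C f g"

text \<open>Exactness of \<open>0 \<rightarrow> X \<rightarrow> Y \<rightarrow> Z \<rightarrow> 0\<close> with maps \<open>f\<close> and \<open>g\<close>.\<close>

definition short_exact :: "('o, 'm, 'x) preadd_data_scheme \<Rightarrow> 'm \<Rightarrow> 'm \<Rightarrow> bool" where
  "short_exact C f g \<longleftrightarrow> is_kernel C f g \<and> is_cokernel C g f"

locale torsion_theory = abelian_category A
  for A :: "('o, 'm, 'x) preadd_data_scheme" (structure) +
  fixes T F :: "'o set"
  assumes torsion_iso_closed: "iso_closed A T"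
    and free_iso_closed: "iso_closed A F"
    and hom_torsion_free: "\<lbrakk>X \<in> T; Y \<in> F\<rbrakk> \<Longrightarrow> Hom A X Y = {Zero A X Y}"
    and ex_torsion_sequence: "X \<in> Obj A \<Longrightarrow>
      \<exists>f g. short_exact A f g \<and> Dom A f \<in> T \<and> Cod A f = X \<and> Cod A g \<in> F"


section \<open>Triangulated categories\<close>

text \<open>
  A triangle \<open>X \<rightarrow> Y \<rightarrow> Z \<rightarrow> X[1]\<close> is represented by its three morphisms, which determine the
  objects.
\<close>

record ('o, 'm) triang_data = "('o, 'm) preadd_data" +
  Shift :: "('o, 'm, 'o, 'm) functor_data"
  Dist :: "('m \<times> 'm \<times> 'm) set"

definition is_triangle :: "('o, 'm) triang_data \<Rightarrow> 'm \<Rightarrow> 'm \<Rightarrow> 'm \<Rightarrow> bool" where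
  "is_triangle D f g h \<longleftrightarrow>
    (\<exists>X Y Z. f \<in> Hom D X Y \<and> g \<in> Hom D Y Z \<and> h \<in> Hom D Z (Ob (Shift D) X))"

definition triangle_morphism ::
  "('o, 'm) triang_data \<Rightarrow> 'm \<times> 'm \<times> 'm \<Rightarrow> 'm \<times> 'm \<times> 'm \<Rightarrow> 'm \<Rightarrow> 'm \<Rightarrow> 'm \<Rightarrow> bool" where
  "triangle_morphism D = (\<lambda>(f, g, h) (f', g', h') u v w.
    u \<in> Hom D (Dom D f) (Dom D f') \<and> v \<in> Hom D (Dom D g) (Dom D g') \<and>
    w \<in> Hom D (Dom D h) (Dom D h') \<and>
    v \<cdot>\<^bsub>D\<^esub> f = f' \<cdot>\<^bsub>D\<^esub> u \<and> w \<cdot>\<^bsub>D\<^esub> g = g' \<cdot>\<^bsub>D\<^esub> v \<and> Ar (Shift D) u \<cdot>\<^bsub>D\<^esub> h = h' \<cdot>\<^bsub>D\<^esub> w)"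

text \<open>As in Verdier and in Beilinson-Bernstein-Deligne, the shift is an automorphism.\<close>

locale triangulated_category = additive_category D
  for D :: "('o, 'm) triang_data" (structure) +
  assumes shift_additive: "additive_functor D D (Shift D)"
    and shift_bij_obj: "bij_betw (Ob (Shift D)) (Obj D) (Obj D)"
    and shift_bij_arr: "bij_betw (Ar (Shift D)) (Arr D) (Arr D)"
    and dist_triangle: "(f, g, h) \<in> Dist D \<Longrightarrow> is_triangle D f g h"
    and TR1_iso: "\<lbrakk>(f, g, h) \<in> Dist D; is_triangle D f' g' h';
        triangle_morphism D (f, g, h) (f', g', h') u v w; is_iso D u; is_iso D v; is_iso D w\<rbrakk>
      \<Longrightarrow> (f', g', h') \<in> Dist D"
    and TR1_id: "\<lbrakk>X \<in> Obj D; zero_object D Z\<rbrakk>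
      \<Longrightarrow> (Id D X, Zero D X Z, Zero D Z (Ob (Shift D) X)) \<in> Dist D"
    and TR1_cone: "f \<in> Arr D \<Longrightarrow> \<exists>g h. (f, g, h) \<in> Dist D"
    and TR2: "is_triangle D f g h
      \<Longrightarrow> (f, g, h) \<in> Dist D \<longleftrightarrow> (g, h, neg D (Ar (Shift D) f)) \<in> Dist D"
    and TR3: "\<lbrakk>(f, g, h) \<in> Dist D; (f', g', h') \<in> Dist D; u \<in> Hom D (Dom D f) (Dom D f');
        v \<in> Hom D (Dom D g) (Dom D g'); v \<cdot> f = f' \<cdot> u\<rbrakk>
      \<Longrightarrow> \<exists>w. triangle_morphism D (f, g, h) (f', g', h') u v w"
    and TR4: "\<lbrakk>f \<in> Hom D X Y; g \<in> Hom D Y Z;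
        (f, a, b) \<in> Dist D; (g, c, d) \<in> Dist D; (g \<cdot> f, e, k) \<in> Dist D\<rbrakk>
      \<Longrightarrow> \<exists>m n. (m, n, Ar (Shift D) a \<cdot> d) \<in> Dist D \<and>
        triangle_morphism D (f, a, b) (g \<cdot> f, e, k) (Id D X) g m \<and>
        triangle_morphism D (g \<cdot> f, e, k) (g, c, d) f (Id D Z) n"

definition triangulated_functor ::
  "('o, 'm) triang_data \<Rightarrow> ('p, 'n) triang_data \<Rightarrow> ('o, 'm, 'p, 'n) functor_data \<Rightarrow> bool" where
  "triangulated_functor D E F \<longleftrightarrow> additive_functor D E F \<and>
    (\<exists>\<phi>. nat_trans D E (F \<odot> Shift D) (Shift E \<odot> F) \<phi> \<and> (\<forall>X \<in> Obj D. is_iso E (\<phi> X)) \<and>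
      (\<forall>f g h. (f, g, h) \<in> Dist D
        \<longrightarrow> (Ar F f, Ar F g, \<phi> (Dom D f) \<cdot>\<^bsub>E\<^esub> Ar F h) \<in> Dist E))"


section \<open>t-structures\<close>

text \<open>
  A t-structure is given by the object sets \<open>L\<close> and \<open>G\<close> of the strictly full subcategories of
  objects in degrees \<open>\<le> 0\<close> and \<open>\<ge> 0\<close>.  As \<open>D\<^sup>\<le>\<^sup>n = D\<^sup>\<le>\<^sup>0[-n]\<close> and \<open>D\<^sup>\<ge>\<^sup>n = D\<^sup>\<ge>\<^sup>0[-n]\<close>, the objects of
  degrees \<open>\<ge> 1\<close> are those whose shift is in \<open>G\<close>, and the objects of degrees \<open>\<le> -1\<close> are the shifts
  of those in \<open>L\<close>.
\<close>

definition ge_one :: "('o, 'm) triang_data \<Rightarrow> 'o set \<Rightarrow> 'o set" where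
  "ge_one D G = {X \<in> Obj D. Ob (Shift D) X \<in> G}"

definition le_minus_one :: "('o, 'm) triang_data \<Rightarrow> 'o set \<Rightarrow> 'o set" where
  "le_minus_one D L = Ob (Shift D) ` L"

locale t_structure = triangulated_category D
  for D :: "('o, 'm) triang_data" (structure) +
  fixes L G :: "'o set"
  assumes le_iso_closed: "iso_closed D L"
    and ge_iso_closed: "iso_closed D G"
    and hom_le_ge: "\<lbrakk>X \<in> L; Y \<in> ge_one D G\<rbrakk> \<Longrightarrow> Hom D X Y = {Zero D X Y}"
    and le_shift: "le_minus_one D L \<subseteq> L"
    and ge_shift: "ge_one D G \<subseteq> G"
    and ex_truncation: "K \<in> Obj D \<Longrightarrow>
      \<exists>f g h. (f, g, h) \<in> Dist D \<and> Dom D f \<in> L \<and> Cod D f = K \<and> Cod D g \<in> ge_one D G"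

definition heart :: "('o, 'm) triang_data \<Rightarrow> 'o set \<Rightarrow> 'o set \<Rightarrow> ('o, 'm) preadd_data" where
  "heart D L G =
    \<lparr>Obj = L \<inter> G, Arr = {f \<in> Arr D. Dom D f \<in> L \<inter> G \<and> Cod D f \<in> L \<inter> G},
     Dom = Dom D, Cod = Cod D, Id = Id D, Comp = Comp D, Add = Add D, Zero = Zero D\<rparr>"

text \<open>
  The truncation functors are determined up to unique isomorphism only; the truncation
  triangles are chosen once and for all.  Their outer morphisms \<open>\<tau>\<^sup>\<le>\<^sup>0 K \<rightarrow> K\<close> and \<open>K \<rightarrow> \<tau>\<^sup>\<ge>\<^sup>0 K\<close> then
  determine the functors on objects and on morphisms.
\<close>

definition le_arrow :: "('o, 'm) triang_data \<Rightarrow> 'o set \<Rightarrow> 'o set \<Rightarrow> 'o \<Rightarrow> 'm" where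
  "le_arrow D L G K = (SOME f. \<exists>g h. (f, g, h) \<in> Dist D \<and>
    Dom D f \<in> L \<and> Cod D f = K \<and> Cod D g \<in> ge_one D G)"

definition ge_arrow :: "('o, 'm) triang_data \<Rightarrow> 'o set \<Rightarrow> 'o set \<Rightarrow> 'o \<Rightarrow> 'm" where
  "ge_arrow D L G K = (SOME g. \<exists>f h. (f, g, h) \<in> Dist D \<and>
    Dom D f \<in> le_minus_one D L \<and> Dom D g = K \<and> Cod D g \<in> G)"

definition tau_le :: "('o, 'm) triang_data \<Rightarrow> 'o set \<Rightarrow> 'o set \<Rightarrow> ('o, 'm, 'o, 'm) functor_data" where
  "tau_le D L G = (let \<iota> = le_arrow D L G in
    \<lparr>Ob = \<lambda>K. Dom D (\<iota> K),
     Ar = \<lambda>u. THE v. v \<in> Hom D (Dom D (\<iota> (Dom D u))) (Dom D (\<iota> (Cod D u))) \<and>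
       \<iota> (Cod D u) \<cdot>\<^bsub>D\<^esub> v = u \<cdot>\<^bsub>D\<^esub> \<iota> (Dom D u)\<rparr>)"

definition tau_ge :: "('o, 'm) triang_data \<Rightarrow> 'o set \<Rightarrow> 'o set \<Rightarrow> ('o, 'm, 'o, 'm) functor_data" where
  "tau_ge D L G = (let \<pi> = ge_arrow D L G in
    \<lparr>Ob = \<lambda>K. Cod D (\<pi> K),
     Ar = \<lambda>u. THE v. v \<in> Hom D (Cod D (\<pi> (Dom D u))) (Cod D (\<pi> (Cod D u))) \<and>
       v \<cdot>\<^bsub>D\<^esub> \<pi> (Dom D u) = \<pi> (Cod D u) \<cdot>\<^bsub>D\<^esub> u\<rparr>)"

definition H0 :: "('o, 'm) triang_data \<Rightarrow> 'o set \<Rightarrow> 'o set \<Rightarrow> ('o, 'm, 'o, 'm) functor_data" where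
  "H0 D L G = tau_ge D L G \<odot> tau_le D L G"

text \<open>
  The functor between hearts induced by a functor \<open>T\<close> into the triangulated category \<open>E\<close> with
  t-structure \<open>(L, G)\<close>.  On objects and morphisms the inclusion of the heart of the source is the
  identity, hence the source does not occur as an argument.
\<close>

definition perv :: "('p, 'n) triang_data \<Rightarrow> 'p set \<Rightarrow> 'p set
    \<Rightarrow> ('o, 'm, 'p, 'n) functor_data \<Rightarrow> ('o, 'm, 'p, 'n) functor_data" where
  "perv E L G T = H0 E L G \<odot> T \<odot> id_functor"


section \<open>Recollement\<close>

text \<open>
  The six functors \<open>i\<^sup>*, i\<^sub>*, i\<^sup>!, j\<^sub>!, j\<^sup>*, j\<^sub>*\<close> are written \<open>iu, il, ix, jx, ju, jl\<close>
  (upper star, lower star, shriek).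
\<close>

locale recollement =
  F: triangulated_category DF + D: triangulated_category D + U: triangulated_category DU
  for DF :: "('of, 'mf) triang_data" and D :: "('o, 'm) triang_data"
    and DU :: "('ou, 'mu) triang_data" +
  fixes iu :: "('o, 'm, 'of, 'mf) functor_data"
    and il :: "('of, 'mf, 'o, 'm) functor_data"
    and ix :: "('o, 'm, 'of, 'mf) functor_data"
    and jx :: "('ou, 'mu, 'o, 'm) functor_data"
    and ju :: "('o, 'm, 'ou, 'mu) functor_data"
    and jl :: "('ou, 'mu, 'o, 'm) functor_data"
  assumes iu_triangulated: "triangulated_functor D DF iu"
    and il_triangulated: "triangulated_functor DF D il"
    and ix_triangulated: "triangulated_functor D DF ix"
    and jx_triangulated: "triangulated_functor DU D jx"
    and ju_triangulated: "triangulated_functor D DU ju"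
    and jl_triangulated: "triangulated_functor DU D jl"
    and ju_il_zero: "X \<in> Obj DF \<Longrightarrow> zero_object DU (Ob ju (Ob il X))"
    and adjunction_triangles:
      "\<exists>\<eta>i \<epsilon>i \<eta>i' \<epsilon>i' \<eta>j \<epsilon>j \<eta>j' \<epsilon>j'.
        adjunction D DF iu il \<eta>i \<epsilon>i \<and> adjunction DF D il ix \<eta>i' \<epsilon>i' \<and>
        adjunction DU D jx ju \<eta>j \<epsilon>j \<and> adjunction D DU ju jl \<eta>j' \<epsilon>j' \<and>
        (\<forall>K \<in> Obj D. (\<exists>h. (\<epsilon>j K, \<eta>i K, h) \<in> Dist D) \<and> (\<exists>h. (\<epsilon>i' K, \<eta>j' K, h) \<in> Dist D))"
    and il_fully_faithful: "fully_faithful DF D il"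
    and jx_fully_faithful: "fully_faithful DU D jx"
    and jl_fully_faithful: "fully_faithful DU D jl"

definition glued_le :: "('o, 'm) triang_data \<Rightarrow> ('o, 'm, 'of, 'mf) functor_data
    \<Rightarrow> ('o, 'm, 'ou, 'mu) functor_data \<Rightarrow> 'of set \<Rightarrow> 'ou set \<Rightarrow> 'o set" where
  "glued_le D iu ju LF LU = {K \<in> Obj D. Ob ju K \<in> LU \<and> Ob iu K \<in> LF}"

definition glued_ge :: "('o, 'm) triang_data \<Rightarrow> ('o, 'm, 'of, 'mf) functor_data
    \<Rightarrow> ('o, 'm, 'ou, 'mu) functor_data \<Rightarrow> 'of set \<Rightarrow> 'ou set \<Rightarrow> 'o set" where
  "glued_ge D ix ju GF GU = {K \<in> Obj D. Ob ju K \<in> GU \<and> Ob ix K \<in> GF}"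

end

(*
  A torsion theory on the heart of a t-structure amounts to a pair of orthogonal subcategories of
  the triangulated category with truncation triangles, namely the tilted pair of Happel, Reiten and
  Smalo: the objects K of degrees <= 0 with H^0 K torsion, and those of degrees >= 0 with H^0 K
  torsion-free. Orthogonality replaces H^0 in its definition: for K of degrees <= 0, H^0 K is torsion
  iff Hom(K, Y) = 0 for all torsion-free Y, and dually. The gluing construction of Beilinson,
  Bernstein and Deligne applies to every such pair, whether or not it is stable under the shift. It
  yields both the glued t-structure and, from the tilted pairs on D_F and D_U, a pair (L', M') on D
  with L' in degrees <= 0 and M' in degrees >= 0. The truncation triangle with respect to (L', M') of
  an object of the heart lies in the heart, where it is the required short exact sequence.
*)
theory Submission
  imports Defs
begin

section \<open>Additive categories\<close>

text \<open>Every membership question is reduced to the vanishing of groups Hom(X, Y), because this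
  passes through adjunctions, through triangles and through the arbitrary choices of truncations.
  \<open>H0\<close> can be traded for such conditions since, for K of degrees <= 0, the morphism K
  -> H^0 K has its fibre in degrees <= -1, so that K and H^0 K have the same orthogonality to
  objects of degrees >= 0. This is exactly the situation of \<open>iu\<close> on the glued heart,
  which only lands in degrees <= 0, and dually of \<open>ix\<close>, which only lands in degrees >=
  0. The link between exact sequences and triangles has to be established by hand. A triangle with
  all vertices in the heart is a short exact sequence; conversely an epimorphism of the heart has
  its fibre in the heart, and this turns a given torsion sequence into a triangle. The same analysis
  of fibres and cones shows that the heart is abelian, which is part of the notion of torsion
  theory. Morphisms of triangles supplied by TR3 are not unique, so cones are compared through
  invertibility of the fill-ins; gluing needs this to identify the restrictions of the constructed
  objects.\<close>

definition isomorphic :: "('o, 'm, 'x) cat_data_scheme \<Rightarrow> 'o \<Rightarrow> 'o \<Rightarrow> bool" where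
  "isomorphic C X Y \<longleftrightarrow> (\<exists>f \<in> Hom C X Y. is_iso C f)"

text \<open>An inclusion rather than an equality, so that no side condition on objects is needed: in
  a category there are no morphisms between values outside of \<open>Obj C\<close>.\<close>

definition null :: "('o, 'm, 'x) preadd_data_scheme \<Rightarrow> 'o \<Rightarrow> 'o \<Rightarrow> bool" where
  "null C X Y \<longleftrightarrow> Hom C X Y \<subseteq> {Zero C X Y}"

lemma nullD: "\<lbrakk>null C X Y; f \<in> Hom C X Y\<rbrakk> \<Longrightarrow> f = Zero C X Y"
  unfolding null_def by blast

lemma nullI: "(\<And>f. f \<in> Hom C X Y \<Longrightarrow> f = Zero C X Y) \<Longrightarrow> null C X Y"
  unfolding null_def by blast

lemma iso_closedD: "\<lbrakk>iso_closed C S; isomorphic C X Y; X \<in> S\<rbrakk> \<Longrightarrow> Y \<in> S"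
  unfolding iso_closed_def isomorphic_def Hom_def by blast

lemma iso_closed_obj: "\<lbrakk>iso_closed C S; X \<in> S\<rbrakk> \<Longrightarrow> X \<in> Obj C"
  unfolding iso_closed_def by blast

lemma iso_closedI:
  assumes "S \<subseteq> Obj C" and "\<And>X Y. \<lbrakk>isomorphic C X Y; X \<in> S\<rbrakk> \<Longrightarrow> Y \<in> S"
  shows "iso_closed C S"
  using assms unfolding iso_closed_def isomorphic_def Hom_def is_iso_def by blast

lemma is_isoI:
  assumes "f \<in> Hom C X Y" and "g \<in> Hom C Y X"
    and "g \<cdot>\<^bsub>C\<^esub> f = Id C X" and "f \<cdot>\<^bsub>C\<^esub> g = Id C Y"
  shows "is_iso C f"
  using assms unfolding is_iso_def Hom_def by auto

lemma is_isoE: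
  assumes "is_iso C f" and "f \<in> Hom C X Y"
  obtains g where "g \<in> Hom C Y X" "g \<cdot>\<^bsub>C\<^esub> f = Id C X" "f \<cdot>\<^bsub>C\<^esub> g = Id C Y"
  using assms unfolding is_iso_def Hom_def by auto

lemma isomorphicI: "\<lbrakk>is_iso C f; f \<in> Hom C X Y\<rbrakk> \<Longrightarrow> isomorphic C X Y"
  unfolding isomorphic_def by blast

lemma isomorphic_sym: "isomorphic C X Y \<Longrightarrow> isomorphic C Y X"
  unfolding isomorphic_def by (metis is_isoE is_isoI)

context category
begin

lemma arr_hom: "f \<in> Arr C \<Longrightarrow> f \<in> Hom C (Dom C f) (Cod C f)"
  unfolding Hom_def by simp

lemma hom_dom: "f \<in> Hom C X Y \<Longrightarrow> X \<in> Obj C"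
  using dom_obj unfolding Hom_def by blast

lemma hom_cod: "f \<in> Hom C X Y \<Longrightarrow> Y \<in> Obj C"
  using cod_obj unfolding Hom_def by blast

lemma isomorphic_trans:
  assumes "isomorphic C X Y" and "isomorphic C Y Z"
  shows "isomorphic C X Z"
proof -
  obtain f f' where f: "f \<in> Hom C X Y" "f' \<in> Hom C Y X" "f' \<cdot> f = Id C X" "f \<cdot> f' = Id C Y"
    using assms(1) unfolding isomorphic_def by (meson is_isoE)
  obtain g g' where g: "g \<in> Hom C Y Z" "g' \<in> Hom C Z Y" "g' \<cdot> g = Id C Y" "g \<cdot> g' = Id C Z"
    using assms(2) unfolding isomorphic_def by (meson is_isoE)
  have cancel: "(v' \<cdot> v) \<cdot> (u \<cdot> u') = Id C A"
    if "u' \<in> Hom C A B" "v' \<in> Hom C B A" "u \<in> Hom C B E" "v \<in> Hom C E B"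
      "v' \<cdot> u' = Id C A" "v \<cdot> u = Id C B" for u u' v v' A B E
  proof -
    have "(v' \<cdot> v) \<cdot> (u \<cdot> u') = v' \<cdot> (v \<cdot> (u \<cdot> u'))"
      using that by (blast intro: comp_assoc comp_hom)
    also have "v \<cdot> (u \<cdot> u') = (v \<cdot> u) \<cdot> u'"
      using that by (blast intro: comp_assoc[symmetric])
    finally show ?thesis using that by (simp add: id_left)
  qed
  have 1: "(f' \<cdot> g') \<cdot> (g \<cdot> f) = Id C X"
    by (rule cancel[OF f(1,2) g(1,2) f(3) g(3)])
  have 2: "(g \<cdot> f) \<cdot> (f' \<cdot> g') = Id C Z"
    by (rule cancel[OF g(2,1) f(2,1) g(4) f(4)])
  show ?thesis
    by (rule isomorphicI[OF is_isoI[OF comp_hom comp_hom 1 2] comp_hom]) (use f g in blast)+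
qed

end

context additive_category
begin

lemma hom_group_simps [simp]:
  "carrier (hom_group C X Y) = Hom C X Y" "one (hom_group C X Y) = Zero C X Y"
  "monoid.mult (hom_group C X Y) = Add C"
  unfolding hom_group_def by simp_all

lemma zero_hom: "\<lbrakk>X \<in> Obj C; Y \<in> Obj C\<rbrakk> \<Longrightarrow> Zero C X Y \<in> Hom C X Y"
  using comm_groupE(2)[OF hom_comm_group[of X Y]] by simp

lemma hom_group: "f \<in> Hom C X Y \<Longrightarrow> comm_group (hom_group C X Y)"
  by (rule hom_comm_group[OF hom_dom hom_cod])

lemma neg_eq: "f \<in> Hom C X Y \<Longrightarrow> neg C f = m_inv (hom_group C X Y) f"
  unfolding neg_def Hom_def by auto

lemma add_hom: "\<lbrakk>f \<in> Hom C X Y; g \<in> Hom C X Y\<rbrakk> \<Longrightarrow> f \<boxplus> g \<in> Hom C X Y"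
  using comm_groupE(1)[OF hom_group[of f X Y]] by simp

lemma neg_hom: "f \<in> Hom C X Y \<Longrightarrow> neg C f \<in> Hom C X Y"
  using group.inv_closed[OF comm_group.axioms(2)[OF hom_group[of f X Y]], of f] neg_eq[of f X Y]
  by simp

lemma add_neg: "f \<in> Hom C X Y \<Longrightarrow> f \<boxplus> neg C f = Zero C X Y"
  using group.r_inv[OF comm_group.axioms(2)[OF hom_group[of f X Y]], of f] neg_eq[of f X Y]
  by simp

lemma add_zero: "f \<in> Hom C X Y \<Longrightarrow> f \<boxplus> Zero C X Y = f"
  using monoid.r_one[OF comm_monoid.axioms(1)[OF comm_group.axioms(1)[OF hom_group[of f X Y]]], of f]
  by simp

lemma zero_add: "f \<in> Hom C X Y \<Longrightarrow> Zero C X Y \<boxplus> f = f"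
  using comm_groupE(5)[OF hom_group[of f X Y]] by simp

lemma add_assoc:
  "\<lbrakk>f \<in> Hom C X Y; g \<in> Hom C X Y; h \<in> Hom C X Y\<rbrakk> \<Longrightarrow> (f \<boxplus> g) \<boxplus> h = f \<boxplus> (g \<boxplus> h)"
  using comm_groupE(3)[OF hom_group[of f X Y]] by simp

lemma add_commute: "\<lbrakk>f \<in> Hom C X Y; g \<in> Hom C X Y\<rbrakk> \<Longrightarrow> f \<boxplus> g = g \<boxplus> f"
  using comm_groupE(4)[OF hom_group[of f X Y]] by simp

lemma neg_unique: "\<lbrakk>f \<in> Hom C X Y; g \<in> Hom C X Y; f \<boxplus> g = Zero C X Y\<rbrakk> \<Longrightarrow> g = neg C f"
  by (metis add_assoc add_commute add_neg add_zero neg_hom zero_add)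

lemma neg_neg: "f \<in> Hom C X Y \<Longrightarrow> neg C (neg C f) = f"
  by (metis add_commute add_neg neg_hom neg_unique)

lemma idem_zero: "\<lbrakk>f \<in> Hom C X Y; f \<boxplus> f = f\<rbrakk> \<Longrightarrow> f = Zero C X Y"
  by (metis add_assoc add_neg add_zero neg_hom)

lemma comp_zero_left:
  assumes "f \<in> Hom C X Y" and "Z \<in> Obj C"
  shows "Zero C Y Z \<cdot> f = Zero C X Z"
proof -
  have z: "Zero C Y Z \<in> Hom C Y Z" using assms by (simp add: zero_hom hom_cod)
  show ?thesis
    by (rule idem_zero[OF comp_hom[OF assms(1) z]])
      (metis add_zero comp_add_left[OF assms(1) z z] z)
qed

lemma comp_zero_right:
  assumes "f \<in> Hom C Y Z" and "X \<in> Obj C"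
  shows "f \<cdot> Zero C X Y = Zero C X Z"
proof -
  have z: "Zero C X Y \<in> Hom C X Y" using assms by (simp add: zero_hom hom_dom)
  show ?thesis
    by (rule idem_zero[OF comp_hom[OF z assms(1)]])
      (metis add_zero comp_add_right[OF z z assms(1)] z)
qed

lemma neg_zero: "\<lbrakk>X \<in> Obj C; Y \<in> Obj C\<rbrakk> \<Longrightarrow> neg C (Zero C X Y) = Zero C X Y"
  by (metis add_zero neg_unique zero_hom)

lemma neg_comp:
  assumes "f \<in> Hom C X Y" and "g \<in> Hom C Y Z"
  shows "neg C g \<cdot> f = neg C (g \<cdot> f)"
  by (rule neg_unique[of _ X Z])
    (use assms in \<open>simp_all add: comp_hom neg_hom comp_add_left[symmetric] add_neg
      comp_zero_left hom_cod comp_hom[of f X Y]\<close>)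

lemma comp_neg:
  assumes "f \<in> Hom C X Y" and "g \<in> Hom C Y Z"
  shows "g \<cdot> neg C f = neg C (g \<cdot> f)"
  by (rule neg_unique[of _ X Z])
    (use assms in \<open>simp_all add: comp_hom neg_hom comp_add_right[symmetric] add_neg
      comp_zero_right hom_dom comp_hom[of _ X Y]\<close>)

lemma neg_inj: "\<lbrakk>neg C f = neg C g; f \<in> Hom C X Y; g \<in> Hom C X Y\<rbrakk> \<Longrightarrow> f = g"
  by (metis neg_neg)

lemma add_neg_eq_zero_iff:
  "\<lbrakk>f \<in> Hom C X Y; g \<in> Hom C X Y\<rbrakk> \<Longrightarrow> f \<boxplus> neg C g = Zero C X Y \<longleftrightarrow> f = g"
  by (metis add_neg neg_hom neg_inj neg_unique)

text \<open>Subtraction reduces cancellation to a test on zero. The test is asked only for the one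
  source \<open>W\<close>, because in a triangle it will hold only for sources in suitable
  degrees.\<close>

lemma comp_left_cancel:
  assumes "k \<in> Hom C X Y" and "\<And>w. \<lbrakk>w \<in> Hom C W X; k \<cdot> w = Zero C W Y\<rbrakk> \<Longrightarrow> w = Zero C W X"
    and "u \<in> Hom C W X" and "v \<in> Hom C W X" and "k \<cdot> u = k \<cdot> v"
  shows "u = v"
proof -
  have "k \<cdot> (u \<boxplus> neg C v) = Zero C W Y"
    using comp_add_right[OF assms(3) neg_hom[OF assms(4)] assms(1)] comp_neg[OF assms(4,1)]
      add_neg[OF comp_hom[OF assms(4,1)]] assms(5) by simp
  then show ?thesis
    using assms(2)[of "u \<boxplus> neg C v"] assms(3,4) by (simp add: add_hom neg_hom add_neg_eq_zero_iff)
qed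

lemma comp_right_cancel:
  assumes "k \<in> Hom C X Y" and "\<And>w. \<lbrakk>w \<in> Hom C Y W; w \<cdot> k = Zero C X W\<rbrakk> \<Longrightarrow> w = Zero C Y W"
    and "u \<in> Hom C Y W" and "v \<in> Hom C Y W" and "u \<cdot> k = v \<cdot> k"
  shows "u = v"
proof -
  have "(u \<boxplus> neg C v) \<cdot> k = Zero C X W"
    using comp_add_left[OF assms(1,3) neg_hom[OF assms(4)]] neg_comp[OF assms(1,4)]
      add_neg[OF comp_hom[OF assms(1,4)]] assms(5) by simp
  then show ?thesis
    using assms(2)[of "u \<boxplus> neg C v"] assms(3,4) by (simp add: add_hom neg_hom add_neg_eq_zero_iff)
qed

lemma zero_object_obj: "zero_object C Z \<Longrightarrow> Z \<in> Obj C"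
  unfolding zero_object_def by blast

lemma zero_object_null:
  assumes Z: "zero_object C Z"
  shows "null C Z X" and "null C X Z"
proof -
  have "f = Zero C Z X" if f: "f \<in> Hom C Z X" for f
  proof -
    have "\<exists>!f. f \<in> Hom C Z X" using Z hom_cod[OF f] unfolding zero_object_def by blast
    then show ?thesis using f zero_hom[OF hom_dom[OF f] hom_cod[OF f]] by blast
  qed
  then show "null C Z X" by (rule nullI)
  have "f = Zero C X Z" if f: "f \<in> Hom C X Z" for f
  proof -
    have "\<exists>!f. f \<in> Hom C X Z" using Z hom_dom[OF f] unfolding zero_object_def by blast
    then show ?thesis using f zero_hom[OF hom_dom[OF f] hom_cod[OF f]] by blast
  qed
  then show "null C X Z" by (rule nullI)
qed

lemma zero_object_iff_id: "zero_object C Z \<longleftrightarrow> Z \<in> Obj C \<and> Id C Z = Zero C Z Z"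
proof
  assume "zero_object C Z"
  then show "Z \<in> Obj C \<and> Id C Z = Zero C Z Z"
    using zero_object_obj zero_object_null(1) nullD id_hom by metis
next
  assume Z: "Z \<in> Obj C \<and> Id C Z = Zero C Z Z"
  have "f = Zero C X Z" if "f \<in> Hom C X Z" for f X
    using that Z comp_zero_left id_left by metis
  moreover have "f = Zero C Z X" if "f \<in> Hom C Z X" for f X
    using that Z comp_zero_right id_right by metis
  ultimately show "zero_object C Z" unfolding zero_object_def using Z zero_hom by metis
qed

lemma zero_object_if_null: "\<lbrakk>Z \<in> Obj C; null C Z Z\<rbrakk> \<Longrightarrow> zero_object C Z"
  by (simp add: zero_object_iff_id nullD id_hom)

lemma null_isomorphic_left:
  assumes "isomorphic C X Y" and "null C X W"
  shows "null C Y W"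
proof (rule nullI)
  fix u assume u: "u \<in> Hom C Y W"
  obtain f g where f: "f \<in> Hom C X Y" and g: "g \<in> Hom C Y X" "f \<cdot> g = Id C Y"
    using assms(1) unfolding isomorphic_def by (meson is_isoE)
  have "u = (u \<cdot> f) \<cdot> g" using u f g by (simp add: comp_assoc[of g Y X f] id_right)
  also have "u \<cdot> f = Zero C X W" by (rule nullD[OF assms(2) comp_hom[OF f u]])
  finally show "u = Zero C Y W" using g u by (simp add: comp_zero_left hom_cod)
qed

lemma null_isomorphic_right:
  assumes "isomorphic C X Y" and "null C W X"
  shows "null C W Y"
proof (rule nullI)
  fix u assume u: "u \<in> Hom C W Y"
  obtain f g where f: "f \<in> Hom C X Y" and g: "g \<in> Hom C Y X" "f \<cdot> g = Id C Y"
    using assms(1) unfolding isomorphic_def by (meson is_isoE)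
  have "u = f \<cdot> (g \<cdot> u)" using u f g by (metis comp_assoc id_left)
  also have "g \<cdot> u = Zero C W X" by (rule nullD[OF assms(2) comp_hom[OF u g(1)]])
  finally show "u = Zero C W Y" using f u by (simp add: comp_zero_right hom_dom)
qed

lemma comp_null_left:
  assumes "p \<in> Hom C W X" and "i \<in> Hom C X Y" and "u \<in> Hom C Y Z" and "null C X Z"
  shows "u \<cdot> (i \<cdot> p) = Zero C W Z"
proof -
  have "u \<cdot> (i \<cdot> p) = (u \<cdot> i) \<cdot> p" by (rule comp_assoc[symmetric, OF assms(1-3)])
  also have "u \<cdot> i = Zero C X Z" by (rule nullD[OF assms(4) comp_hom[OF assms(2,3)]])
  finally show ?thesis by (simp add: comp_zero_left[OF assms(1) hom_cod[OF assms(3)]])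
qed

lemma comp_null_right:
  assumes "u \<in> Hom C W X" and "p \<in> Hom C X Y" and "i \<in> Hom C Y Z" and "null C W Y"
  shows "(i \<cdot> p) \<cdot> u = Zero C W Z"
proof -
  have "(i \<cdot> p) \<cdot> u = i \<cdot> (p \<cdot> u)" by (rule comp_assoc[OF assms(1-3)])
  also have "p \<cdot> u = Zero C W Y" by (rule nullD[OF assms(4) comp_hom[OF assms(1,2)]])
  finally show ?thesis by (simp add: comp_zero_right[OF assms(3) hom_dom[OF assms(1)]])
qed

text \<open>The identity of \<open>B\<close> splits into a part through \<open>X\<close> and a part
  through \<open>Y\<close>. Since both halves of a t-structure are orthogonals, this will place
  biproducts of objects of the heart in the heart.\<close>

lemma biproduct_null_left:
  assumes "i \<in> Hom C X B" "j \<in> Hom C Y B" "p \<in> Hom C B X" "q \<in> Hom C B Y"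
    and "(i \<cdot> p) \<boxplus> (j \<cdot> q) = Id C B" and "null C X W" and "null C Y W"
  shows "null C B W"
proof (rule nullI)
  fix u assume u: "u \<in> Hom C B W"
  have ip: "i \<cdot> p \<in> Hom C B B" and jq: "j \<cdot> q \<in> Hom C B B"
    by (rule comp_hom[OF assms(3,1)], rule comp_hom[OF assms(4,2)])
  have "u = (u \<cdot> (i \<cdot> p)) \<boxplus> (u \<cdot> (j \<cdot> q))"
    using u comp_add_right[OF ip jq u] assms(5) by (simp add: id_right)
  also have "u \<cdot> (i \<cdot> p) = Zero C B W" by (rule comp_null_left[OF assms(3,1) u assms(6)])
  also have "u \<cdot> (j \<cdot> q) = Zero C B W" by (rule comp_null_left[OF assms(4,2) u assms(7)])
  finally show "u = Zero C B W" by (simp add: add_zero zero_hom hom_cod[OF u] hom_dom[OF u])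
qed

lemma biproduct_null_right:
  assumes "i \<in> Hom C X B" "j \<in> Hom C Y B" "p \<in> Hom C B X" "q \<in> Hom C B Y"
    and "(i \<cdot> p) \<boxplus> (j \<cdot> q) = Id C B" and "null C W X" and "null C W Y"
  shows "null C W B"
proof (rule nullI)
  fix u assume u: "u \<in> Hom C W B"
  have ip: "i \<cdot> p \<in> Hom C B B" and jq: "j \<cdot> q \<in> Hom C B B"
    by (rule comp_hom[OF assms(3,1)], rule comp_hom[OF assms(4,2)])
  have "u = ((i \<cdot> p) \<cdot> u) \<boxplus> ((j \<cdot> q) \<cdot> u)"
    using u comp_add_left[OF u ip jq] assms(5) by (simp add: id_left)
  also have "(i \<cdot> p) \<cdot> u = Zero C W B" by (rule comp_null_right[OF u assms(3,1,6)])
  also have "(j \<cdot> q) \<cdot> u = Zero C W B" by (rule comp_null_right[OF u assms(4,2,7)])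
  finally show "u = Zero C W B" by (simp add: add_zero zero_hom hom_cod[OF u] hom_dom[OF u])
qed

end

section \<open>Triangulated categories\<close>

context triangulated_category
begin

abbreviation sh :: "'o \<Rightarrow> 'o" where "sh \<equiv> Ob (Shift D)"

abbreviation sha :: "'m \<Rightarrow> 'm" where "sha \<equiv> Ar (Shift D)"

lemma shift_obj: "X \<in> Obj D \<Longrightarrow> sh X \<in> Obj D"
  using shift_bij_obj unfolding bij_betw_def by blast

lemma unshift_obj:
  assumes "X \<in> Obj D" obtains X' where "X' \<in> Obj D" "sh X' = X"
proof -
  have "X \<in> sh ` Obj D" using assms shift_bij_obj unfolding bij_betw_def by simp
  then show ?thesis using that by blast
qed

lemma shift_functor: "is_functor D D (Shift D)"
  using shift_additive unfolding additive_functor_def by blast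

lemma shift_hom: "f \<in> Hom D X Y \<Longrightarrow> sha f \<in> Hom D (sh X) (sh Y)"
  using shift_functor unfolding is_functor_def by blast

lemma shift_id: "X \<in> Obj D \<Longrightarrow> sha (Id D X) = Id D (sh X)"
  using shift_functor unfolding is_functor_def by blast

lemma shift_comp: "\<lbrakk>f \<in> Hom D X Y; g \<in> Hom D Y Z\<rbrakk> \<Longrightarrow> sha (g \<cdot> f) = sha g \<cdot> sha f"
  using shift_functor unfolding is_functor_def by blast

lemma shift_add: "\<lbrakk>f \<in> Hom D X Y; g \<in> Hom D X Y\<rbrakk> \<Longrightarrow> sha (f \<boxplus> g) = sha f \<boxplus> sha g"
  using shift_additive unfolding additive_functor_def by blast

lemma shift_zero:
  assumes "X \<in> Obj D" and "Y \<in> Obj D"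
  shows "sha (Zero D X Y) = Zero D (sh X) (sh Y)"
proof (rule idem_zero[OF shift_hom[OF zero_hom[OF assms]]])
  have z: "Zero D X Y \<in> Hom D X Y" by (rule zero_hom[OF assms])
  show "sha (Zero D X Y) \<boxplus> sha (Zero D X Y) = sha (Zero D X Y)"
    using shift_add[OF z z] add_zero[OF z] by simp
qed

lemma shift_inj: "\<lbrakk>sha f = sha g; f \<in> Hom D X Y; g \<in> Hom D X' Y'\<rbrakk> \<Longrightarrow> f = g"
  by (rule inj_onD[OF bij_betw_imp_inj_on[OF shift_bij_arr]]) (auto simp: Hom_def)

lemma shift_inj_obj: "\<lbrakk>sh X = sh Y; X \<in> Obj D; Y \<in> Obj D\<rbrakk> \<Longrightarrow> X = Y"
  by (rule inj_onD[OF bij_betw_imp_inj_on[OF shift_bij_obj]])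

text \<open>Bijectivity of the shift on all arrows does not by itself locate the ends of the
  preimage; injectivity on objects does.\<close>

lemma unshift_hom:
  assumes "u \<in> Hom D (sh X) (sh Y)" and "X \<in> Obj D" and "Y \<in> Obj D"
  obtains v where "v \<in> Hom D X Y" "sha v = u"
proof -
  have "u \<in> Arr D" using assms(1) unfolding Hom_def by blast
  then have "u \<in> sha ` Arr D" using shift_bij_arr unfolding bij_betw_def by simp
  then obtain v where v: "v \<in> Arr D" "sha v = u" by blast
  have "sha v \<in> Hom D (sh (Dom D v)) (sh (Cod D v))" by (rule shift_hom[OF arr_hom[OF v(1)]])
  then have "sh (Dom D v) = sh X" "sh (Cod D v) = sh Y"
    using assms(1) v(2) unfolding Hom_def by auto
  then have "Dom D v = X" "Cod D v = Y"
    using shift_inj_obj dom_obj cod_obj v(1) assms(2,3) by blast+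
  then show ?thesis using that[of v] v arr_hom[OF v(1)] by simp
qed

lemma null_shift:
  assumes "X \<in> Obj D" and "Y \<in> Obj D"
  shows "null D (sh X) (sh Y) \<longleftrightarrow> null D X Y"
proof
  assume n: "null D (sh X) (sh Y)"
  show "null D X Y"
  proof (rule nullI)
    fix f assume f: "f \<in> Hom D X Y"
    have "sha f = sha (Zero D X Y)"
      using nullD[OF n shift_hom[OF f]] shift_zero[OF assms] by simp
    then show "f = Zero D X Y" by (rule shift_inj[OF _ f zero_hom[OF assms]])
  qed
next
  assume n: "null D X Y"
  show "null D (sh X) (sh Y)"
  proof (rule nullI)
    fix f assume f: "f \<in> Hom D (sh X) (sh Y)"
    obtain g where g: "g \<in> Hom D X Y" "sha g = f" by (rule unshift_hom[OF f assms])
    show "f = Zero D (sh X) (sh Y)" using nullD[OF n g(1)] g(2) shift_zero[OF assms] by simp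
  qed
qed

lemma isomorphic_shift:
  assumes "isomorphic D X Y"
  shows "isomorphic D (sh X) (sh Y)"
proof -
  obtain f g where f: "f \<in> Hom D X Y" "g \<in> Hom D Y X" "g \<cdot> f = Id D X" "f \<cdot> g = Id D Y"
    using assms unfolding isomorphic_def by (meson is_isoE)
  have "sha g \<cdot> sha f = Id D (sh X)"
    using shift_comp[OF f(1,2)] f(3) shift_id[OF hom_dom[OF f(1)]] by simp
  moreover have "sha f \<cdot> sha g = Id D (sh Y)"
    using shift_comp[OF f(2,1)] f(4) shift_id[OF hom_cod[OF f(1)]] by simp
  ultimately show ?thesis
    using isomorphicI[OF is_isoI shift_hom[OF f(1)]] shift_hom f(1,2) by blast
qed

lemma zero_object_shift:
  assumes "zero_object D Z"
  shows "zero_object D (sh Z)"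
  using assms shift_id[of Z] shift_zero[of Z Z] shift_obj[of Z] by (simp add: zero_object_iff_id)

text \<open>\<open>Dist\<close> records only the morphisms; carrying the vertices along makes the
  typing of each morphism available without computing \<open>Dom\<close> and
  \<open>Cod\<close>.\<close>

definition dtri :: "'o \<Rightarrow> 'o \<Rightarrow> 'o \<Rightarrow> 'm \<Rightarrow> 'm \<Rightarrow> 'm \<Rightarrow> bool" where
  "dtri X Y Z f g h \<longleftrightarrow> (f, g, h) \<in> Dist D \<and>
    f \<in> Hom D X Y \<and> g \<in> Hom D Y Z \<and> h \<in> Hom D Z (sh X)"

lemma dtriD:
  assumes "dtri X Y Z f g h"
  shows "(f, g, h) \<in> Dist D" "f \<in> Hom D X Y" "g \<in> Hom D Y Z" "h \<in> Hom D Z (sh X)"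
    "X \<in> Obj D" "Y \<in> Obj D" "Z \<in> Obj D"
  using assms hom_dom hom_cod unfolding dtri_def by blast+

lemma dtriI:
  assumes "(f, g, h) \<in> Dist D"
  shows "dtri (Dom D f) (Dom D g) (Cod D g) f g h"
  using assms dist_triangle[OF assms] unfolding dtri_def is_triangle_def Hom_def by auto

lemma dtriI':
  assumes "(f, g, h) \<in> Dist D" "f \<in> Hom D X Y" "g \<in> Hom D Y Z"
  shows "dtri X Y Z f g h"
  using dtriI[OF assms(1)] assms(2,3) unfolding Hom_def by auto

lemma dtri_triangle: "dtri X Y Z f g h \<Longrightarrow> is_triangle D f g h"
  unfolding dtri_def is_triangle_def by blast

lemma dtri_rotate: "dtri X Y Z f g h \<Longrightarrow> dtri Y Z (sh X) g h (neg D (sha f))"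
  using TR2[OF dtri_triangle, of X Y Z f g h] unfolding dtri_def
  by (auto intro: neg_hom shift_hom)

text \<open>The new first morphism \<open>k\<close> is chosen with \<open>sha k = neg D h\<close>,
  so that the sign introduced by TR2 cancels. The object \<open>Z'\<close> is Z[-1], which exists
  strictly because the shift is an automorphism.\<close>

lemma dtri_unrotate:
  assumes "dtri X Y Z f g h" and "Z' \<in> Obj D" and "sh Z' = Z"
  obtains k where "dtri Z' X Y k f g"
proof -
  note t = dtriD[OF assms(1)]
  have "neg D h \<in> Hom D (sh Z') (sh X)" using neg_hom[OF t(4)] assms(3) by simp
  then obtain k where k: "k \<in> Hom D Z' X" "sha k = neg D h"
    by (rule unshift_hom[OF _ assms(2) t(5)])
  have h: "h = neg D (sha k)" using k(2) neg_neg[OF t(4)] by simp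
  have "is_triangle D k f g" unfolding is_triangle_def using k(1) t(2,3) assms(3) by blast
  from TR2[OF this] have "(k, f, g) \<in> Dist D" using t(1) h by simp
  then show ?thesis using that[of k] k(1) t(2,3) assms(3) unfolding dtri_def by simp
qed

lemma cone_ex:
  assumes "f \<in> Hom D X Y"
  obtains Z g h where "dtri X Y Z f g h"
proof -
  have "f \<in> Arr D" using assms unfolding Hom_def by blast
  then obtain g h where gh: "(f, g, h) \<in> Dist D" using TR1_cone by blast
  have "dtri X Y (Cod D g) f g h"
    using dtriI[OF gh] assms unfolding dtri_def Hom_def by auto
  then show ?thesis by (rule that)
qed

lemma fibre_ex:
  assumes "g \<in> Hom D Y Z"
  obtains X f h where "dtri X Y Z f g h"
proof -
  obtain W a b where t: "dtri Y Z W g a b" by (rule cone_ex[OF assms])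
  obtain X where X: "X \<in> Obj D" "sh X = W" by (rule unshift_obj[OF dtriD(7)[OF t]])
  obtain f where "dtri X Y Z f g a" by (rule dtri_unrotate[OF t X])
  then show ?thesis by (rule that)
qed

lemma dtri_id: "\<lbrakk>X \<in> Obj D; zero_object D Z\<rbrakk>
    \<Longrightarrow> dtri X X Z (Id D X) (Zero D X Z) (Zero D Z (sh X))"
  unfolding dtri_def by (simp add: TR1_id id_hom zero_hom zero_object_obj shift_obj)

lemma dtri_morphism:
  assumes "dtri X Y Z f g h" and "dtri X' Y' Z' f' g' h'"
    and "u \<in> Hom D X X'" and "v \<in> Hom D Y Y'" and "v \<cdot> f = f' \<cdot> u"
  obtains w where "w \<in> Hom D Z Z'" "w \<cdot> g = g' \<cdot> v" "sha u \<cdot> h = h' \<cdot> w"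
proof -
  note t = dtriD[OF assms(1)] and t' = dtriD[OF assms(2)]
  have doms: "Dom D f = X" "Dom D g = Y" "Dom D h = Z" "Dom D f' = X'" "Dom D g' = Y'" "Dom D h' = Z'"
    using t(2-4) t'(2-4) unfolding Hom_def by auto
  show ?thesis
    using TR3[OF t(1) t'(1), of u v] assms(3-5) that doms unfolding triangle_morphism_def by auto
qed

text \<open>By TR3 the triangle \<open>X -> X -> 0\<close> maps to the given one, so the composite
  factors through a zero object.\<close>

lemma dtri_comp_zero:
  assumes "dtri X Y Z f g h"
  shows "g \<cdot> f = Zero D X Z"
proof -
  note t = dtriD[OF assms]
  obtain O' where z: "zero_object D O'" using ex_zero_object by blast
  obtain w where w: "w \<in> Hom D O' Z" "w \<cdot> Zero D X O' = g \<cdot> f"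
    by (rule dtri_morphism[OF dtri_id[OF t(5) z] assms id_hom[OF t(5)] t(2)]) blast
  then show ?thesis using comp_zero_right[OF w(1) t(5)] by simp
qed

text \<open>A morphism \<open>u\<close> killing \<open>f\<close> extends, by TR3, to a morphism into
  the triangle \<open>0 -> W -> W\<close>, which is an unrotated identity triangle; the third
  component is the factorisation.\<close>

lemma weak_cokernel:
  assumes "dtri X Y Z f g h" and u: "u \<in> Hom D Y W" and "u \<cdot> f = Zero D X W"
  obtains v where "v \<in> Hom D Z W" "v \<cdot> g = u"
proof -
  note t = dtriD[OF assms(1)]
  have W: "W \<in> Obj D" by (rule hom_cod[OF u])
  obtain O' where z: "zero_object D O'" using ex_zero_object by blast
  note O' = zero_object_obj[OF z]
  obtain k where k: "dtri O' W W k (Id D W) (Zero D W (sh O'))"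
    by (rule dtri_unrotate[OF dtri_id[OF W zero_object_shift[OF z]] O' refl])
  have "u \<cdot> f = k \<cdot> Zero D X O'"
    using assms(3) comp_zero_right[OF dtriD(2)[OF k] t(5)] by simp
  then obtain v where v: "v \<in> Hom D Z W" "v \<cdot> g = Id D W \<cdot> u"
    by (rule dtri_morphism[OF assms(1) k zero_hom[OF t(5) O'] u])
  show ?thesis by (rule that[OF v(1)]) (use v(2) id_left[OF u] in simp)
qed

text \<open>TR3 completes only the third component, so both the identity triangle of
  \<open>W\<close> and the given triangle are rotated first. The factorisation then appears shifted,
  between \<open>sh W\<close> and \<open>sh X\<close>, and the two signs of the rotations
  cancel.\<close>

lemma weak_kernel:
  assumes "dtri X Y Z f g h" and u: "u \<in> Hom D W Y" and "g \<cdot> u = Zero D W Z"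
  obtains v where "v \<in> Hom D W X" "f \<cdot> v = u"
proof -
  note t = dtriD[OF assms(1)]
  have W: "W \<in> Obj D" by (rule hom_dom[OF u])
  obtain O' where z: "zero_object D O'" using ex_zero_object by blast
  note O' = zero_object_obj[OF z]
  have "Zero D O' Z \<cdot> Zero D W O' = g \<cdot> u"
    using assms(3) comp_zero_left[OF zero_hom[OF W O'] t(7)] by simp
  then obtain w where w: "w \<in> Hom D (sh W) (sh X)"
      "sha u \<cdot> neg D (sha (Id D W)) = neg D (sha f) \<cdot> w"
    by (rule dtri_morphism[OF dtri_rotate[OF dtri_id[OF W z]] dtri_rotate[OF assms(1)] u
          zero_hom[OF O' t(7)]])
  obtain v where v: "v \<in> Hom D W X" "sha v = w" by (rule unshift_hom[OF w(1) W t(5)])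
  have "neg D (sha u) = neg D (sha f) \<cdot> w"
    using w(2) comp_neg[OF shift_hom[OF id_hom[OF W]] shift_hom[OF u]] shift_id[OF W]
      id_right[OF shift_hom[OF u]] by simp
  also have "\<dots> = neg D (sha (f \<cdot> v))"
    using neg_comp[OF w(1) shift_hom[OF t(2)]] shift_comp[OF v(1) t(2)] v(2) by simp
  finally have "sha u = sha (f \<cdot> v)"
    by (rule neg_inj[OF _ shift_hom[OF u] shift_hom[OF comp_hom[OF v(1) t(2)]]])
  then have "u = f \<cdot> v" by (rule shift_inj[OF _ u comp_hom[OF v(1) t(2)]])
  then show ?thesis using that v(1) by simp
qed

section \<open>Vanishing of Hom along a triangle, and uniqueness of cones\<close>

lemma null_middle_left:
  assumes "dtri X Y Z f g h" and "null D X W" and "null D Z W"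
  shows "null D Y W"
proof (rule nullI)
  note t = dtriD[OF assms(1)]
  fix u assume u: "u \<in> Hom D Y W"
  obtain v where v: "v \<in> Hom D Z W" "v \<cdot> g = u"
    by (rule weak_cokernel[OF assms(1) u nullD[OF assms(2) comp_hom[OF t(2) u]]])
  show "u = Zero D Y W"
    using v nullD[OF assms(3) v(1)] comp_zero_left[OF t(3) hom_cod[OF u]] by simp
qed

lemma null_middle_right:
  assumes "dtri X Y Z f g h" and "null D W X" and "null D W Z"
  shows "null D W Y"
proof (rule nullI)
  note t = dtriD[OF assms(1)]
  fix u assume u: "u \<in> Hom D W Y"
  obtain v where v: "v \<in> Hom D W X" "f \<cdot> v = u"
    by (rule weak_kernel[OF assms(1) u nullD[OF assms(3) comp_hom[OF u t(3)]]])
  show "u = Zero D W Y"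
    using v nullD[OF assms(2) v(1)] comp_zero_right[OF t(2) hom_dom[OF u]] by simp
qed

lemmas null_cone_left = null_middle_left[OF dtri_rotate]

lemma null_fibre_right:
  assumes "dtri X Y Z f g h" and "Z' \<in> Obj D" and "sh Z' = Z" and "null D W Y" and "null D W Z'"
  shows "null D W X"
  by (rule dtri_unrotate[OF assms(1-3)]) (rule null_middle_right[OF _ assms(5,4)])

text \<open>A morphism killed by \<open>f\<close> factors through Z[-1], here \<open>Z'\<close>. For
  sources orthogonal to Z[-1] the weak kernel is therefore a genuine one.\<close>

lemma dtri_first_mono:
  assumes "dtri X Y Z f g h" and Z': "Z' \<in> Obj D" "sh Z' = Z" and "null D W Z'"
    and w: "w \<in> Hom D W X" "f \<cdot> w = Zero D W Y"
  shows "w = Zero D W X"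
proof -
  obtain k where k: "dtri Z' X Y k f g" by (rule dtri_unrotate[OF assms(1) Z'])
  obtain a where a: "a \<in> Hom D W Z'" "k \<cdot> a = w" by (rule weak_kernel[OF k w])
  then show ?thesis
    using nullD[OF assms(4) a(1)] comp_zero_right[OF dtriD(2)[OF k] hom_dom[OF w(1)]] by simp
qed

lemma dtri_second_epi:
  assumes "dtri X Y Z f g h" and "null D (sh X) W"
    and w: "w \<in> Hom D Z W" "w \<cdot> g = Zero D Y W"
  shows "w = Zero D Z W"
proof -
  note t = dtriD[OF assms(1)]
  obtain a where a: "a \<in> Hom D (sh X) W" "a \<cdot> h = w"
    by (rule weak_cokernel[OF dtri_rotate[OF assms(1)] w])
  then show ?thesis
    using nullD[OF assms(2) a(1)] comp_zero_left[OF t(4) hom_cod[OF w(1)]] by simp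
qed

text \<open>The identity of \<open>Y\<close> lifts along \<open>f\<close> because its image in
  \<open>Z\<close> is zero; this right inverse is two-sided because \<open>f\<close> can be
  cancelled on the left, Hom(X, Z[-1]) being zero.\<close>

lemma iso_if_cone_zero:
  assumes "dtri X Y Z f g h" and z: "zero_object D Z"
  shows "is_iso D f"
proof -
  note t = dtriD[OF assms(1)]
  obtain v where v: "v \<in> Hom D Y X" "f \<cdot> v = Id D Y"
    by (rule weak_kernel[OF assms(1) id_hom[OF t(6)]
          nullD[OF zero_object_null(2)[OF z] comp_hom[OF id_hom[OF t(6)] t(3)]]])
  obtain Z' where Z': "Z' \<in> Obj D" "sh Z' = Z" by (rule unshift_obj[OF t(7)])
  have "null D X Z'"
    using null_shift[OF t(5) Z'(1)] Z'(2) zero_object_null(2)[OF z] by simp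
  note this = dtri_first_mono[OF assms(1) Z' this]
  note cancel = comp_left_cancel[OF t(2) this comp_hom[OF t(2) v(1)] id_hom[OF t(5)]]
  have "f \<cdot> (v \<cdot> f) = f \<cdot> Id D X"
    using comp_assoc[OF t(2) v(1) t(2)] v(2) id_left[OF t(2)] id_right[OF t(2)] by simp
  then have "v \<cdot> f = Id D X" by (rule cancel[rotated 2])
  then show ?thesis by (rule is_isoI[OF t(2) v(1) _ v(2)])
qed

lemma iso_if_fibre_zero:
  assumes "dtri X Y Z f g h" and z: "zero_object D X"
  shows "is_iso D g"
  by (rule iso_if_cone_zero[OF dtri_rotate[OF assms(1)] zero_object_shift[OF z]])

text \<open>
  An endomorphism \<open>e\<close> of the third vertex over the identities of the other two is unipotent:
  \<open>e - 1\<close> factors through \<open>h\<close> and \<open>h (e - 1) = 0\<close>, hence \<open>(e - 1)\<^sup>2 = 0\<close>.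
\<close>

lemma unipotent_iso:
  assumes "dtri X Y Z f g h" and e: "e \<in> Hom D Z Z" and "e \<cdot> g = g" and "h \<cdot> e = h"
  shows "\<exists>d \<in> Hom D Z Z. d \<cdot> e = Id D Z \<and> e \<cdot> d = Id D Z"
proof -
  note t = dtriD[OF assms(1)]
  note i = id_hom[OF t(7)]
  define n where "n = e \<boxplus> neg D (Id D Z)"
  have n: "n \<in> Hom D Z Z" unfolding n_def by (rule add_hom[OF e neg_hom[OF i]])
  have "n \<cdot> g = Zero D Y Z"
    unfolding n_def comp_add_left[OF t(3) e neg_hom[OF i]] neg_comp[OF t(3) i]
    using assms(3) id_left[OF t(3)] add_neg[OF t(3)] by simp
  then obtain a where a: "a \<in> Hom D (sh X) Z" "a \<cdot> h = n"
    by (rule weak_cokernel[OF dtri_rotate[OF assms(1)] n])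
  have hn: "h \<cdot> n = Zero D Z (sh X)"
    unfolding n_def comp_add_right[OF e neg_hom[OF i] t(4)] comp_neg[OF i t(4)]
    using assms(4) id_right[OF t(4)] add_neg[OF t(4)] by simp
  have "n \<cdot> n = a \<cdot> (h \<cdot> n)"
    using comp_assoc[OF n t(4) a(1)] a(2) by simp
  then have nn: "n \<cdot> n = Zero D Z Z" using hn comp_zero_right[OF a(1) t(7)] by simp
  have "n \<boxplus> Id D Z = e \<boxplus> (Id D Z \<boxplus> neg D (Id D Z))"
    unfolding n_def
    by (simp add: add_assoc[OF e neg_hom[OF i] i] add_commute[OF i neg_hom[OF i]])
  then have en: "e = Id D Z \<boxplus> n"
    using add_neg[OF i] add_zero[OF e] add_commute[OF n i] by simp
  define d where "d = Id D Z \<boxplus> neg D n"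
  have d: "d \<in> Hom D Z Z" unfolding d_def by (rule add_hom[OF i neg_hom[OF n]])
  note nn' = neg_hom[OF n]
  have z: "Zero D Z Z \<in> Hom D Z Z" by (rule zero_hom[OF t(7) t(7)])
  have "d \<cdot> n = n"
    unfolding d_def comp_add_left[OF n i nn'] neg_comp[OF n n] nn neg_zero[OF t(7) t(7)] id_left[OF n]
    by (rule add_zero[OF n])
  moreover have "n \<cdot> d = n"
    unfolding d_def comp_add_right[OF i nn' n] comp_neg[OF n n] nn neg_zero[OF t(7) t(7)] id_right[OF n]
    by (rule add_zero[OF n])
  moreover have "d \<boxplus> n = Id D Z"
    unfolding d_def add_assoc[OF i nn' n] add_commute[OF nn' n] add_neg[OF n] by (rule add_zero[OF i])
  ultimately have "d \<cdot> e = Id D Z" "e \<cdot> d = Id D Z"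
    unfolding en comp_add_right[OF i n d] comp_add_left[OF d i n] id_left[OF d] id_right[OF d]
    by simp_all
  then show ?thesis using d by blast
qed

lemma iso_if_inverses:
  assumes u: "u \<in> Hom D X Y" and l: "l \<in> Hom D Y X" "l \<cdot> u = Id D X"
    and r: "r \<in> Hom D Y X" "u \<cdot> r = Id D Y"
  shows "is_iso D u"
proof -
  have "l = l \<cdot> (u \<cdot> r)" using r(2) id_right[OF l(1)] by simp
  also have "\<dots> = r" using comp_assoc[OF r(1) u l(1)] l(2) id_left[OF r(1)] by simp
  finally show ?thesis using is_isoI[OF u r(1)] l(2) r(2) by simp
qed

text \<open>TR3 gives fill-ins in both directions. Their composites need not be identities, but they
  are unipotent, hence invertible, so \<open>w\<close> has a left and a right inverse.\<close>

lemma cone_unique: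
  assumes T: "dtri X Y Z f g h" and T': "dtri X Y Z' f g' h'"
  obtains w where "w \<in> Hom D Z Z'" "is_iso D w" "w \<cdot> g = g'" "h' \<cdot> w = h"
proof -
  note t = dtriD[OF T] and t' = dtriD[OF T']
  have ff: "Id D Y \<cdot> f = f \<cdot> Id D X" using id_left[OF t(2)] id_right[OF t(2)] by simp
  note hs = id_left[OF t(4)] id_left[OF t'(4)] id_right[OF t(3)] id_right[OF t'(3)] shift_id[OF t(5)]
  obtain w where w: "w \<in> Hom D Z Z'" "w \<cdot> g = g'" "h' \<cdot> w = h"
    by (rule dtri_morphism[OF T T' id_hom[OF t(5)] id_hom[OF t(6)] ff]) (simp add: hs)
  obtain w' where w': "w' \<in> Hom D Z' Z" "w' \<cdot> g' = g" "h \<cdot> w' = h'"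
    by (rule dtri_morphism[OF T' T id_hom[OF t(5)] id_hom[OF t(6)] ff]) (simp add: hs)
  have "(w' \<cdot> w) \<cdot> g = g" "h \<cdot> (w' \<cdot> w) = h"
    using comp_assoc[OF t(3) w(1) w'(1)] comp_assoc[OF w(1) w'(1) t(4)] w w' by simp_all
  from unipotent_iso[OF T comp_hom[OF w(1) w'(1)] this]
  obtain d where d: "d \<in> Hom D Z Z" "d \<cdot> (w' \<cdot> w) = Id D Z" by blast
  have "(w \<cdot> w') \<cdot> g' = g'" "h' \<cdot> (w \<cdot> w') = h'"
    using comp_assoc[OF t'(3) w'(1) w(1)] comp_assoc[OF w'(1) w(1) t'(4)] w w' by simp_all
  from unipotent_iso[OF T' comp_hom[OF w'(1) w(1)] this]
  obtain d' where d': "d' \<in> Hom D Z' Z'" "(w \<cdot> w') \<cdot> d' = Id D Z'" by blast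
  have "is_iso D w"
  proof (rule iso_if_inverses[OF w(1)])
    show "d \<cdot> w' \<in> Hom D Z' Z" by (rule comp_hom[OF w'(1) d(1)])
    show "(d \<cdot> w') \<cdot> w = Id D Z" using comp_assoc[OF w(1) w'(1) d(1)] d(2) by simp
    show "w' \<cdot> d' \<in> Hom D Z' Z" by (rule comp_hom[OF d'(1) w'(1)])
    show "w \<cdot> (w' \<cdot> d') = Id D Z'" using comp_assoc[OF d'(1) w'(1) w(1)] d'(2) by simp
  qed
  then show ?thesis by (rule that[OF w(1) _ w(2,3)])
qed

lemma iso_dtri_third:
  assumes "dtri X Y Z f g h" and w: "w \<in> Hom D Z Z'" "is_iso D w"
  shows "\<exists>h'. dtri X Y Z' f (w \<cdot> g) h'"
proof -
  note t = dtriD[OF assms(1)]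
  obtain v where v: "v \<in> Hom D Z' Z" "v \<cdot> w = Id D Z" by (rule is_isoE[OF w(2,1)])
  have wg: "w \<cdot> g \<in> Hom D Y Z'" and hv: "h \<cdot> v \<in> Hom D Z' (sh X)"
    by (rule comp_hom[OF t(3) w(1)], rule comp_hom[OF v(1) t(4)])
  have iso_id: "is_iso D (Id D A)" if "A \<in> Obj D" for A
    by (rule is_isoI[OF id_hom id_hom id_left id_left]) (rule that id_hom)+
  have doms: "Dom D f = X" "Dom D g = Y" "Dom D h = Z" "Dom D (w \<cdot> g) = Y" "Dom D (h \<cdot> v) = Z'"
    using t(2-4) wg hv unfolding Hom_def by auto
  have "(h \<cdot> v) \<cdot> w = h" using comp_assoc[OF w(1) v(1) t(4)] v(2) id_right[OF t(4)] by simp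
  then have "triangle_morphism D (f, g, h) (f, w \<cdot> g, h \<cdot> v) (Id D X) (Id D Y) w"
    unfolding triangle_morphism_def
    using id_hom[OF t(5)] id_hom[OF t(6)] w(1) id_left[OF t(2)] id_right[OF t(2)] id_right[OF wg]
      shift_id[OF t(5)] id_left[OF t(4)] by (simp add: doms)
  moreover have "is_triangle D f (w \<cdot> g) (h \<cdot> v)"
    unfolding is_triangle_def using t(2) wg hv by blast
  ultimately have "(f, w \<cdot> g, h \<cdot> v) \<in> Dist D"
    using TR1_iso[OF t(1)] iso_id t(5,6) w(2) by blast
  then show ?thesis using t(2) wg hv unfolding dtri_def by blast
qed

text \<open>After rotation the fibres are shifted cones of the same \<open>g\<close>; the
  isomorphism between \<open>sh X\<close> and \<open>sh X'\<close> is then unshifted together with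
  its inverse.\<close>

lemma fibre_unique:
  assumes T: "dtri X Y Z f g h" and T': "dtri X' Y Z f' g h'"
  shows "isomorphic D X X'"
proof -
  note t = dtriD[OF T] and t' = dtriD[OF T']
  obtain w where w: "w \<in> Hom D (sh X) (sh X')" "is_iso D w"
    by (rule cone_unique[OF dtri_rotate[OF T] dtri_rotate[OF T']])
  obtain v where v: "v \<in> Hom D (sh X') (sh X)" "v \<cdot> w = Id D (sh X)" "w \<cdot> v = Id D (sh X')"
    by (rule is_isoE[OF w(2,1)])
  obtain a where a: "a \<in> Hom D X X'" "sha a = w" by (rule unshift_hom[OF w(1) t(5) t'(5)])
  obtain b where b: "b \<in> Hom D X' X" "sha b = v" by (rule unshift_hom[OF v(1) t'(5) t(5)])
  have "sha (b \<cdot> a) = sha (Id D X)" "sha (a \<cdot> b) = sha (Id D X')"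
    using shift_comp[OF a(1) b(1)] shift_comp[OF b(1) a(1)] a(2) b(2) v(2,3)
      shift_id[OF t(5)] shift_id[OF t'(5)] by simp_all
  then have "b \<cdot> a = Id D X" "a \<cdot> b = Id D X'"
    using shift_inj comp_hom[OF a(1) b(1)] comp_hom[OF b(1) a(1)] id_hom t(5) t'(5) by blast+
  then show ?thesis by (rule isomorphicI[OF is_isoI[OF a(1) b(1)] a(1)])
qed

text \<open>TR4 in the form in which it is applied below: the cone of a composite is an extension of
  the cone of \<open>g\<close> by the cone of \<open>f\<close>.\<close>

lemma octahedron:
  assumes F: "dtri X Y Z' f a b" and G: "dtri Y Z X' g c d" and GF: "dtri X Z Y' (g \<cdot> f) e k"
  obtains m n l where "dtri Z' Y' X' m n l" "n \<cdot> e = c"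
proof -
  note t = dtriD[OF F] and t' = dtriD[OF G] and t'' = dtriD[OF GF]
  obtain m n where mn: "(m, n, sha a \<cdot> d) \<in> Dist D"
    "triangle_morphism D (f, a, b) (g \<cdot> f, e, k) (Id D X) g m"
    "triangle_morphism D (g \<cdot> f, e, k) (g, c, d) f (Id D Z) n"
    using TR4[OF t(2) t'(2) t(1) t'(1) t''(1)] by blast
  have doms: "Dom D b = Z'" "Dom D k = Y'" "Dom D d = X'"
    using t(4) t''(4) t'(4) unfolding Hom_def by auto
  have "m \<in> Hom D Z' Y'" "n \<in> Hom D Y' X'" "n \<cdot> e = c \<cdot> Id D Z"
    using mn(2,3) doms unfolding triangle_morphism_def by auto
  moreover have "sha a \<cdot> d \<in> Hom D X' (sh Z')" by (rule comp_hom[OF t'(4) shift_hom[OF t(3)]])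
  ultimately have "dtri Z' Y' X' m n (sha a \<cdot> d)" "n \<cdot> e = c"
    using mn(1) id_right[OF t'(3)] unfolding dtri_def by auto
  then show ?thesis by (rule that)
qed

end

section \<open>The heart of a t-structure\<close>

lemma (in additive_category) is_kernelI:
  assumes f: "f \<in> Hom C A B" and k: "k \<in> Hom C K A" and "f \<cdot> k = Zero C K B"
    and ex: "\<And>W u. \<lbrakk>u \<in> Hom C W A; f \<cdot> u = Zero C W B\<rbrakk> \<Longrightarrow> \<exists>v \<in> Hom C W K. k \<cdot> v = u"
    and un: "\<And>W w. \<lbrakk>w \<in> Hom C W K; k \<cdot> w = Zero C W A\<rbrakk> \<Longrightarrow> w = Zero C W K"
  shows "is_kernel C k f"
proof -
  have doms: "f \<in> Arr C" "k \<in> Arr C" "Dom C f = A" "Cod C f = B" "Dom C k = K" "Cod C k = A"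
    using f k unfolding Hom_def by auto
  have "\<exists>!v. v \<in> Hom C W K \<and> k \<cdot> v = u" if u: "u \<in> Hom C W A" "f \<cdot> u = Zero C W B" for W u
  proof -
    obtain v where v: "v \<in> Hom C W K" "k \<cdot> v = u" using ex[OF u] by blast
    have "v' = v" if "v' \<in> Hom C W K" "k \<cdot> v' = u" for v'
      by (rule comp_left_cancel[OF k un that(1) v(1)]) (simp_all add: that v)
    then show ?thesis using v by blast
  qed
  then show ?thesis unfolding is_kernel_def by (simp add: doms assms(3))
qed

lemma (in additive_category) is_cokernelI:
  assumes f: "f \<in> Hom C A B" and c: "c \<in> Hom C B K" and "c \<cdot> f = Zero C A K"
    and ex: "\<And>W u. \<lbrakk>u \<in> Hom C B W; u \<cdot> f = Zero C A W\<rbrakk> \<Longrightarrow> \<exists>v \<in> Hom C K W. v \<cdot> c = u"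
    and un: "\<And>W w. \<lbrakk>w \<in> Hom C K W; w \<cdot> c = Zero C B W\<rbrakk> \<Longrightarrow> w = Zero C K W"
  shows "is_cokernel C c f"
proof -
  have doms: "f \<in> Arr C" "c \<in> Arr C" "Dom C f = A" "Cod C f = B" "Dom C c = B" "Cod C c = K"
    using f c unfolding Hom_def by auto
  have "\<exists>!v. v \<in> Hom C K W \<and> v \<cdot> c = u" if u: "u \<in> Hom C B W" "u \<cdot> f = Zero C A W" for W u
  proof -
    obtain v where v: "v \<in> Hom C K W" "v \<cdot> c = u" using ex[OF u] by blast
    have "v' = v" if "v' \<in> Hom C K W" "v' \<cdot> c = u" for v'
      by (rule comp_right_cancel[OF c un that(1) v(1)]) (simp_all add: that v)
    then show ?thesis using v by blast
  qed
  then show ?thesis unfolding is_cokernel_def by (simp add: doms assms(3))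
qed

lemma (in additive_category) is_kernelD:
  assumes "is_kernel C k f" and f: "f \<in> Hom C A B"
  shows "k \<in> Hom C (Dom C k) A" and "f \<cdot> k = Zero C (Dom C k) B"
    and "\<And>W u. \<lbrakk>u \<in> Hom C W A; f \<cdot> u = Zero C W B\<rbrakk> \<Longrightarrow> \<exists>v \<in> Hom C W (Dom C k). k \<cdot> v = u"
    and "\<And>W u v. \<lbrakk>u \<in> Hom C W (Dom C k); v \<in> Hom C W (Dom C k); k \<cdot> u = k \<cdot> v\<rbrakk> \<Longrightarrow> u = v"
proof -
  have doms: "Dom C f = A" "Cod C f = B" using f unfolding Hom_def by auto
  show k: "k \<in> Hom C (Dom C k) A" using assms doms unfolding is_kernel_def Hom_def by auto
  show fk: "f \<cdot> k = Zero C (Dom C k) B" using assms doms unfolding is_kernel_def by simp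
  have univ: "\<exists>!v. v \<in> Hom C W (Dom C k) \<and> k \<cdot> v = u" if "u \<in> Hom C W A" "f \<cdot> u = Zero C W B" for W u
    using assms(1) that unfolding is_kernel_def doms by blast
  show "\<exists>v \<in> Hom C W (Dom C k). k \<cdot> v = u" if "u \<in> Hom C W A" "f \<cdot> u = Zero C W B" for W u
    using univ[OF that] by blast
  show "u = v" if uv: "u \<in> Hom C W (Dom C k)" "v \<in> Hom C W (Dom C k)" "k \<cdot> u = k \<cdot> v" for W u v
  proof -
    have "f \<cdot> (k \<cdot> u) = Zero C W B"
      using comp_assoc[OF uv(1) k f] fk comp_zero_left[OF uv(1) hom_cod[OF f]] by simp
    from univ[OF comp_hom[OF uv(1) k] this] show ?thesis using uv by auto
  qed
qed

lemma (in additive_category) is_cokernelD: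
  assumes "is_cokernel C c f" and f: "f \<in> Hom C A B"
  shows "c \<in> Hom C B (Cod C c)" and "c \<cdot> f = Zero C A (Cod C c)"
    and "\<And>W u. \<lbrakk>u \<in> Hom C B W; u \<cdot> f = Zero C A W\<rbrakk> \<Longrightarrow> \<exists>v \<in> Hom C (Cod C c) W. v \<cdot> c = u"
    and "\<And>W u v. \<lbrakk>u \<in> Hom C (Cod C c) W; v \<in> Hom C (Cod C c) W; u \<cdot> c = v \<cdot> c\<rbrakk> \<Longrightarrow> u = v"
proof -
  have doms: "Dom C f = A" "Cod C f = B" using f unfolding Hom_def by auto
  show c: "c \<in> Hom C B (Cod C c)" using assms doms unfolding is_cokernel_def Hom_def by auto
  show cf: "c \<cdot> f = Zero C A (Cod C c)" using assms doms unfolding is_cokernel_def by simp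
  have univ: "\<exists>!v. v \<in> Hom C (Cod C c) W \<and> v \<cdot> c = u" if "u \<in> Hom C B W" "u \<cdot> f = Zero C A W" for W u
    using assms(1) that unfolding is_cokernel_def doms by blast
  show "\<exists>v \<in> Hom C (Cod C c) W. v \<cdot> c = u" if "u \<in> Hom C B W" "u \<cdot> f = Zero C A W" for W u
    using univ[OF that] by blast
  show "u = v" if uv: "u \<in> Hom C (Cod C c) W" "v \<in> Hom C (Cod C c) W" "u \<cdot> c = v \<cdot> c" for W u v
  proof -
    have "(u \<cdot> c) \<cdot> f = Zero C A W"
      using comp_assoc[OF f c uv(1)] cf comp_zero_right[OF uv(1) hom_dom[OF f]] by simp
    from univ[OF comp_hom[OF c uv(1)] this] show ?thesis using uv by auto
  qed
qed

lemma (in additive_category) kernel_unique: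
  assumes "is_kernel C k f" and "is_kernel C k' f" and f: "f \<in> Hom C A B"
  shows "isomorphic C (Dom C k) (Dom C k')"
proof -
  note k = is_kernelD[OF assms(1) f] and k' = is_kernelD[OF assms(2) f]
  obtain v where v: "v \<in> Hom C (Dom C k) (Dom C k')" "k' \<cdot> v = k" using k'(3)[OF k(1,2)] by blast
  obtain w where w: "w \<in> Hom C (Dom C k') (Dom C k)" "k \<cdot> w = k'" using k(3)[OF k'(1,2)] by blast
  have "k \<cdot> (w \<cdot> v) = k \<cdot> Id C (Dom C k)"
    using comp_assoc[OF v(1) w(1) k(1)] v(2) w(2) id_right[OF k(1)] by simp
  then have 1: "w \<cdot> v = Id C (Dom C k)"
    by (rule k(4)[OF comp_hom[OF v(1) w(1)] id_hom[OF hom_dom[OF k(1)]]])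
  have "k' \<cdot> (v \<cdot> w) = k' \<cdot> Id C (Dom C k')"
    using comp_assoc[OF w(1) v(1) k'(1)] v(2) w(2) id_right[OF k'(1)] by simp
  then have 2: "v \<cdot> w = Id C (Dom C k')"
    by (rule k'(4)[OF comp_hom[OF w(1) v(1)] id_hom[OF hom_dom[OF k'(1)]]])
  show ?thesis by (rule isomorphicI[OF is_isoI[OF v(1) w(1) 1 2] v(1)])
qed

lemma (in additive_category) cokernel_epi:
  assumes "is_cokernel C c f"
  shows "is_epi C c"
proof -
  have "f \<in> Arr C" "c \<in> Arr C" "Dom C c = Cod C f" using assms unfolding is_cokernel_def by auto
  then show ?thesis
    using is_cokernelD(4)[OF assms arr_hom] unfolding is_epi_def by blast
qed

section \<open>The two classes of a torsion theory are each other's orthogonals\<close>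

context torsion_theory
begin

text \<open>In the torsion sequence of \<open>X\<close> the quotient map \<open>g\<close> vanishes,
  so the identity of \<open>X\<close> factors through its kernel \<open>f\<close>. Hence
  \<open>f\<close> is an isomorphism and \<open>X\<close> is isomorphic to its torsion part.\<close>

lemma torsion_if_null:
  assumes X: "X \<in> Obj A" and n: "\<And>Y. Y \<in> F \<Longrightarrow> null A X Y"
  shows "X \<in> T"
proof -
  obtain f g where fg: "short_exact A f g" "Dom A f \<in> T" "Cod A f = X" "Cod A g \<in> F"
    using ex_torsion_sequence[OF X] by blast
  define Y where "Y = Cod A g"
  have ker: "is_kernel A f g" using fg(1) unfolding short_exact_def by blast
  then have g: "g \<in> Hom A X Y" using fg(3) unfolding Y_def is_kernel_def Hom_def by auto
  note k = is_kernelD[OF ker g]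
  have "g = Zero A X Y" using nullD[OF n g] fg(4) Y_def by simp
  then have "g \<cdot> Id A X = Zero A X Y" using id_right[OF g] by simp
  then obtain v where v: "v \<in> Hom A X (Dom A f)" "f \<cdot> v = Id A X" using k(3)[OF id_hom[OF X]] by blast
  have "f \<cdot> (v \<cdot> f) = f \<cdot> Id A (Dom A f)"
    using comp_assoc[OF k(1) v(1) k(1)] v(2) id_left[OF k(1)] id_right[OF k(1)] by simp
  then have "v \<cdot> f = Id A (Dom A f)"
    by (rule k(4)[OF comp_hom[OF k(1) v(1)] id_hom[OF hom_dom[OF k(1)]]])
  from isomorphicI[OF is_isoI[OF k(1) v(1) this v(2)] k(1)] show ?thesis
    by (rule iso_closedD[OF torsion_iso_closed _ fg(2)])
qed

lemma free_if_null:
  assumes X: "X \<in> Obj A" and n: "\<And>Y. Y \<in> T \<Longrightarrow> null A Y X"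
  shows "X \<in> F"
proof -
  obtain f g where fg: "short_exact A f g" "Dom A f \<in> T" "Cod A f = X" "Cod A g \<in> F"
    using ex_torsion_sequence[OF X] by blast
  define Y where "Y = Dom A f"
  have coker: "is_cokernel A g f" using fg(1) unfolding short_exact_def by blast
  then have f: "f \<in> Hom A Y X" using fg(3) unfolding Y_def is_cokernel_def Hom_def by auto
  note c = is_cokernelD[OF coker f]
  have "f = Zero A Y X" using nullD[OF n f] fg(2) Y_def by simp
  then have "Id A X \<cdot> f = Zero A Y X" using id_left[OF f] by simp
  then obtain v where v: "v \<in> Hom A (Cod A g) X" "v \<cdot> g = Id A X" using c(3)[OF id_hom[OF X]] by blast
  have "(g \<cdot> v) \<cdot> g = Id A (Cod A g) \<cdot> g"
    using comp_assoc[OF c(1) v(1) c(1)] v(2) id_left[OF c(1)] id_right[OF c(1)] by simp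
  then have "g \<cdot> v = Id A (Cod A g)"
    by (rule c(4)[OF comp_hom[OF v(1) c(1)] id_hom[OF hom_cod[OF c(1)]]])
  from isomorphicI[OF is_isoI[OF v(1) c(1) this v(2)] v(1)] show ?thesis
    by (rule iso_closedD[OF free_iso_closed _ fg(4)])
qed

lemma null_torsion_free: "\<lbrakk>X \<in> T; Y \<in> F\<rbrakk> \<Longrightarrow> null A X Y"
  using hom_torsion_free unfolding null_def by blast

end

section \<open>Orthogonality and closure properties of a t-structure\<close>

context t_structure
begin

lemma le_obj: "X \<in> L \<Longrightarrow> X \<in> Obj D"
  by (rule iso_closed_obj[OF le_iso_closed])

lemma ge_obj: "X \<in> G \<Longrightarrow> X \<in> Obj D"
  by (rule iso_closed_obj[OF ge_iso_closed])

lemma ge_one_obj: "X \<in> ge_one D G \<Longrightarrow> X \<in> Obj D"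
  unfolding ge_one_def by blast

lemma ge_one_ge: "X \<in> ge_one D G \<Longrightarrow> X \<in> G"
  using ge_shift by blast

lemma ge_one_iff: "X \<in> Obj D \<Longrightarrow> X \<in> ge_one D G \<longleftrightarrow> sh X \<in> G"
  unfolding ge_one_def by blast

lemma sh_le: "X \<in> L \<Longrightarrow> sh X \<in> L"
  using le_shift unfolding le_minus_one_def by blast

lemma null_le_ge_one: "\<lbrakk>X \<in> L; Y \<in> ge_one D G\<rbrakk> \<Longrightarrow> null D X Y"
  using hom_le_ge unfolding null_def by blast

lemma null_sh_le_ge:
  assumes "X \<in> L" and "Y \<in> G"
  shows "null D (sh X) Y"
proof -
  obtain Y' where Y': "Y' \<in> Obj D" "sh Y' = Y" by (rule unshift_obj[OF ge_obj[OF assms(2)]])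
  then have "null D X Y'" using null_le_ge_one assms by (simp add: ge_one_iff)
  then show ?thesis using null_shift[OF le_obj[OF assms(1)] Y'(1)] Y'(2) by simp
qed

lemma truncation:
  assumes "K \<in> Obj D"
  obtains A B f g h where "dtri A K B f g h" "A \<in> L" "B \<in> ge_one D G"
proof -
  obtain f g h where t: "(f, g, h) \<in> Dist D" "Dom D f \<in> L" "Cod D f = K" "Cod D g \<in> ge_one D G"
    using ex_truncation[OF assms] by blast
  have "dtri (Dom D f) K (Cod D g) f g h"
    using dtriI[OF t(1)] t(3) unfolding dtri_def Hom_def by auto
  then show ?thesis using t(2,4) by (rule that)
qed

text \<open>The triangle of K[-1] is shifted by three rotations: its parts of degrees <= 0 and >= 1
  become parts of degrees <= -1 and >= 0. The signs may be forgotten, since the morphisms are only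
  claimed to exist.\<close>

lemma truncation_ge:
  assumes "K \<in> Obj D"
  obtains A B f g h where "dtri (sh A) K B f g h" "A \<in> L" "B \<in> G"
proof -
  obtain K' where K': "K' \<in> Obj D" "sh K' = K" by (rule unshift_obj[OF assms])
  obtain A B f g h where t: "dtri A K' B f g h" "A \<in> L" "B \<in> ge_one D G"
    by (rule truncation[OF K'(1)])
  have "sh B \<in> G" using t(3) unfolding ge_one_def by blast
  then show ?thesis
    using that dtri_rotate[OF dtri_rotate[OF dtri_rotate[OF t(1)]]] t(2) K'(2) by blast
qed

text \<open>The upper truncation \<open>B\<close> receives no non-zero morphism to itself: none can
  come from \<open>K\<close> by hypothesis, none from \<open>sh A\<close> by orthogonality. So
  \<open>B\<close> is zero and \<open>K\<close> is isomorphic to its lower truncation.\<close>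

lemma le_if_null:
  assumes K: "K \<in> Obj D" and n: "\<And>M. M \<in> ge_one D G \<Longrightarrow> null D K M"
  shows "K \<in> L"
proof -
  obtain A B f g h where t: "dtri A K B f g h" "A \<in> L" "B \<in> ge_one D G" by (rule truncation[OF K])
  have "null D B B"
    by (rule null_cone_left[OF t(1) n[OF t(3)] null_le_ge_one[OF sh_le[OF t(2)] t(3)]])
  then have "zero_object D B" by (rule zero_object_if_null[OF ge_one_obj[OF t(3)]])
  from isomorphicI[OF iso_if_cone_zero[OF t(1) this] dtriD(2)[OF t(1)]] show ?thesis
    by (rule iso_closedD[OF le_iso_closed _ t(2)])
qed

lemma ge_one_iso_closed: "iso_closed D (ge_one D G)"
proof (rule iso_closedI)
  show "ge_one D G \<subseteq> Obj D" unfolding ge_one_def by blast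
  fix X Y assume XY: "isomorphic D X Y" "X \<in> ge_one D G"
  have "Y \<in> Obj D" using XY(1) hom_cod unfolding isomorphic_def by blast
  then show "Y \<in> ge_one D G"
    using iso_closedD[OF ge_iso_closed isomorphic_shift[OF XY(1)]] XY(2) unfolding ge_one_def by blast
qed

text \<open>Here the lower truncation \<open>A\<close> vanishes: an endomorphism of \<open>A\<close>
  is controlled by Hom(A, K) and Hom(A, B[-1]), and both are zero.\<close>

lemma ge_one_if_null:
  assumes K: "K \<in> Obj D" and n: "\<And>X. X \<in> L \<Longrightarrow> null D X K"
  shows "K \<in> ge_one D G"
proof -
  obtain A B f g h where t: "dtri A K B f g h" "A \<in> L" "B \<in> ge_one D G" by (rule truncation[OF K])
  obtain B' where B': "B' \<in> Obj D" "sh B' = B" by (rule unshift_obj[OF ge_one_obj[OF t(3)]])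
  have "B' \<in> ge_one D G" using B' ge_one_ge[OF t(3)] by (simp add: ge_one_iff)
  then have "null D A A"
    by (rule null_fibre_right[OF t(1) B' n[OF t(2)] null_le_ge_one[OF t(2)]])
  then have "zero_object D A" by (rule zero_object_if_null[OF le_obj[OF t(2)]])
  from isomorphicI[OF iso_if_fibre_zero[OF t(1) this] dtriD(3)[OF t(1)]] show ?thesis
    by (rule iso_closedD[OF ge_one_iso_closed isomorphic_sym t(3)])
qed

lemma ge_if_null:
  assumes K: "K \<in> Obj D" and n: "\<And>X. X \<in> L \<Longrightarrow> null D (sh X) K"
  shows "K \<in> G"
proof -
  obtain K' where K': "K' \<in> Obj D" "sh K' = K" by (rule unshift_obj[OF K])
  have "K' \<in> ge_one D G"
  proof (rule ge_one_if_null[OF K'(1)])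
    fix X assume "X \<in> L"
    then show "null D X K'" using n[of X] null_shift[OF le_obj K'(1), of X] K'(2) by simp
  qed
  then show ?thesis using K' by (simp add: ge_one_iff)
qed

lemma le_middle: "\<lbrakk>dtri X Y Z f g h; X \<in> L; Z \<in> L\<rbrakk> \<Longrightarrow> Y \<in> L"
  by (rule le_if_null) (auto intro: dtriD null_middle_left null_le_ge_one)

lemma ge_middle: "\<lbrakk>dtri X Y Z f g h; X \<in> G; Z \<in> G\<rbrakk> \<Longrightarrow> Y \<in> G"
  by (rule ge_if_null) (auto intro: dtriD null_middle_right null_sh_le_ge)

lemma le_cone: "\<lbrakk>dtri X Y Z f g h; X \<in> L; Y \<in> L\<rbrakk> \<Longrightarrow> Z \<in> L"
  by (rule le_middle[OF dtri_rotate _ sh_le])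

lemma ge_fibre:
  assumes "dtri X Y Z f g h" and "Y \<in> G" and "Z \<in> G"
  shows "X \<in> G"
proof -
  obtain Z' where Z': "Z' \<in> Obj D" "sh Z' = Z" by (rule unshift_obj[OF ge_obj[OF assms(3)]])
  have "Z' \<in> G" using ge_one_ge[of Z'] Z' assms(3) by (simp add: ge_one_iff)
  then show ?thesis
    using dtri_unrotate[OF assms(1) Z'] ge_middle assms(2) by metis
qed

lemma zero_le: "zero_object D Z \<Longrightarrow> Z \<in> L"
  by (rule le_if_null) (auto intro: zero_object_obj zero_object_null)

lemma zero_ge: "zero_object D Z \<Longrightarrow> Z \<in> G"
  by (rule ge_if_null) (auto intro: zero_object_obj zero_object_null)

section \<open>The heart as a full additive subcategory\<close>

lemma heart_sel [simp]:
  "Obj (heart D L G) = L \<inter> G" "Dom (heart D L G) = Dom D" "Cod (heart D L G) = Cod D"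
  "Id (heart D L G) = Id D" "Comp (heart D L G) = Comp D" "Add (heart D L G) = Add D"
  "Zero (heart D L G) = Zero D"
  unfolding heart_def by simp_all

lemma heart_hom_iff:
  "f \<in> Hom (heart D L G) X Y \<longleftrightarrow> f \<in> Hom D X Y \<and> X \<in> L \<inter> G \<and> Y \<in> L \<inter> G"
  unfolding heart_def Hom_def by auto

lemma heart_hom: "\<lbrakk>X \<in> L \<inter> G; Y \<in> L \<inter> G\<rbrakk> \<Longrightarrow> Hom (heart D L G) X Y = Hom D X Y"
  using heart_hom_iff by blast

lemma heart_null: "\<lbrakk>X \<in> L \<inter> G; Y \<in> L \<inter> G\<rbrakk> \<Longrightarrow> null (heart D L G) X Y \<longleftrightarrow> null D X Y"
  unfolding null_def by (simp add: heart_hom)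

lemma heart_isomorphic:
  "isomorphic (heart D L G) X Y \<longleftrightarrow> isomorphic D X Y \<and> X \<in> L \<inter> G \<and> Y \<in> L \<inter> G"
proof
  assume "isomorphic (heart D L G) X Y"
  then obtain f g where fg: "f \<in> Hom (heart D L G) X Y" "g \<in> Hom (heart D L G) Y X"
    "g \<cdot> f = Id D X" "f \<cdot> g = Id D Y"
    unfolding isomorphic_def by (metis is_isoE heart_sel(4,5))
  then have "f \<in> Hom D X Y" "g \<in> Hom D Y X" by (simp_all add: heart_hom_iff)
  from isomorphicI[OF is_isoI[OF this fg(3,4)] this(1)] fg(1)
  show "isomorphic D X Y \<and> X \<in> L \<inter> G \<and> Y \<in> L \<inter> G" by (simp add: heart_hom_iff)
next
  assume *: "isomorphic D X Y \<and> X \<in> L \<inter> G \<and> Y \<in> L \<inter> G"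
  then obtain f g where "f \<in> Hom D X Y" "g \<in> Hom D Y X" "g \<cdot> f = Id D X" "f \<cdot> g = Id D Y"
    unfolding isomorphic_def by (meson is_isoE)
  then show "isomorphic (heart D L G) X Y"
    using isomorphicI[OF is_isoI, of f "heart D L G" X Y g] * by (simp add: heart_hom)
qed

sublocale heart: additive_category "heart D L G"
proof (intro additive_category.intro category.intro additive_category_axioms.intro)
  fix f g g' h W X Y Z
  let ?H = "heart D L G"
  show "f \<in> Arr ?H \<Longrightarrow> Dom ?H f \<in> Obj ?H" "f \<in> Arr ?H \<Longrightarrow> Cod ?H f \<in> Obj ?H"
    unfolding heart_def by auto
  show "X \<in> Obj ?H \<Longrightarrow> Id ?H X \<in> Hom ?H X X"
    using id_hom le_obj by (simp add: heart_hom_iff)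
  show "\<lbrakk>f \<in> Hom ?H X Y; g \<in> Hom ?H Y Z\<rbrakk> \<Longrightarrow> g \<cdot>\<^bsub>?H\<^esub> f \<in> Hom ?H X Z"
    using comp_hom unfolding heart_hom_iff heart_sel by blast
  show "f \<in> Hom ?H X Y \<Longrightarrow> Id ?H Y \<cdot>\<^bsub>?H\<^esub> f = f" "f \<in> Hom ?H X Y \<Longrightarrow> f \<cdot>\<^bsub>?H\<^esub> Id ?H X = f"
    using id_left id_right unfolding heart_hom_iff heart_sel by blast+
  show "\<lbrakk>f \<in> Hom ?H W X; g \<in> Hom ?H X Y; h \<in> Hom ?H Y Z\<rbrakk>
      \<Longrightarrow> (h \<cdot>\<^bsub>?H\<^esub> g) \<cdot>\<^bsub>?H\<^esub> f = h \<cdot>\<^bsub>?H\<^esub> (g \<cdot>\<^bsub>?H\<^esub> f)"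
    using comp_assoc unfolding heart_hom_iff heart_sel by blast
  show "comm_group (hom_group ?H X Y)" if "X \<in> Obj ?H" "Y \<in> Obj ?H"
    using that hom_comm_group[of X Y] le_obj heart_hom[of X Y] unfolding hom_group_def by simp
  show "\<lbrakk>f \<in> Hom ?H X Y; g \<in> Hom ?H Y Z; g' \<in> Hom ?H Y Z\<rbrakk>
      \<Longrightarrow> (g \<boxplus>\<^bsub>?H\<^esub> g') \<cdot>\<^bsub>?H\<^esub> f = (g \<cdot>\<^bsub>?H\<^esub> f) \<boxplus>\<^bsub>?H\<^esub> (g' \<cdot>\<^bsub>?H\<^esub> f)"
    using comp_add_left unfolding heart_hom_iff heart_sel by blast
  show "\<lbrakk>f \<in> Hom ?H X Y; g \<in> Hom ?H X Y; h \<in> Hom ?H Y Z\<rbrakk>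
      \<Longrightarrow> h \<cdot>\<^bsub>?H\<^esub> (f \<boxplus>\<^bsub>?H\<^esub> g) = (h \<cdot>\<^bsub>?H\<^esub> f) \<boxplus>\<^bsub>?H\<^esub> (h \<cdot>\<^bsub>?H\<^esub> g)"
    using comp_add_right unfolding heart_hom_iff heart_sel by blast
  obtain O' where z: "zero_object D O'" using ex_zero_object by blast
  have "zero_object ?H O'"
    using z zero_le[OF z] zero_ge[OF z] le_obj unfolding zero_object_def by (simp add: heart_hom)
  then show "\<exists>Z. zero_object ?H Z" by blast
  show "\<exists>B \<in> Obj ?H. \<exists>i \<in> Hom ?H X B. \<exists>j \<in> Hom ?H Y B. \<exists>p \<in> Hom ?H B X. \<exists>q \<in> Hom ?H B Y.
        p \<cdot>\<^bsub>?H\<^esub> i = Id ?H X \<and> q \<cdot>\<^bsub>?H\<^esub> j = Id ?H Y \<and> q \<cdot>\<^bsub>?H\<^esub> i = Zero ?H X Y \<and>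
        p \<cdot>\<^bsub>?H\<^esub> j = Zero ?H Y X \<and> (i \<cdot>\<^bsub>?H\<^esub> p) \<boxplus>\<^bsub>?H\<^esub> (j \<cdot>\<^bsub>?H\<^esub> q) = Id ?H B"
    if "X \<in> Obj ?H" "Y \<in> Obj ?H"
  proof -
    have XY: "X \<in> L \<inter> G" "Y \<in> L \<inter> G" using that by simp_all
    obtain B i j p q where B: "B \<in> Obj D" "i \<in> Hom D X B" "j \<in> Hom D Y B" "p \<in> Hom D B X"
      "q \<in> Hom D B Y" "p \<cdot> i = Id D X" "q \<cdot> j = Id D Y" "q \<cdot> i = Zero D X Y"
      "p \<cdot> j = Zero D Y X" "(i \<cdot> p) \<boxplus> (j \<cdot> q) = Id D B"
      using ex_biproduct[of X Y] XY le_obj by blast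
    \<comment> \<open>A biproduct inherits orthogonality from its summands, and \<open>L\<close> and
      \<open>G\<close> are detected by orthogonality alone.\<close>
    have "B \<in> L"
      by (rule le_if_null[OF B(1)], rule biproduct_null_left[OF B(2-5,10)])
        (use XY null_le_ge_one in blast)+
    moreover have "B \<in> G"
      by (rule ge_if_null[OF B(1)], rule biproduct_null_right[OF B(2-5,10)])
        (use XY null_sh_le_ge in blast)+
    ultimately have "B \<in> L \<inter> G" by blast
    then show ?thesis
      using B(2-10) XY by (intro bexI[of _ B] bexI[of _ i] bexI[of _ j] bexI[of _ p] bexI[of _ q])
        (simp_all add: heart_hom_iff)
  qed
qed

text \<open>Triangles provide weak kernels and weak cokernels. Uniqueness of the factorisations
  comes from degrees: Z[-1] has degrees >= 1 and receives nothing from the heart, X[1] has degrees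
  <= -1 and sends nothing to it.\<close>

lemma dtri_heart_short_exact:
  assumes "dtri X Y Z f g h" and X: "X \<in> L \<inter> G" and Y: "Y \<in> L \<inter> G" and Z: "Z \<in> L \<inter> G"
  shows "short_exact (heart D L G) f g"
proof -
  note t = dtriD[OF assms(1)]
  have f: "f \<in> Hom (heart D L G) X Y" and g: "g \<in> Hom (heart D L G) Y Z"
    using t(2,3) X Y Z by (simp_all add: heart_hom)
  obtain Z' where Z': "Z' \<in> Obj D" "sh Z' = Z" by (rule unshift_obj[OF t(7)])
  have "Z' \<in> ge_one D G" using Z' Z by (simp add: ge_one_iff)
  then have nZ: "null D W Z'" if "W \<in> L" for W using null_le_ge_one that by blast
  have gf: "Comp (heart D L G) g f = Zero (heart D L G) X Z" using dtri_comp_zero[OF assms(1)] by simp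
  have "is_kernel (heart D L G) f g"
  proof (rule heart.is_kernelI[OF g f gf])
    fix W u assume u: "u \<in> Hom (heart D L G) W Y" "Comp (heart D L G) g u = Zero (heart D L G) W Z"
    then have "u \<in> Hom D W Y" "g \<cdot> u = Zero D W Z" by (simp_all add: heart_hom_iff)
    then obtain v where "v \<in> Hom D W X" "f \<cdot> v = u" by (rule weak_kernel[OF assms(1)])
    then show "\<exists>v \<in> Hom (heart D L G) W X. Comp (heart D L G) f v = u"
      using u(1) X unfolding Bex_def heart_hom_iff heart_sel by blast
  next
    fix W w assume w: "w \<in> Hom (heart D L G) W X" "Comp (heart D L G) f w = Zero (heart D L G) W Y"
    then show "w = Zero (heart D L G) W X"
      using dtri_first_mono[OF assms(1) Z' nZ, of W w] by (simp add: heart_hom_iff)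
  qed
  moreover have "is_cokernel (heart D L G) g f"
  proof (rule heart.is_cokernelI[OF f g gf])
    fix W u assume u: "u \<in> Hom (heart D L G) Y W" "Comp (heart D L G) u f = Zero (heart D L G) X W"
    then have "u \<in> Hom D Y W" "u \<cdot> f = Zero D X W" by (simp_all add: heart_hom_iff)
    then obtain v where "v \<in> Hom D Z W" "v \<cdot> g = u" by (rule weak_cokernel[OF assms(1)])
    then show "\<exists>v \<in> Hom (heart D L G) Z W. Comp (heart D L G) v g = u"
      using u(1) Z unfolding Bex_def heart_hom_iff heart_sel by blast
  next
    fix W w assume w: "w \<in> Hom (heart D L G) Z W" "Comp (heart D L G) w g = Zero (heart D L G) Y W"
    then show "w = Zero (heart D L G) Z W"
      using dtri_second_epi[OF assms(1) null_sh_le_ge, of W w] X by (simp add: heart_hom_iff)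
  qed
  ultimately show ?thesis unfolding short_exact_def by blast
qed

text \<open>The kernel in the heart is the truncation in degrees <= 0 of the fibre \<open>S\<close>:
  a morphism from \<open>L\<close> to \<open>S\<close> factors uniquely through \<open>P\<close>,
  and \<open>S\<close>, hence also \<open>P\<close>, lies in \<open>G\<close>.\<close>

lemma heart_kernel:
  assumes T: "dtri S A B a f b" and T': "dtri P S M p m c"
    and A: "A \<in> L \<inter> G" and B: "B \<in> L \<inter> G" and P: "P \<in> L" and M: "M \<in> ge_one D G"
  shows "P \<in> L \<inter> G" and "is_kernel (heart D L G) (a \<cdot> p) f"
proof -
  note t = dtriD[OF T] and t' = dtriD[OF T']
  have "S \<in> G" using ge_fibre[OF T] A B by blast
  then have "P \<in> G" using ge_fibre[OF T'] ge_one_ge[OF M] by blast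
  then show PH: "P \<in> L \<inter> G" using P by blast
  obtain B' where B': "B' \<in> Obj D" "sh B' = B" by (rule unshift_obj[OF t(7)])
  obtain M' where M': "M' \<in> Obj D" "sh M' = M" by (rule unshift_obj[OF t'(7)])
  have "B' \<in> ge_one D G" "M' \<in> ge_one D G"
    using B' M' B ge_one_ge[OF M] by (simp_all add: ge_one_iff)
  then have nB: "null D W B'" and nM: "null D W M'" if "W \<in> L" for W
    using null_le_ge_one that by blast+
  have ap: "a \<cdot> p \<in> Hom D P A" by (rule comp_hom[OF t'(2) t(2)])
  have f: "f \<in> Hom (heart D L G) A B" and k: "a \<cdot> p \<in> Hom (heart D L G) P A"
    using t(3) ap PH A B by (simp_all add: heart_hom)
  show "is_kernel (heart D L G) (a \<cdot> p) f"
  proof (rule heart.is_kernelI[OF f k])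
    show "Comp (heart D L G) f (a \<cdot> p) = Zero (heart D L G) P B"
      using comp_assoc[OF t'(2) t(2,3)] dtri_comp_zero[OF T] comp_zero_left[OF t'(2) t(7)] by simp
  next
    fix W u assume u: "u \<in> Hom (heart D L G) W A" "Comp (heart D L G) f u = Zero (heart D L G) W B"
    then have uD: "u \<in> Hom D W A" "f \<cdot> u = Zero D W B" and W: "W \<in> L \<inter> G"
      by (simp_all add: heart_hom_iff)
    obtain v where v: "v \<in> Hom D W S" "a \<cdot> v = u" by (rule weak_kernel[OF T uD])
    have "m \<cdot> v = Zero D W M"
      by (rule nullD[OF null_le_ge_one[OF _ M] comp_hom[OF v(1) t'(3)]]) (use W in blast)
    then obtain w where w: "w \<in> Hom D W P" "p \<cdot> w = v" by (rule weak_kernel[OF T' v(1)])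
    have "(a \<cdot> p) \<cdot> w = u" using comp_assoc[OF w(1) t'(2) t(2)] w(2) v(2) by simp
    then show "\<exists>v \<in> Hom (heart D L G) W P. Comp (heart D L G) (a \<cdot> p) v = u"
      using w(1) W PH by (auto simp: heart_hom)
  next
    fix W w assume "w \<in> Hom (heart D L G) W P"
      "Comp (heart D L G) (a \<cdot> p) w = Zero (heart D L G) W A"
    then have w: "w \<in> Hom D W P" "a \<cdot> (p \<cdot> w) = Zero D W A" and W: "W \<in> L"
      using comp_assoc[of w W P p S a A] t(2) t'(2) by (simp_all add: heart_hom_iff)
    have "p \<cdot> w = Zero D W S"
      by (rule dtri_first_mono[OF T B' nB[OF W] comp_hom[OF w(1) t'(2)] w(2)])
    from dtri_first_mono[OF T' M' nM[OF W] w(1) this] show "w = Zero (heart D L G) W P" by simp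
  qed
qed

text \<open>Dually, the cokernel is the truncation in degrees >= 0 of the cone \<open>S\<close>,
  which lies in \<open>L\<close>; the discarded part \<open>sh P\<close> has no morphisms to
  \<open>G\<close>.\<close>

lemma heart_cokernel:
  assumes T: "dtri A B S f g h" and T': "dtri (sh P) S Q p q c"
    and A: "A \<in> L \<inter> G" and B: "B \<in> L \<inter> G" and P: "P \<in> L" and Q: "Q \<in> G"
  shows "Q \<in> L \<inter> G" and "is_cokernel (heart D L G) (q \<cdot> g) f"
proof -
  note t = dtriD[OF T] and t' = dtriD[OF T']
  have "S \<in> L" using le_cone[OF T] A B by blast
  then have "Q \<in> L" using le_cone[OF T'] sh_le[OF P] by blast
  then show QH: "Q \<in> L \<inter> G" using Q by blast
  have qg: "q \<cdot> g \<in> Hom D B Q" by (rule comp_hom[OF t(3) t'(3)])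
  have f: "f \<in> Hom (heart D L G) A B" and k: "q \<cdot> g \<in> Hom (heart D L G) B Q"
    using t(2) qg QH A B by (simp_all add: heart_hom)
  show "is_cokernel (heart D L G) (q \<cdot> g) f"
  proof (rule heart.is_cokernelI[OF f k])
    show "Comp (heart D L G) (q \<cdot> g) f = Zero (heart D L G) A Q"
      using comp_assoc[OF t(2,3) t'(3)] dtri_comp_zero[OF T] comp_zero_right[OF t'(3) t(5)] by simp
  next
    fix W u assume u: "u \<in> Hom (heart D L G) B W" "Comp (heart D L G) u f = Zero (heart D L G) A W"
    then have uD: "u \<in> Hom D B W" "u \<cdot> f = Zero D A W" and W: "W \<in> L \<inter> G"
      by (simp_all add: heart_hom_iff)
    obtain v where v: "v \<in> Hom D S W" "v \<cdot> g = u" by (rule weak_cokernel[OF T uD])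
    have "v \<cdot> p = Zero D (sh P) W"
      by (rule nullD[OF null_sh_le_ge[OF P] comp_hom[OF t'(2) v(1)]]) (use W in blast)
    then obtain w where w: "w \<in> Hom D Q W" "w \<cdot> q = v" by (rule weak_cokernel[OF T' v(1)])
    have "w \<cdot> (q \<cdot> g) = u" using comp_assoc[OF t(3) t'(3) w(1)] w(2) v(2) by simp
    then show "\<exists>v \<in> Hom (heart D L G) Q W. Comp (heart D L G) v (q \<cdot> g) = u"
      using w(1) W QH by (auto simp: heart_hom)
  next
    fix W w assume "w \<in> Hom (heart D L G) Q W"
      "Comp (heart D L G) w (q \<cdot> g) = Zero (heart D L G) B W"
    then have w: "w \<in> Hom D Q W" "(w \<cdot> q) \<cdot> g = Zero D B W" and W: "W \<in> G"
      using comp_assoc[of g B S q Q w W] t(3) t'(3) by (simp_all add: heart_hom_iff)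
    have "w \<cdot> q = Zero D S W"
      by (rule dtri_second_epi[OF T null_sh_le_ge[OF _ W] comp_hom[OF t'(3) w(1)] w(2)]) (use A in blast)
    from dtri_second_epi[OF T' null_sh_le_ge[OF sh_le[OF P] W] w(1) this]
    show "w = Zero (heart D L G) Q W" by simp
  qed
qed

text \<open>For a monomorphism the kernel \<open>P\<close> computed above is zero, so the fibre
  \<open>S'\<close> has degrees >= 1 and the cone, its shift, has degrees >= 0.\<close>

lemma heart_mono_cone:
  assumes "is_mono (heart D L G) f" and f: "f \<in> Hom (heart D L G) A B"
  obtains S g h where "dtri A B S f g h" "S \<in> L \<inter> G"
proof -
  have A: "A \<in> L \<inter> G" and B: "B \<in> L \<inter> G" and fD: "f \<in> Hom D A B"
    using f by (simp_all add: heart_hom_iff)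
  obtain S g h where T: "dtri A B S f g h" by (rule cone_ex[OF fD])
  obtain S' where S': "S' \<in> Obj D" "sh S' = S" by (rule unshift_obj[OF dtriD(7)[OF T]])
  obtain a where a: "dtri S' A B a f g" by (rule dtri_unrotate[OF T S'])
  obtain P M p m c where T': "dtri P S' M p m c" "P \<in> L" "M \<in> ge_one D G" by (rule truncation[OF S'(1)])
  note ker = heart_kernel[OF a T'(1) A B T'(2,3)]
  note k = heart.is_kernelD[OF ker(2) f]
  have ap: "a \<cdot> p \<in> Hom D P A" by (rule comp_hom[OF dtriD(2)[OF T'(1)] dtriD(2)[OF a]])
  then have dom: "Dom D (a \<cdot> p) = P" unfolding Hom_def by blast
  have z: "Zero D P A \<in> Hom D P A" by (rule zero_hom[OF hom_dom[OF ap] hom_cod[OF ap]])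
  have "f \<cdot> (a \<cdot> p) = f \<cdot> Zero D P A"
    using k(2) comp_zero_right[OF fD hom_dom[OF ap]] dom by simp
  moreover have "f \<cdot> u = f \<cdot> v \<Longrightarrow> u = v" if "u \<in> Hom D P A" "v \<in> Hom D P A" for u v
  proof -
    have "Dom (heart D L G) f = A" using f unfolding Hom_def by blast
    moreover have "u \<in> Hom (heart D L G) P A" "v \<in> Hom (heart D L G) P A"
      using that ker(1) A by (simp_all add: heart_hom)
    ultimately show "f \<cdot> u = f \<cdot> v \<Longrightarrow> u = v"
      using assms(1) unfolding is_mono_def heart_sel by blast
  qed
  ultimately have "a \<cdot> p = Zero D P A" using ap z by blast
  then have "(a \<cdot> p) \<cdot> Id D P = (a \<cdot> p) \<cdot> Zero D P P"
    using comp_zero_right[OF ap hom_dom[OF ap]] id_right[OF ap] by simp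
  then have "Id D P = Zero D P P"
    using k(4)[of "Id D P" P "Zero D P P"] dom ker(1) id_hom[OF hom_dom[OF ap]]
      zero_hom[OF hom_dom[OF ap] hom_dom[OF ap]] by (simp add: heart_hom)
  then have zero: "zero_object D P" using hom_dom[OF ap] by (simp add: zero_object_iff_id)
  have "S' \<in> ge_one D G"
    by (rule ge_one_if_null[OF S'(1) null_middle_right[OF T'(1) zero_object_null(2)[OF zero]
      null_le_ge_one[OF _ T'(3)]]])
  then have "S \<in> G" using S' by (simp add: ge_one_iff)
  moreover have "S \<in> L" using le_cone[OF T] A B by blast
  ultimately show ?thesis using that[OF T] by blast
qed

text \<open>For an epimorphism the truncation of the cone in degrees >= 0 is the cokernel and
  vanishes, so the cone has degrees <= -1 and the fibre, one shift below, has degrees <= 0. Besides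
  normality of epimorphisms this yields the triangle of a torsion sequence.\<close>

lemma heart_epi_fibre:
  assumes "is_epi (heart D L G) f" and f: "f \<in> Hom (heart D L G) A B"
  obtains S a h where "dtri S A B a f h" "S \<in> L \<inter> G"
proof -
  have A: "A \<in> L \<inter> G" and B: "B \<in> L \<inter> G" and fD: "f \<in> Hom D A B"
    using f by (simp_all add: heart_hom_iff)
  obtain S g h where T: "dtri A B S f g h" by (rule cone_ex[OF fD])
  obtain S' where S': "S' \<in> Obj D" "sh S' = S" by (rule unshift_obj[OF dtriD(7)[OF T]])
  obtain a where a: "dtri S' A B a f g" by (rule dtri_unrotate[OF T S'])
  obtain P Q p q c where T': "dtri (sh P) S Q p q c" "P \<in> L" "Q \<in> G"
    by (rule truncation_ge[OF dtriD(7)[OF T]])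
  note coker = heart_cokernel[OF T T'(1) A B T'(2,3)]
  note k = heart.is_cokernelD[OF coker(2) f]
  have qg: "q \<cdot> g \<in> Hom D B Q" by (rule comp_hom[OF dtriD(3)[OF T] dtriD(3)[OF T'(1)]])
  then have cod: "Cod D (q \<cdot> g) = Q" unfolding Hom_def by blast
  have z: "Zero D B Q \<in> Hom D B Q" by (rule zero_hom[OF hom_dom[OF qg] hom_cod[OF qg]])
  have "(q \<cdot> g) \<cdot> f = Zero D B Q \<cdot> f"
    using k(2) comp_zero_left[OF fD hom_cod[OF qg]] cod by simp
  moreover have "u \<cdot> f = v \<cdot> f \<Longrightarrow> u = v" if "u \<in> Hom D B Q" "v \<in> Hom D B Q" for u v
  proof -
    have "Cod (heart D L G) f = B" using f unfolding Hom_def by blast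
    moreover have "u \<in> Hom (heart D L G) B Q" "v \<in> Hom (heart D L G) B Q"
      using that coker(1) B by (simp_all add: heart_hom)
    ultimately show "u \<cdot> f = v \<cdot> f \<Longrightarrow> u = v"
      using assms(1) unfolding is_epi_def heart_sel by blast
  qed
  ultimately have "q \<cdot> g = Zero D B Q" using qg z by blast
  then have "Id D Q \<cdot> (q \<cdot> g) = Zero D Q Q \<cdot> (q \<cdot> g)"
    using comp_zero_left[OF qg hom_cod[OF qg]] id_left[OF qg] by simp
  then have "Id D Q = Zero D Q Q"
    using k(4)[of "Id D Q" Q "Zero D Q Q"] cod coker(1) id_hom[OF hom_cod[OF qg]]
      zero_hom[OF hom_cod[OF qg] hom_cod[OF qg]] by (simp add: heart_hom)
  then have zero: "zero_object D Q" using hom_cod[OF qg] by (simp add: zero_object_iff_id)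
  have "S' \<in> L"
  proof (rule le_if_null[OF S'(1)])
    fix M assume M: "M \<in> ge_one D G"
    then have "sh M \<in> G" unfolding ge_one_def by blast
    from null_middle_left[OF T'(1) null_sh_le_ge[OF T'(2) this] zero_object_null(1)[OF zero]]
    show "null D S' M" using null_shift[OF S'(1) ge_one_obj[OF M]] S'(2) by simp
  qed
  moreover have "S' \<in> G" using ge_fibre[OF a] A B by blast
  ultimately show ?thesis using that[OF a] by blast
qed

text \<open>Normality follows because the third vertex of the triangle on a monomorphism or
  epimorphism stays in the heart, so that this triangle is a short exact sequence.\<close>

sublocale heart: abelian_category "heart D L G"
proof
  fix f
  show "\<exists>k. is_kernel (heart D L G) k f" if arr: "f \<in> Arr (heart D L G)"
  proof -
    have f: "f \<in> Hom D (Dom D f) (Cod D f)" "Dom D f \<in> L \<inter> G" "Cod D f \<in> L \<inter> G"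
      using heart.arr_hom[OF arr] by (simp_all add: heart_hom_iff)
    obtain S a b where a: "dtri S (Dom D f) (Cod D f) a f b" by (rule fibre_ex[OF f(1)])
    obtain P M p m c where "dtri P S M p m c" "P \<in> L" "M \<in> ge_one D G"
      by (rule truncation[OF dtriD(5)[OF a]])
    then show ?thesis using heart_kernel(2)[OF a _ f(2,3)] by blast
  qed
  show "\<exists>c. is_cokernel (heart D L G) c f" if arr: "f \<in> Arr (heart D L G)"
  proof -
    have f: "f \<in> Hom D (Dom D f) (Cod D f)" "Dom D f \<in> L \<inter> G" "Cod D f \<in> L \<inter> G"
      using heart.arr_hom[OF arr] by (simp_all add: heart_hom_iff)
    obtain S g h where a: "dtri (Dom D f) (Cod D f) S f g h" by (rule cone_ex[OF f(1)])
    obtain P Q p q c where "dtri (sh P) S Q p q c" "P \<in> L" "Q \<in> G"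
      by (rule truncation_ge[OF dtriD(7)[OF a]])
    then show ?thesis using heart_cokernel(2)[OF a _ f(2,3)] by blast
  qed
  show "\<exists>g. is_kernel (heart D L G) f g" if m: "is_mono (heart D L G) f"
  proof -
    have arr: "f \<in> Arr (heart D L G)" using m unfolding is_mono_def by blast
    obtain S g h where S: "dtri (Dom D f) (Cod D f) S f g h" "S \<in> L \<inter> G"
      using heart_mono_cone[OF m heart.arr_hom[OF arr]] by auto
    have "short_exact (heart D L G) f g"
      by (rule dtri_heart_short_exact[OF S(1) _ _ S(2)])
        (use heart.arr_hom[OF arr] in \<open>simp_all add: heart_hom_iff\<close>)
    then show ?thesis unfolding short_exact_def by blast
  qed
  show "\<exists>g. is_cokernel (heart D L G) f g" if e: "is_epi (heart D L G) f"
  proof -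
    have arr: "f \<in> Arr (heart D L G)" using e unfolding is_epi_def by blast
    obtain S a h where S: "dtri S (Dom D f) (Cod D f) a f h" "S \<in> L \<inter> G"
      using heart_epi_fibre[OF e heart.arr_hom[OF arr]] by auto
    have "short_exact (heart D L G) a f"
      by (rule dtri_heart_short_exact[OF S])
        (use heart.arr_hom[OF arr] in \<open>simp_all add: heart_hom_iff\<close>)
    then show ?thesis unfolding short_exact_def by blast
  qed
qed

end

section \<open>Tilting a t-structure at a torsion theory\<close>

locale truncation_pair = triangulated_category D
  for D :: "('o, 'm) triang_data" (structure) +
  fixes L M :: "'o set"
  assumes left_iso_closed: "iso_closed D L"
    and right_iso_closed: "iso_closed D M"
    and pair_null: "\<lbrakk>X \<in> L; Y \<in> M\<rbrakk> \<Longrightarrow> null D X Y"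
    and ex_pair_triangle: "K \<in> Obj D \<Longrightarrow> \<exists>A B f g h. dtri A K B f g h \<and> A \<in> L \<and> B \<in> M"

context t_structure
begin

text \<open>The right half consists of the objects of degrees >= 1, not of \<open>G\<close>: between
  \<open>L\<close> and \<open>G\<close> there may be morphisms in degree 0.\<close>

lemma t_structure_pair: "truncation_pair D L (ge_one D G)"
proof (intro truncation_pair.intro truncation_pair_axioms.intro)
  show "triangulated_category D" by (rule triangulated_category_axioms)
  show "iso_closed D L" "iso_closed D (ge_one D G)" by (rule le_iso_closed ge_one_iso_closed)+
  show "null D X Y" if "X \<in> L" "Y \<in> ge_one D G" for X Y by (rule null_le_ge_one[OF that])
  show "\<exists>A B f g h. dtri A K B f g h \<and> A \<in> L \<and> B \<in> ge_one D G" if "K \<in> Obj D" for K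
    by (rule truncation[OF that]) blast
qed

section \<open>The chosen truncations, and \<open>H0\<close> as seen by Hom\<close>

lemma tau_le_dtri:
  assumes "K \<in> Obj D"
  obtains M f g h where "dtri (Ob (tau_le D L G) K) K M f g h" "Ob (tau_le D L G) K \<in> L"
    "M \<in> ge_one D G"
proof -
  have "\<exists>f g h. (f, g, h) \<in> Dist D \<and> Dom D f \<in> L \<and> Cod D f = K \<and> Cod D g \<in> ge_one D G"
    by (rule ex_truncation[OF assms])
  then have "\<exists>g h. (le_arrow D L G K, g, h) \<in> Dist D \<and> Dom D (le_arrow D L G K) \<in> L \<and>
      Cod D (le_arrow D L G K) = K \<and> Cod D g \<in> ge_one D G"
    unfolding le_arrow_def by (rule someI_ex)
  then obtain g h where t: "(le_arrow D L G K, g, h) \<in> Dist D" "Dom D (le_arrow D L G K) \<in> L"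
      "Cod D (le_arrow D L G K) = K" "Cod D g \<in> ge_one D G"
    by blast
  have "dtri (Ob (tau_le D L G) K) K (Cod D g) (le_arrow D L G K) g h"
    using dtriI[OF t(1)] t(3) unfolding tau_le_def dtri_def Hom_def by (auto simp: Let_def)
  then show ?thesis using that t(2,4) unfolding tau_le_def by (auto simp: Let_def)
qed

lemma tau_ge_dtri:
  assumes "K \<in> Obj D"
  obtains P f g h where "dtri (sh P) K (Ob (tau_ge D L G) K) f g h" "P \<in> L"
    "Ob (tau_ge D L G) K \<in> G"
proof -
  obtain A B a b c where T: "dtri (sh A) K B a b c" "A \<in> L" "B \<in> G" by (rule truncation_ge[OF assms])
  have "Dom D a \<in> le_minus_one D L" "Dom D b = K" "Cod D b \<in> G"
    using dtriD(2,3)[OF T(1)] T(2,3) unfolding le_minus_one_def Hom_def by auto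
  then have "\<exists>g f h. (f, g, h) \<in> Dist D \<and> Dom D f \<in> le_minus_one D L \<and> Dom D g = K \<and> Cod D g \<in> G"
    using dtriD(1)[OF T(1)] by blast
  then have "\<exists>f h. (f, ge_arrow D L G K, h) \<in> Dist D \<and> Dom D f \<in> le_minus_one D L \<and>
      Dom D (ge_arrow D L G K) = K \<and> Cod D (ge_arrow D L G K) \<in> G"
    unfolding ge_arrow_def by (rule someI_ex)
  then obtain f h where t: "(f, ge_arrow D L G K, h) \<in> Dist D" "Dom D f \<in> le_minus_one D L"
      "Dom D (ge_arrow D L G K) = K" "Cod D (ge_arrow D L G K) \<in> G"
    by blast
  obtain P where P: "P \<in> L" "Dom D f = sh P" using t(2) unfolding le_minus_one_def by blast
  have "dtri (sh P) K (Ob (tau_ge D L G) K) f (ge_arrow D L G K) h"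
    using dtriI[OF t(1)] t(3) P(2) unfolding tau_ge_def by (simp add: Let_def)
  then show ?thesis using that[OF _ P(1)] t(4) unfolding tau_ge_def by (simp add: Let_def)
qed

text \<open>For \<open>K\<close> in \<open>L\<close> the first truncation changes nothing up to
  isomorphism, since \<open>M\<close> lies in \<open>L\<close> and in degrees >= 1. The second one
  removes \<open>sh P'\<close>; neither this object nor its shift maps to \<open>W\<close>, so
  vanishing of Hom into \<open>W\<close> is unaffected.\<close>

lemma H0_le:
  assumes "K \<in> L"
  shows "Ob (H0 D L G) K \<in> L \<inter> G"
    and "W \<in> G \<Longrightarrow> null D (Ob (H0 D L G) K) W \<longleftrightarrow> null D K W"
proof -
  define P where "P = Ob (tau_le D L G) K"
  obtain M f g h where T: "dtri P K M f g h" "P \<in> L" "M \<in> ge_one D G"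
    using tau_le_dtri[OF le_obj[OF assms]] unfolding P_def by metis
  note t = dtriD[OF T(1)]
  have "null D M M" by (rule null_le_ge_one[OF le_cone[OF T(1,2) assms] T(3)])
  then have "zero_object D M" by (rule zero_object_if_null[OF t(7)])
  from isomorphicI[OF iso_if_cone_zero[OF T(1) this] t(2)] have iso: "isomorphic D P K" .
  define Q where "Q = Ob (tau_ge D L G) P"
  have Q: "Ob (H0 D L G) K = Q" unfolding Q_def P_def H0_def comp_functor_def by simp
  obtain P' f' g' h' where T': "dtri (sh P') P Q f' g' h'" "P' \<in> L" "Q \<in> G"
    using tau_ge_dtri[OF t(5)] unfolding Q_def by metis
  show "Ob (H0 D L G) K \<in> L \<inter> G"
    using Q T'(3) le_cone[OF T'(1) sh_le[OF T'(2)] T(2)] by simp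
  assume W: "W \<in> G"
  have "null D Q W \<longleftrightarrow> null D P W"
    using null_middle_left[OF T'(1) null_sh_le_ge[OF T'(2) W]]
      null_cone_left[OF T'(1) _ null_sh_le_ge[OF sh_le[OF T'(2)] W]] by blast
  also have "\<dots> \<longleftrightarrow> null D K W"
    using null_isomorphic_left[OF iso] null_isomorphic_left[OF isomorphic_sym[OF iso]] by blast
  finally show "null D (Ob (H0 D L G) K) W \<longleftrightarrow> null D K W" unfolding Q .
qed

text \<open>Now the first truncation already lands in the heart, and the second is an isomorphism.
  Passing from \<open>K\<close> to \<open>P\<close> loses only morphisms involving \<open>M\<close>
  and M[-1], to which \<open>W\<close> is orthogonal.\<close>

lemma H0_ge:
  assumes "K \<in> G"
  shows "Ob (H0 D L G) K \<in> L \<inter> G"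
    and "W \<in> L \<Longrightarrow> null D W (Ob (H0 D L G) K) \<longleftrightarrow> null D W K"
proof -
  define P where "P = Ob (tau_le D L G) K"
  obtain M f g h where T: "dtri P K M f g h" "P \<in> L" "M \<in> ge_one D G"
    using tau_le_dtri[OF ge_obj[OF assms]] unfolding P_def by metis
  note t = dtriD[OF T(1)]
  have P: "P \<in> G" by (rule ge_fibre[OF T(1) assms ge_one_ge[OF T(3)]])
  define Q where "Q = Ob (tau_ge D L G) P"
  have Q: "Ob (H0 D L G) K = Q" unfolding Q_def P_def H0_def comp_functor_def by simp
  obtain P' f' g' h' where T': "dtri (sh P') P Q f' g' h'" "P' \<in> L" "Q \<in> G"
    using tau_ge_dtri[OF t(5)] unfolding Q_def by metis
  note t' = dtriD[OF T'(1)]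
  have "null D (sh P') (sh P')" by (rule null_sh_le_ge[OF T'(2) ge_fibre[OF T'(1) P T'(3)]])
  then have "zero_object D (sh P')" by (rule zero_object_if_null[OF t'(5)])
  from isomorphicI[OF iso_if_fibre_zero[OF T'(1) this] t'(3)] have iso: "isomorphic D P Q" .
  show "Ob (H0 D L G) K \<in> L \<inter> G"
    using Q T'(3) iso_closedD[OF le_iso_closed iso T(2)] by simp
  assume W: "W \<in> L"
  obtain M' where M': "M' \<in> Obj D" "sh M' = M" by (rule unshift_obj[OF t(7)])
  have "M' \<in> ge_one D G" using M' ge_one_ge[OF T(3)] by (simp add: ge_one_iff)
  then have n: "null D W M'" by (rule null_le_ge_one[OF W])
  have "null D W Q \<longleftrightarrow> null D W P"
    using null_isomorphic_right[OF iso] null_isomorphic_right[OF isomorphic_sym[OF iso]] by blast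
  also have "\<dots> \<longleftrightarrow> null D W K"
    using null_middle_right[OF T(1) _ null_le_ge_one[OF W T(3)]]
      null_fibre_right[OF T(1) M' _ n] by blast
  finally show "null D W (Ob (H0 D L G) K) \<longleftrightarrow> null D W K" unfolding Q .
qed

end

definition tilt_le :: "('o, 'm) triang_data \<Rightarrow> 'o set \<Rightarrow> 'o set \<Rightarrow> 'o set" where
  "tilt_le D L F = {K \<in> L. \<forall>Y \<in> F. null D K Y}"

definition tilt_ge :: "('o, 'm) triang_data \<Rightarrow> 'o set \<Rightarrow> 'o set \<Rightarrow> 'o set" where
  "tilt_ge D G T = {K \<in> G. \<forall>X \<in> T. null D X K}"

section \<open>The tilted pair of a torsion theory on the heart\<close>

locale tilted_t_structure = t_structure D L G + torsion: torsion_theory "heart D L G" T F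
  for D :: "('o, 'm) triang_data" (structure) and L G T F :: "'o set"
begin

lemma torsion_heart: "T \<subseteq> L \<inter> G"
  using torsion.torsion_iso_closed unfolding iso_closed_def by simp

lemma free_heart: "F \<subseteq> L \<inter> G"
  using torsion.free_iso_closed unfolding iso_closed_def by simp

lemma null_torsion_free: "\<lbrakk>X \<in> T; Y \<in> F\<rbrakk> \<Longrightarrow> null D X Y"
  using torsion.null_torsion_free[of X Y] heart_null torsion_heart free_heart by blast

text \<open>On the heart the orthogonality condition recovers the torsion class, because that class
  is the left orthogonal of \<open>F\<close>. Applied to \<open>H0\<close> of an object of
  \<open>L\<close>, this identifies \<open>tilt_le\<close> with a condition on cohomology.\<close>

lemma tilt_le_heart:
  assumes X: "X \<in> L \<inter> G"
  shows "X \<in> tilt_le D L F \<longleftrightarrow> X \<in> T"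
proof
  assume "X \<in> T"
  then show "X \<in> tilt_le D L F" using X null_torsion_free unfolding tilt_le_def by blast
next
  assume X': "X \<in> tilt_le D L F"
  show "X \<in> T"
  proof (rule torsion.torsion_if_null)
    show "X \<in> Obj (heart D L G)" using X by simp
    show "null (heart D L G) X Y" if "Y \<in> F" for Y
      using heart_null[OF X, of Y] X' that free_heart unfolding tilt_le_def by blast
  qed
qed

lemma tilt_ge_heart:
  assumes X: "X \<in> L \<inter> G"
  shows "X \<in> tilt_ge D G T \<longleftrightarrow> X \<in> F"
proof
  assume "X \<in> F"
  then show "X \<in> tilt_ge D G T" using X null_torsion_free unfolding tilt_ge_def by blast
next
  assume X': "X \<in> tilt_ge D G T"
  show "X \<in> F"
  proof (rule torsion.free_if_null)
    show "X \<in> Obj (heart D L G)" using X by simp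
    show "null (heart D L G) Y X" if "Y \<in> T" for Y
      using heart_null[OF _ X, of Y] X' that torsion_heart unfolding tilt_ge_def by blast
  qed
qed

lemma H0_torsion_iff: "K \<in> L \<Longrightarrow> Ob (H0 D L G) K \<in> T \<longleftrightarrow> K \<in> tilt_le D L F"
  using tilt_le_heart[OF H0_le(1), of K] H0_le[of K] free_heart unfolding tilt_le_def by blast

lemma H0_free_iff: "K \<in> G \<Longrightarrow> Ob (H0 D L G) K \<in> F \<longleftrightarrow> K \<in> tilt_ge D G T"
  using tilt_ge_heart[OF H0_ge(1), of K] H0_ge[of K] torsion_heart unfolding tilt_ge_def by blast

text \<open>The epimorphism \<open>g\<close> of the torsion sequence has a fibre \<open>S\<close> in
  the heart. Both \<open>f\<close> and the morphism from \<open>S\<close> are kernels of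
  \<open>g\<close>, so \<open>S\<close> is isomorphic to the torsion part and thus torsion.\<close>

lemma torsion_triangle:
  assumes A: "A \<in> L \<inter> G"
  obtains X Y f g h where "dtri X A Y f g h" "X \<in> T" "Y \<in> F"
proof -
  have "A \<in> Obj (heart D L G)" using A by simp
  then obtain f g where fg: "short_exact (heart D L G) f g" "Dom D f \<in> T" "Cod D f = A" "Cod D g \<in> F"
    using torsion.ex_torsion_sequence[of A] unfolding heart_sel by blast
  have ker: "is_kernel (heart D L G) f g" and coker: "is_cokernel (heart D L G) g f"
    using fg(1) unfolding short_exact_def by blast+
  have g: "g \<in> Hom (heart D L G) A (Cod D g)"
    using ker fg(3) unfolding is_kernel_def Hom_def by auto
  obtain S a h where S: "dtri S A (Cod D g) a g h" "S \<in> L \<inter> G"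
    by (rule heart_epi_fibre[OF heart.cokernel_epi[OF coker] g])
  have "is_kernel (heart D L G) a g"
    using dtri_heart_short_exact[OF S(1,2) A] g unfolding short_exact_def heart_hom_iff by blast
  from heart.kernel_unique[OF ker this g] have "isomorphic (heart D L G) (Dom D f) S"
    using dtriD(2)[OF S(1)] unfolding Hom_def by simp
  then have "S \<in> T" by (rule iso_closedD[OF torsion.torsion_iso_closed _ fg(2)])
  then show ?thesis using that S(1) fg(4) by blast
qed

text \<open>\<open>Y\<close> is split by its truncation triangle. The lower part \<open>P\<close>
  lies in the heart and is torsion-free, as Hom(V, P) for torsion \<open>V\<close> is squeezed
  between Hom(V, M[-1]) and Hom(V, Y), both zero; so \<open>X\<close> maps trivially to
  \<open>P\<close>, and to \<open>M\<close> by degrees.\<close>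

lemma tilt_null:
  assumes X: "X \<in> tilt_le D L F" and Y: "Y \<in> tilt_ge D G T"
  shows "null D X Y"
proof -
  have YG: "Y \<in> G" and XL: "X \<in> L" using X Y unfolding tilt_le_def tilt_ge_def by blast+
  obtain P M f g h where t: "dtri P Y M f g h" "P \<in> L" "M \<in> ge_one D G"
    by (rule truncation[OF ge_obj[OF YG]])
  have P: "P \<in> L \<inter> G" using t(2) ge_fibre[OF t(1) YG ge_one_ge[OF t(3)]] by blast
  obtain M' where M': "M' \<in> Obj D" "sh M' = M" by (rule unshift_obj[OF ge_one_obj[OF t(3)]])
  have M'1: "M' \<in> ge_one D G" using M' ge_one_ge[OF t(3)] by (simp add: ge_one_iff)
  have "null D V P" if V: "V \<in> T" for V
  proof (rule null_fibre_right[OF t(1) M'])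
    show "null D V Y" using Y V unfolding tilt_ge_def by blast
    show "null D V M'" using null_le_ge_one[OF _ M'1] torsion_heart V by blast
  qed
  then have "P \<in> tilt_ge D G T" using P unfolding tilt_ge_def by blast
  then have "P \<in> F" using tilt_ge_heart[OF P] by simp
  then have "null D X P" using X unfolding tilt_le_def by blast
  then show ?thesis by (rule null_middle_right[OF t(1) _ null_le_ge_one[OF XL t(3)]])
qed

text \<open>With \<open>P\<close> the lower truncation of \<open>K\<close> and \<open>A\<close> its
  cohomology in degree 0, the object \<open>K'\<close> is to be the preimage in \<open>P\<close> of
  the torsion part \<open>X\<close> of \<open>A\<close>, and \<open>B\<close> the corresponding
  quotient of \<open>K\<close>. Two octahedra exhibit \<open>K'\<close> as an extension of
  \<open>X\<close> by the part of degrees <= -1, and \<open>B\<close> as an extension of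
  \<open>M\<close> by the torsion-free part \<open>Y\<close>.\<close>

lemma tilt_triangle:
  assumes K: "K \<in> Obj D"
  shows "\<exists>A B f g h. dtri A K B f g h \<and> A \<in> tilt_le D L F \<and> B \<in> tilt_ge D G T"
proof -
  obtain P M i m n where PKM: "dtri P K M i m n" "P \<in> L" "M \<in> ge_one D G" by (rule truncation[OF K])
  obtain P' A j p q where PA: "dtri (sh P') P A j p q" "P' \<in> L" "A \<in> G"
    by (rule truncation_ge[OF dtriD(5)[OF PKM(1)]])
  have A: "A \<in> L \<inter> G" using le_cone[OF PA(1) sh_le[OF PA(2)] PKM(2)] PA(3) by blast
  obtain X Y x y z where XAY: "dtri X A Y x y z" "X \<in> T" "Y \<in> F" by (rule torsion_triangle[OF A])
  have X: "X \<in> L" and Y: "Y \<in> G" using XAY(2,3) torsion_heart free_heart by blast+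
  \<comment> \<open>The fibre of \<open>P -> A -> Y\<close> is the triangulated substitute for the
    preimage of the kernel \<open>X\<close> of \<open>y\<close>.\<close>
  have "y \<cdot> p \<in> Hom D P Y" by (rule comp_hom[OF dtriD(3)[OF PA(1)] dtriD(3)[OF XAY(1)]])
  then obtain K' k l where K': "dtri K' P Y k (y \<cdot> p) l" by (rule fibre_ex)
  note K'obj = dtriD(5)[OF K']
  \<comment> \<open>The octahedral axiom compares cones, whereas the objects of interest are fibres.
    After rotation these become cones, each shifted once; \<open>nK'\<close> below removes the shift
    at the level of Hom.\<close>
  obtain u v w where oct: "dtri (sh (sh P')) (sh K') (sh X) u v w"
    by (rule octahedron[OF dtri_rotate[OF PA(1)] dtri_rotate[OF XAY(1)] dtri_rotate[OF K']])
  have nK': "null D K' W" if W: "null D (sh P') W" "null D X W" "W \<in> Obj D" for W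
  proof -
    have "null D (sh (sh P')) (sh W)" "null D (sh X) (sh W)"
      using W null_shift[OF shift_obj[OF le_obj[OF PA(2)]] W(3)] null_shift[OF le_obj[OF X] W(3)]
      by simp_all
    then have "null D (sh K') (sh W)" by (rule null_middle_left[OF oct])
    then show ?thesis using null_shift[OF K'obj W(3)] by simp
  qed
  have "K' \<in> L"
  proof (rule le_if_null[OF K'obj])
    fix W assume W: "W \<in> ge_one D G"
    show "null D K' W"
      by (rule nK'[OF null_le_ge_one[OF sh_le[OF PA(2)] W] null_le_ge_one[OF X W] ge_one_obj[OF W]])
  qed
  moreover have "null D K' W" if W: "W \<in> F" for W
  proof -
    have WG: "W \<in> G" using W free_heart by blast
    show ?thesis
      by (rule nK'[OF null_sh_le_ge[OF PA(2) WG] null_torsion_free[OF XAY(2) W] ge_obj[OF WG]])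
  qed
  ultimately have K'tilt: "K' \<in> tilt_le D L F" unfolding tilt_le_def by blast
  obtain B b c where B: "dtri K' K B (i \<cdot> k) b c"
    using cone_ex[OF comp_hom[OF dtriD(2)[OF K'] dtriD(2)[OF PKM(1)]]] by metis
  \<comment> \<open>The octahedron of \<open>K' -> P -> K\<close>: the cone of the first morphism is
    \<open>Y\<close>, that of the second is \<open>M\<close>.\<close>
  obtain r s t where YBM: "dtri Y B M r s t" by (rule octahedron[OF K' PKM(1) B])
  have "B \<in> G" by (rule ge_middle[OF YBM Y ge_one_ge[OF PKM(3)]])
  moreover have "null D V B" if V: "V \<in> T" for V
  proof (rule null_middle_right[OF YBM null_torsion_free[OF V XAY(3)]])
    show "null D V M" using null_le_ge_one[OF _ PKM(3)] V torsion_heart by blast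
  qed
  ultimately have "B \<in> tilt_ge D G T" unfolding tilt_ge_def by blast
  then show ?thesis using B K'tilt by blast
qed

lemma tilt_pair: "truncation_pair D (tilt_le D L F) (tilt_ge D G T)"
proof (intro truncation_pair.intro truncation_pair_axioms.intro)
  show "triangulated_category D" by (rule triangulated_category_axioms)
  show "iso_closed D (tilt_le D L F)"
  proof (rule iso_closedI)
    show "tilt_le D L F \<subseteq> Obj D" unfolding tilt_le_def using le_obj by blast
    show "Y \<in> tilt_le D L F" if "isomorphic D X Y" "X \<in> tilt_le D L F" for X Y
      using that null_isomorphic_left[OF that(1)] iso_closedD[OF le_iso_closed that(1)]
      unfolding tilt_le_def by blast
  qed
  show "iso_closed D (tilt_ge D G T)"
  proof (rule iso_closedI)
    show "tilt_ge D G T \<subseteq> Obj D" unfolding tilt_ge_def using ge_obj by blast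
    show "Y \<in> tilt_ge D G T" if "isomorphic D X Y" "X \<in> tilt_ge D G T" for X Y
      using that null_isomorphic_right[OF that(1)] iso_closedD[OF ge_iso_closed that(1)]
      unfolding tilt_ge_def by blast
  qed
  show "null D X Y" if "X \<in> tilt_le D L F" "Y \<in> tilt_ge D G T" for X Y by (rule tilt_null[OF that])
  show "\<exists>A B f g h. dtri A K B f g h \<and> A \<in> tilt_le D L F \<and> B \<in> tilt_ge D G T"
    if "K \<in> Obj D" for K
    by (rule tilt_triangle[OF that])
qed

end

text \<open>The two inclusions are what keeps the truncation of an object of the heart inside the
  heart; without them a triangle for the pair would say nothing about exactness in the
  heart.\<close>

lemma (in t_structure) torsion_theory_if_pair:
  assumes "truncation_pair D L' M'" and "L' \<subseteq> L" and "M' \<subseteq> G"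
  shows "torsion_theory (heart D L G) (L \<inter> G \<inter> L') (L \<inter> G \<inter> M')"
proof -
  interpret pair: truncation_pair D L' M' by (rule assms(1))
  show ?thesis
  proof (intro torsion_theory.intro torsion_theory_axioms.intro)
    show "abelian_category (heart D L G)" by (rule heart.abelian_category_axioms)
    show "iso_closed (heart D L G) (L \<inter> G \<inter> L')"
    proof (rule iso_closedI)
      show "Y \<in> L \<inter> G \<inter> L'" if "isomorphic (heart D L G) X Y" "X \<in> L \<inter> G \<inter> L'" for X Y
        using that iso_closedD[OF pair.left_iso_closed, of X Y] by (simp add: heart_isomorphic)
    qed auto
    show "iso_closed (heart D L G) (L \<inter> G \<inter> M')"
    proof (rule iso_closedI)
      show "Y \<in> L \<inter> G \<inter> M'" if "isomorphic (heart D L G) X Y" "X \<in> L \<inter> G \<inter> M'" for X Y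
        using that iso_closedD[OF pair.right_iso_closed, of X Y] by (simp add: heart_isomorphic)
    qed auto
    show "Hom (heart D L G) X Y = {Zero (heart D L G) X Y}"
      if "X \<in> L \<inter> G \<inter> L'" "Y \<in> L \<inter> G \<inter> M'" for X Y
    proof -
      have "null D X Y" by (rule pair.pair_null) (use that in blast)+
      then show ?thesis
        using that zero_hom[OF le_obj le_obj, of X Y] heart_hom[of X Y] unfolding null_def by auto
    qed
    show "\<exists>f g. short_exact (heart D L G) f g \<and> Dom (heart D L G) f \<in> L \<inter> G \<inter> L' \<and>
        Cod (heart D L G) f = X \<and> Cod (heart D L G) g \<in> L \<inter> G \<inter> M'"
      if X: "X \<in> Obj (heart D L G)" for X
    proof -
      have XH: "X \<in> L \<inter> G" using X by simp
      then obtain A B f g h where t: "dtri A X B f g h" "A \<in> L'" "B \<in> M'"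
        using pair.ex_pair_triangle le_obj by blast
      \<comment> \<open>\<open>A\<close> is in \<open>L\<close> by assumption, and in
        \<open>G\<close> as the fibre of \<open>X -> B\<close> between objects of \<open>G\<close>;
        dually, \<open>B\<close> is in \<open>L\<close> as a cone.\<close>
      have A: "A \<in> L \<inter> G" using t(2,3) assms(2,3) ge_fibre[OF t(1)] XH by blast
      have B: "B \<in> L \<inter> G" using t(2,3) assms(2,3) le_cone[OF t(1)] XH by blast
      have "short_exact (heart D L G) f g" by (rule dtri_heart_short_exact[OF t(1) A XH B])
      moreover have "Dom D f = A" "Cod D f = X" "Cod D g = B"
        using dtriD(2,3)[OF t(1)] unfolding Hom_def by blast+
      ultimately show ?thesis using t(2,3) A B by auto
    qed
  qed
qed

section \<open>Adjoint triangulated functors\<close>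

locale exact_functor = C: triangulated_category C + D: triangulated_category D
  for C :: "('o, 'm) triang_data" and D :: "('p, 'n) triang_data" +
  fixes F :: "('o, 'm, 'p, 'n) functor_data"
  assumes exact: "triangulated_functor C D F"
begin

lemma functorial: "is_functor C D F"
  using exact unfolding triangulated_functor_def additive_functor_def by blast

lemma map_obj: "X \<in> Obj C \<Longrightarrow> Ob F X \<in> Obj D"
  using functorial unfolding is_functor_def by blast

lemma map_hom: "f \<in> Hom C X Y \<Longrightarrow> Ar F f \<in> Hom D (Ob F X) (Ob F Y)"
  using functorial unfolding is_functor_def by blast

lemma map_id: "X \<in> Obj C \<Longrightarrow> Ar F (Id C X) = Id D (Ob F X)"
  using functorial unfolding is_functor_def by blast

lemma map_comp:
  "\<lbrakk>f \<in> Hom C X Y; g \<in> Hom C Y Z\<rbrakk> \<Longrightarrow> Ar F (g \<cdot>\<^bsub>C\<^esub> f) = Ar F g \<cdot>\<^bsub>D\<^esub> Ar F f"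
  using functorial unfolding is_functor_def by blast

lemma map_add:
  "\<lbrakk>f \<in> Hom C X Y; g \<in> Hom C X Y\<rbrakk> \<Longrightarrow> Ar F (f \<boxplus>\<^bsub>C\<^esub> g) = Ar F f \<boxplus>\<^bsub>D\<^esub> Ar F g"
  using exact unfolding triangulated_functor_def additive_functor_def by blast

lemma map_zero:
  assumes "X \<in> Obj C" and "Y \<in> Obj C"
  shows "Ar F (Zero C X Y) = Zero D (Ob F X) (Ob F Y)"
proof (rule D.idem_zero[OF map_hom[OF C.zero_hom[OF assms]]])
  have z: "Zero C X Y \<in> Hom C X Y" by (rule C.zero_hom[OF assms])
  show "Ar F (Zero C X Y) \<boxplus>\<^bsub>D\<^esub> Ar F (Zero C X Y) = Ar F (Zero C X Y)"
    using map_add[OF z z] C.add_zero[OF z] by simp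
qed

lemma map_isomorphic:
  assumes "isomorphic C X Y"
  shows "isomorphic D (Ob F X) (Ob F Y)"
proof -
  obtain f g where f: "f \<in> Hom C X Y" "g \<in> Hom C Y X" "g \<cdot>\<^bsub>C\<^esub> f = Id C X" "f \<cdot>\<^bsub>C\<^esub> g = Id C Y"
    using assms unfolding isomorphic_def by (meson is_isoE)
  have "Ar F g \<cdot>\<^bsub>D\<^esub> Ar F f = Id D (Ob F X)"
    using map_comp[OF f(1,2)] f(3) map_id[OF C.hom_dom[OF f(1)]] by simp
  moreover have "Ar F f \<cdot>\<^bsub>D\<^esub> Ar F g = Id D (Ob F Y)"
    using map_comp[OF f(2,1)] f(4) map_id[OF C.hom_cod[OF f(1)]] by simp
  ultimately show ?thesis
    by (rule isomorphicI[OF is_isoI[OF map_hom[OF f(1)] map_hom[OF f(2)]] map_hom[OF f(1)]])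
qed

text \<open>The third morphism of the image is twisted by the comparison of \<open>F\<close> with
  the shifts. Since cones and fibres depend only on one morphism, its mere existence
  suffices.\<close>

lemma map_dtri:
  assumes "C.dtri X Y Z f g h"
  obtains h' where "D.dtri (Ob F X) (Ob F Y) (Ob F Z) (Ar F f) (Ar F g) h'"
proof -
  note t = C.dtriD[OF assms]
  obtain h' where "(Ar F f, Ar F g, h') \<in> Dist D"
    using exact t(1) unfolding triangulated_functor_def by blast
  then show ?thesis using that D.dtriI'[OF _ map_hom[OF t(2)] map_hom[OF t(3)]] by blast
qed

lemma map_shift:
  assumes "X \<in> Obj C"
  shows "isomorphic D (Ob F (Ob (Shift C) X)) (Ob (Shift D) (Ob F X))"
proof -
  obtain \<phi> where "nat_trans C D (F \<odot> Shift C) (Shift D \<odot> F) \<phi>" "\<forall>X \<in> Obj C. is_iso D (\<phi> X)"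
    using exact unfolding triangulated_functor_def by blast
  then have "\<phi> X \<in> Hom D (Ob F (Ob (Shift C) X)) (Ob (Shift D) (Ob F X))" "is_iso D (\<phi> X)"
    using assms unfolding nat_trans_def comp_functor_def by auto
  then show ?thesis by (rule isomorphicI[rotated])
qed

text \<open>\<open>F\<close> commutes with the shifts only up to isomorphism, so degree conditions
  can be transported only for isomorphism-closed classes.\<close>

lemma map_shift_mem_iff:
  "\<lbrakk>iso_closed D S; X \<in> Obj C\<rbrakk> \<Longrightarrow> Ob F (Ob (Shift C) X) \<in> S \<longleftrightarrow> Ob (Shift D) (Ob F X) \<in> S"
  using iso_closedD map_shift isomorphic_sym by metis

end

section \<open>Transposition along an adjunction\<close>

locale adjoint_functors = left: exact_functor C D F + right: exact_functor D C G
  for C :: "('o, 'm) triang_data" and D :: "('p, 'n) triang_data"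
    and F :: "('o, 'm, 'p, 'n) functor_data" and G :: "('p, 'n, 'o, 'm) functor_data" +
  fixes \<eta> :: "'o \<Rightarrow> 'm" and \<epsilon> :: "'p \<Rightarrow> 'n"
  assumes adj: "adjunction C D F G \<eta> \<epsilon>"
begin

lemma unit_hom: "X \<in> Obj C \<Longrightarrow> \<eta> X \<in> Hom C X (Ob G (Ob F X))"
  using adj unfolding adjunction_def nat_trans_def id_functor_def comp_functor_def by simp

lemma counit_hom: "Y \<in> Obj D \<Longrightarrow> \<epsilon> Y \<in> Hom D (Ob F (Ob G Y)) Y"
  using adj unfolding adjunction_def nat_trans_def id_functor_def comp_functor_def by simp

lemma unit_natural:
  assumes "f \<in> Hom C X Y"
  shows "\<eta> Y \<cdot>\<^bsub>C\<^esub> f = Ar G (Ar F f) \<cdot>\<^bsub>C\<^esub> \<eta> X"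
proof -
  have "f \<in> Arr C" "Dom C f = X" "Cod C f = Y" using assms unfolding Hom_def by blast+
  then show ?thesis
    using adj unfolding adjunction_def nat_trans_def id_functor_def comp_functor_def by auto
qed

lemma counit_natural:
  assumes "f \<in> Hom D X Y"
  shows "\<epsilon> Y \<cdot>\<^bsub>D\<^esub> Ar F (Ar G f) = f \<cdot>\<^bsub>D\<^esub> \<epsilon> X"
proof -
  have "f \<in> Arr D" "Dom D f = X" "Cod D f = Y" using assms unfolding Hom_def by blast+
  then show ?thesis
    using adj unfolding adjunction_def nat_trans_def id_functor_def comp_functor_def by auto
qed

lemma left_triangle: "X \<in> Obj C \<Longrightarrow> \<epsilon> (Ob F X) \<cdot>\<^bsub>D\<^esub> Ar F (\<eta> X) = Id D (Ob F X)"
  using adj unfolding adjunction_def by blast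

lemma right_triangle: "Y \<in> Obj D \<Longrightarrow> Ar G (\<epsilon> Y) \<cdot>\<^bsub>C\<^esub> \<eta> (Ob G Y) = Id C (Ob G Y)"
  using adj unfolding adjunction_def by blast

text \<open>Naturality of the counit moves \<open>f\<close> to the outside, where a triangle
  identity remains. With \<open>right_transpose\<close> this makes the two transpositions mutually
  inverse.\<close>

lemma left_transpose:
  assumes f: "f \<in> Hom D (Ob F X) Y" and X: "X \<in> Obj C"
  shows "\<epsilon> Y \<cdot>\<^bsub>D\<^esub> Ar F (Ar G f \<cdot>\<^bsub>C\<^esub> \<eta> X) = f"
proof -
  note e = counit_hom[OF left.D.hom_cod[OF f]] and n = unit_hom[OF X] and Gf = right.map_hom[OF f]
  have "\<epsilon> Y \<cdot>\<^bsub>D\<^esub> Ar F (Ar G f \<cdot>\<^bsub>C\<^esub> \<eta> X) = (\<epsilon> Y \<cdot>\<^bsub>D\<^esub> Ar F (Ar G f)) \<cdot>\<^bsub>D\<^esub> Ar F (\<eta> X)"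
    unfolding left.map_comp[OF n Gf]
    by (rule left.D.comp_assoc[symmetric, OF left.map_hom[OF n] left.map_hom[OF Gf] e])
  also have "\<dots> = f \<cdot>\<^bsub>D\<^esub> (\<epsilon> (Ob F X) \<cdot>\<^bsub>D\<^esub> Ar F (\<eta> X))"
    unfolding counit_natural[OF f]
    by (rule left.D.comp_assoc[OF left.map_hom[OF n] counit_hom[OF left.map_obj[OF X]] f])
  also have "\<dots> = f" unfolding left_triangle[OF X] by (rule left.D.id_right[OF f])
  finally show ?thesis .
qed

lemma right_transpose:
  assumes g: "g \<in> Hom C X (Ob G Y)" and Y: "Y \<in> Obj D"
  shows "Ar G (\<epsilon> Y \<cdot>\<^bsub>D\<^esub> Ar F g) \<cdot>\<^bsub>C\<^esub> \<eta> X = g"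
proof -
  note e = counit_hom[OF Y] and n = unit_hom[OF left.C.hom_dom[OF g]] and Fg = left.map_hom[OF g]
  have "Ar G (\<epsilon> Y \<cdot>\<^bsub>D\<^esub> Ar F g) \<cdot>\<^bsub>C\<^esub> \<eta> X = Ar G (\<epsilon> Y) \<cdot>\<^bsub>C\<^esub> (Ar G (Ar F g) \<cdot>\<^bsub>C\<^esub> \<eta> X)"
    unfolding right.map_comp[OF Fg e]
    by (rule left.C.comp_assoc[OF n right.map_hom[OF Fg] right.map_hom[OF e]])
  also have "\<dots> = (Ar G (\<epsilon> Y) \<cdot>\<^bsub>C\<^esub> \<eta> (Ob G Y)) \<cdot>\<^bsub>C\<^esub> g"
    unfolding unit_natural[OF g, symmetric]
    by (rule left.C.comp_assoc[symmetric, OF g unit_hom[OF right.map_obj[OF Y]] right.map_hom[OF e]])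
  also have "\<dots> = g" unfolding right_triangle[OF Y] by (rule left.C.id_left[OF g])
  finally show ?thesis .
qed

text \<open>A morphism is recovered from its transpose by applying an additive functor and
  composing, and both operations preserve zero.\<close>

lemma adjoint_null_iff:
  assumes X: "X \<in> Obj C" and Y: "Y \<in> Obj D"
  shows "null D (Ob F X) Y \<longleftrightarrow> null C X (Ob G Y)"
proof
  assume n: "null D (Ob F X) Y"
  show "null C X (Ob G Y)"
  proof (rule nullI)
    fix g assume g: "g \<in> Hom C X (Ob G Y)"
    have "\<epsilon> Y \<cdot>\<^bsub>D\<^esub> Ar F g = Zero D (Ob F X) Y"
      by (rule nullD[OF n left.D.comp_hom[OF left.map_hom[OF g] counit_hom[OF Y]]])
    then show "g = Zero C X (Ob G Y)"
      using right_transpose[OF g Y] right.map_zero[OF left.map_obj[OF X] Y]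
        left.C.comp_zero_left[OF unit_hom[OF X] right.map_obj[OF Y]] by simp
  qed
next
  assume n: "null C X (Ob G Y)"
  show "null D (Ob F X) Y"
  proof (rule nullI)
    fix f assume f: "f \<in> Hom D (Ob F X) Y"
    have "Ar G f \<cdot>\<^bsub>C\<^esub> \<eta> X = Zero C X (Ob G Y)"
      by (rule nullD[OF n left.C.comp_hom[OF unit_hom[OF X] right.map_hom[OF f]]])
    then show "f = Zero D (Ob F X) Y"
      using left_transpose[OF f X] left.map_zero[OF X right.map_obj[OF Y]]
        left.D.comp_zero_right[OF counit_hom[OF Y] left.map_obj[OF X]] by simp
  qed
qed

text \<open>The inverse \<open>s\<close> is the preimage under the fully faithful \<open>G\<close>
  of the unit at \<open>Ob G Y\<close>. One composite is checked after applying \<open>G\<close>;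
  the other has the same transpose as the identity.\<close>

lemma counit_iso:
  assumes ff: "fully_faithful D C G" and Y: "Y \<in> Obj D"
  shows "is_iso D (\<epsilon> Y)"
proof -
  note GY = right.map_obj[OF Y] and e = counit_hom[OF Y]
  note FGY = left.map_obj[OF GY]
  have bij: "bij_betw (Ar G) (Hom D A B) (Hom C (Ob G A) (Ob G B))" if "A \<in> Obj D" "B \<in> Obj D" for A B
    using ff that unfolding fully_faithful_def by blast
  obtain s where s: "s \<in> Hom D Y (Ob F (Ob G Y))" "Ar G s = \<eta> (Ob G Y)"
    using bij_betw_imp_surj_on[OF bij[OF Y FGY]] unit_hom[OF GY] by (metis imageE)
  have "Ar G (\<epsilon> Y \<cdot>\<^bsub>D\<^esub> s) = Ar G (Id D Y)"
    unfolding right.map_comp[OF s(1) e] s(2) right_triangle[OF Y] right.map_id[OF Y] ..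
  then have es: "\<epsilon> Y \<cdot>\<^bsub>D\<^esub> s = Id D Y"
    by (rule inj_onD[OF bij_betw_imp_inj_on[OF bij[OF Y Y]] _ left.D.comp_hom[OF s(1) e]
        left.D.id_hom[OF Y]])
  have se: "s \<cdot>\<^bsub>D\<^esub> \<epsilon> Y \<in> Hom D (Ob F (Ob G Y)) (Ob F (Ob G Y))" by (rule left.D.comp_hom[OF e s(1)])
  have "Ar G (s \<cdot>\<^bsub>D\<^esub> \<epsilon> Y) \<cdot>\<^bsub>C\<^esub> \<eta> (Ob G Y) = \<eta> (Ob G Y) \<cdot>\<^bsub>C\<^esub> (Ar G (\<epsilon> Y) \<cdot>\<^bsub>C\<^esub> \<eta> (Ob G Y))"
    unfolding right.map_comp[OF e s(1)] s(2)
    by (rule left.C.comp_assoc[OF unit_hom[OF GY] right.map_hom[OF e] unit_hom[OF GY]])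
  also have "\<dots> = \<eta> (Ob G Y)" unfolding right_triangle[OF Y] by (rule left.C.id_right[OF unit_hom[OF GY]])
  finally have "s \<cdot>\<^bsub>D\<^esub> \<epsilon> Y = \<epsilon> (Ob F (Ob G Y)) \<cdot>\<^bsub>D\<^esub> Ar F (\<eta> (Ob G Y))"
    using left_transpose[OF se GY] by simp
  then have "s \<cdot>\<^bsub>D\<^esub> \<epsilon> Y = Id D (Ob F (Ob G Y))" using left_triangle[OF GY] by simp
  then show ?thesis by (rule is_isoI[OF e s(1) _ es])
qed

lemma unit_iso:
  assumes ff: "fully_faithful C D F" and X: "X \<in> Obj C"
  shows "is_iso C (\<eta> X)"
proof -
  note FX = left.map_obj[OF X] and n = unit_hom[OF X]
  note GFX = right.map_obj[OF FX]
  have bij: "bij_betw (Ar F) (Hom C A B) (Hom D (Ob F A) (Ob F B))" if "A \<in> Obj C" "B \<in> Obj C" for A B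
    using ff that unfolding fully_faithful_def by blast
  obtain s where s: "s \<in> Hom C (Ob G (Ob F X)) X" "Ar F s = \<epsilon> (Ob F X)"
    using bij_betw_imp_surj_on[OF bij[OF GFX X]] counit_hom[OF FX] by (metis imageE)
  have "Ar F (s \<cdot>\<^bsub>C\<^esub> \<eta> X) = Ar F (Id C X)"
    unfolding left.map_comp[OF n s(1)] s(2) left_triangle[OF X] left.map_id[OF X] ..
  then have sn: "s \<cdot>\<^bsub>C\<^esub> \<eta> X = Id C X"
    by (rule inj_onD[OF bij_betw_imp_inj_on[OF bij[OF X X]] _ left.C.comp_hom[OF n s(1)]
        left.C.id_hom[OF X]])
  have ns: "\<eta> X \<cdot>\<^bsub>C\<^esub> s \<in> Hom C (Ob G (Ob F X)) (Ob G (Ob F X))" by (rule left.C.comp_hom[OF s(1) n])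
  have "\<epsilon> (Ob F X) \<cdot>\<^bsub>D\<^esub> Ar F (\<eta> X \<cdot>\<^bsub>C\<^esub> s) = (\<epsilon> (Ob F X) \<cdot>\<^bsub>D\<^esub> Ar F (\<eta> X)) \<cdot>\<^bsub>D\<^esub> \<epsilon> (Ob F X)"
    unfolding left.map_comp[OF s(1) n] s(2)
    by (rule left.D.comp_assoc[symmetric, OF counit_hom[OF FX] left.map_hom[OF n] counit_hom[OF FX]])
  also have "\<dots> = \<epsilon> (Ob F X)" unfolding left_triangle[OF X] by (rule left.D.id_left[OF counit_hom[OF FX]])
  finally have "\<eta> X \<cdot>\<^bsub>C\<^esub> s = Ar G (\<epsilon> (Ob F X)) \<cdot>\<^bsub>C\<^esub> \<eta> (Ob G (Ob F X))"
    using right_transpose[OF ns FX] by simp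
  then have "\<eta> X \<cdot>\<^bsub>C\<^esub> s = Id C (Ob G (Ob F X))" using right_triangle[OF FX] by simp
  then show ?thesis by (rule is_isoI[OF n s(1) sn])
qed

end

section \<open>Gluing\<close>

text \<open>Fixes the adjunction data that \<open>recollement\<close> only asserts to exist, so that
  transposition and the adjunction triangles refer to the same units and counits.\<close>

locale recollement_adjunctions = recollement +
  fixes \<eta>i \<epsilon>i \<eta>i' \<epsilon>i' \<eta>j \<epsilon>j \<eta>j' \<epsilon>j'
  assumes iu_il_adj: "adjunction D DF iu il \<eta>i \<epsilon>i"
    and il_ix_adj: "adjunction DF D il ix \<eta>i' \<epsilon>i'"
    and jx_ju_adj: "adjunction DU D jx ju \<eta>j \<epsilon>j"
    and ju_jl_adj: "adjunction D DU ju jl \<eta>j' \<epsilon>j'"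
    and jx_il_triangle: "K \<in> Obj D \<Longrightarrow> \<exists>h. (\<epsilon>j K, \<eta>i K, h) \<in> Dist D"
begin

sublocale iu: exact_functor D DF iu
  by (intro exact_functor.intro exact_functor_axioms.intro F.triangulated_category_axioms
      D.triangulated_category_axioms iu_triangulated)

sublocale il: exact_functor DF D il
  by (intro exact_functor.intro exact_functor_axioms.intro F.triangulated_category_axioms
      D.triangulated_category_axioms il_triangulated)

sublocale ix: exact_functor D DF ix
  by (intro exact_functor.intro exact_functor_axioms.intro F.triangulated_category_axioms
      D.triangulated_category_axioms ix_triangulated)

sublocale jx: exact_functor DU D jx
  by (intro exact_functor.intro exact_functor_axioms.intro U.triangulated_category_axioms
      D.triangulated_category_axioms jx_triangulated)

sublocale ju: exact_functor D DU ju
  by (intro exact_functor.intro exact_functor_axioms.intro U.triangulated_category_axioms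
      D.triangulated_category_axioms ju_triangulated)

sublocale jl: exact_functor DU D jl
  by (intro exact_functor.intro exact_functor_axioms.intro U.triangulated_category_axioms
      D.triangulated_category_axioms jl_triangulated)

sublocale iu_il: adjoint_functors D DF iu il \<eta>i \<epsilon>i
  by (intro adjoint_functors.intro adjoint_functors_axioms.intro iu.exact_functor_axioms
      il.exact_functor_axioms iu_il_adj)

sublocale il_ix: adjoint_functors DF D il ix \<eta>i' \<epsilon>i'
  by (intro adjoint_functors.intro adjoint_functors_axioms.intro il.exact_functor_axioms
      ix.exact_functor_axioms il_ix_adj)

sublocale jx_ju: adjoint_functors DU D jx ju \<eta>j \<epsilon>j
  by (intro adjoint_functors.intro adjoint_functors_axioms.intro jx.exact_functor_axioms
      ju.exact_functor_axioms jx_ju_adj)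

sublocale ju_jl: adjoint_functors D DU ju jl \<eta>j' \<epsilon>j'
  by (intro adjoint_functors.intro adjoint_functors_axioms.intro ju.exact_functor_axioms
      jl.exact_functor_axioms ju_jl_adj)

text \<open>Two adjunctions carry Hom from \<open>ix jl X\<close> to itself first to Hom(il ix jl X,
  jl X) and then to Hom(ju il ix jl X, X), which vanishes because \<open>ju il\<close> is
  zero.\<close>

lemma ix_jl_zero:
  assumes X: "X \<in> Obj DU"
  shows "zero_object DF (Ob ix (Ob jl X))"
proof -
  note jlX = jl.map_obj[OF X]
  note ixjlX = ix.map_obj[OF jlX]
  have "null DU (Ob ju (Ob il (Ob ix (Ob jl X)))) X"
    by (rule U.zero_object_null(1)[OF ju_il_zero[OF ixjlX]])
  then have "null D (Ob il (Ob ix (Ob jl X))) (Ob jl X)"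
    using ju_jl.adjoint_null_iff[OF il.map_obj[OF ixjlX] X] by simp
  then have "null DF (Ob ix (Ob jl X)) (Ob ix (Ob jl X))"
    using il_ix.adjoint_null_iff[OF ixjlX jlX] by simp
  then show ?thesis by (rule F.zero_object_if_null[OF ixjlX])
qed

text \<open>The triangle \<open>jx ju X -> X -> il iu X\<close> reduces the claim to its outer
  terms, where the adjunctions give Hom(ju X, ju Y) and Hom(iu X, ix Y). This is why the left class
  is tested with \<open>iu\<close> and the right class with \<open>ix\<close>.\<close>

lemma glued_null:
  assumes "X \<in> glued_le D iu ju LF LU" and "Y \<in> glued_ge D ix ju MF MU"
    and F: "\<And>X Y. \<lbrakk>X \<in> LF; Y \<in> MF\<rbrakk> \<Longrightarrow> null DF X Y"
    and U: "\<And>X Y. \<lbrakk>X \<in> LU; Y \<in> MU\<rbrakk> \<Longrightarrow> null DU X Y"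
  shows "null D X Y"
proof -
  have X: "X \<in> Obj D" "Ob ju X \<in> LU" "Ob iu X \<in> LF" using assms(1) unfolding glued_le_def by blast+
  have Y: "Y \<in> Obj D" "Ob ju Y \<in> MU" "Ob ix Y \<in> MF" using assms(2) unfolding glued_ge_def by blast+
  obtain h where h: "(\<epsilon>j X, \<eta>i X, h) \<in> Dist D" using jx_il_triangle[OF X(1)] by blast
  have t: "D.dtri (Ob jx (Ob ju X)) X (Ob il (Ob iu X)) (\<epsilon>j X) (\<eta>i X) h"
    by (rule D.dtriI'[OF h jx_ju.counit_hom[OF X(1)] iu_il.unit_hom[OF X(1)]])
  have "null D (Ob jx (Ob ju X)) Y"
    using U[OF X(2) Y(2)] jx_ju.adjoint_null_iff[OF ju.map_obj[OF X(1)] Y(1)] by simp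
  moreover have "null D (Ob il (Ob iu X)) Y"
    using F[OF X(3) Y(3)] il_ix.adjoint_null_iff[OF iu.map_obj[OF X(1)] Y(1)] by simp
  ultimately show ?thesis by (rule D.null_middle_left[OF t])
qed

text \<open>
  Following Beilinson-Bernstein-Deligne, \<open>X\<close> is truncated first along \<open>j\<close> and then along \<open>i\<close>:
  \<open>Y\<close> is the fibre of \<open>X \<rightarrow> j\<^sub>* M\<close> and \<open>A\<close> that of \<open>Y \<rightarrow> i\<^sub>* N\<close>, where \<open>M\<close> and \<open>N\<close> are the upper
  truncations of \<open>j\<^sup>* X\<close> and \<open>i\<^sup>* Y\<close>. The argument does not use the shift, so that it applies to
  tilted pairs as well as to t-structures.
\<close>

lemma glued_triangle:
  assumes "truncation_pair DF LF MF" and "truncation_pair DU LU MU" and X: "X \<in> Obj D"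
  shows "\<exists>A B f g h. D.dtri A X B f g h \<and> A \<in> glued_le D iu ju LF LU \<and> B \<in> glued_ge D ix ju MF MU"
proof -
  interpret PF: truncation_pair DF LF MF by (rule assms(1))
  interpret PU: truncation_pair DU LU MU by (rule assms(2))
  obtain P M p m n where PM: "U.dtri P (Ob ju X) M p m n" "P \<in> LU" "M \<in> MU"
    using PU.ex_pair_triangle[OF ju.map_obj[OF X]] by blast
  note M = U.dtriD(7)[OF PM(1)] and m = U.dtriD(3)[OF PM(1)]
  \<comment> \<open>The transpose of \<open>m\<close> under the adjunction of \<open>ju\<close> and
    \<open>jl\<close>: applying \<open>ju\<close> and the counit gives back \<open>m\<close>, so
    \<open>ju Y\<close> will be a fibre of \<open>m\<close>. In the same way \<open>v\<close> below
    is the transpose of \<open>m'\<close>.\<close>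
  define x where "x = Ar jl m \<cdot>\<^bsub>D\<^esub> \<eta>j' X"
  have x: "x \<in> Hom D X (Ob jl M)"
    unfolding x_def by (rule D.comp_hom[OF ju_jl.unit_hom[OF X] jl.map_hom[OF m]])
  obtain Y y z where Y: "D.dtri Y X (Ob jl M) y x z" by (rule D.fibre_ex[OF x])
  note Yobj = D.dtriD(5)[OF Y]
  obtain P' N p' m' n' where PN: "F.dtri P' (Ob iu Y) N p' m' n'" "P' \<in> LF" "N \<in> MF"
    using PF.ex_pair_triangle[OF iu.map_obj[OF Yobj]] by blast
  note N = F.dtriD(7)[OF PN(1)] and m' = F.dtriD(3)[OF PN(1)]
  define v where "v = Ar il m' \<cdot>\<^bsub>D\<^esub> \<eta>i Y"
  have v: "v \<in> Hom D Y (Ob il N)"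
    unfolding v_def by (rule D.comp_hom[OF iu_il.unit_hom[OF Yobj] il.map_hom[OF m']])
  obtain A a b where A: "D.dtri A Y (Ob il N) a v b" by (rule D.fibre_ex[OF v])
  obtain B e k where B: "D.dtri A X B (y \<cdot>\<^bsub>D\<^esub> a) e k"
    by (rule D.cone_ex[OF D.comp_hom[OF D.dtriD(2)[OF A] D.dtriD(2)[OF Y]]])
  obtain r s t where NBM: "D.dtri (Ob il N) B (Ob jl M) r s t" by (rule D.octahedron[OF A Y B])
  note Aobj = D.dtriD(5)[OF A] and Bobj = D.dtriD(6)[OF NBM]
  have counit_M: "\<epsilon>j' M \<in> Hom DU (Ob ju (Ob jl M)) M" "is_iso DU (\<epsilon>j' M)"
    by (rule ju_jl.counit_hom[OF M], rule ju_jl.counit_iso[OF jl_fully_faithful M])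
  have counit_N: "\<epsilon>i N \<in> Hom DF (Ob iu (Ob il N)) N" "is_iso DF (\<epsilon>i N)"
    by (rule iu_il.counit_hom[OF N], rule iu_il.counit_iso[OF il_fully_faithful N])
  have unit_N: "isomorphic DF N (Ob ix (Ob il N))"
    by (rule isomorphicI[OF il_ix.unit_iso[OF il_fully_faithful N] il_ix.unit_hom[OF N]])
  have "Ob ju A \<in> LU"
  proof -
    \<comment> \<open>\<open>ju\<close> kills \<open>il N\<close>, so the second truncation does not
      disturb the first: \<open>ju A\<close> is isomorphic to \<open>ju Y\<close>, and this to
      \<open>P\<close> as fibres of \<open>m\<close>.\<close>
    obtain h where h: "U.dtri (Ob ju A) (Ob ju Y) (Ob ju (Ob il N)) (Ar ju a) (Ar ju v) h"
      by (rule ju.map_dtri[OF A])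
    have 1: "isomorphic DU (Ob ju A) (Ob ju Y)"
      by (rule isomorphicI[OF U.iso_if_cone_zero[OF h ju_il_zero[OF N]] U.dtriD(2)[OF h]])
    obtain h' where h': "U.dtri (Ob ju Y) (Ob ju X) (Ob ju (Ob jl M)) (Ar ju y) (Ar ju x) h'"
      by (rule ju.map_dtri[OF Y])
    have "\<epsilon>j' M \<cdot>\<^bsub>DU\<^esub> Ar ju x = m" unfolding x_def by (rule ju_jl.left_transpose[OF m X])
    then obtain h'' where "U.dtri (Ob ju Y) (Ob ju X) M (Ar ju y) m h''"
      using U.iso_dtri_third[OF h' counit_M] by auto
    then have "isomorphic DU (Ob ju Y) P" by (rule U.fibre_unique[OF _ PM(1)])
    from U.isomorphic_trans[OF 1 this] show ?thesis
      by (rule iso_closedD[OF PU.left_iso_closed isomorphic_sym PM(2)])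
  qed
  moreover have "Ob iu A \<in> LF"
  proof -
    obtain h where h: "F.dtri (Ob iu A) (Ob iu Y) (Ob iu (Ob il N)) (Ar iu a) (Ar iu v) h"
      by (rule iu.map_dtri[OF A])
    have "\<epsilon>i N \<cdot>\<^bsub>DF\<^esub> Ar iu v = m'" unfolding v_def by (rule iu_il.left_transpose[OF m' Yobj])
    then obtain h' where "F.dtri (Ob iu A) (Ob iu Y) N (Ar iu a) m' h'"
      using F.iso_dtri_third[OF h counit_N] by auto
    then have "isomorphic DF (Ob iu A) P'" by (rule F.fibre_unique[OF _ PN(1)])
    then show ?thesis by (rule iso_closedD[OF PF.left_iso_closed isomorphic_sym PN(2)])
  qed
  moreover have "Ob ju B \<in> MU"
  proof -
    obtain h where h: "U.dtri (Ob ju (Ob il N)) (Ob ju B) (Ob ju (Ob jl M)) (Ar ju r) (Ar ju s) h"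
      by (rule ju.map_dtri[OF NBM])
    have "isomorphic DU (Ob ju B) (Ob ju (Ob jl M))"
      by (rule isomorphicI[OF U.iso_if_fibre_zero[OF h ju_il_zero[OF N]] U.dtriD(3)[OF h]])
    from U.isomorphic_trans[OF this isomorphicI[OF counit_M(2,1)]] show ?thesis
      by (rule iso_closedD[OF PU.right_iso_closed isomorphic_sym PM(3)])
  qed
  moreover have "Ob ix B \<in> MF"
  proof -
    \<comment> \<open>\<open>B\<close> is an extension of \<open>jl M\<close> by
      \<open>il N\<close>; \<open>ix\<close> kills the former and returns \<open>N\<close> from the
      latter.\<close>
    obtain h where h: "F.dtri (Ob ix (Ob il N)) (Ob ix B) (Ob ix (Ob jl M)) (Ar ix r) (Ar ix s) h"
      by (rule ix.map_dtri[OF NBM])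
    have "isomorphic DF (Ob ix (Ob il N)) (Ob ix B)"
      by (rule isomorphicI[OF F.iso_if_cone_zero[OF h ix_jl_zero[OF M]] F.dtriD(2)[OF h]])
    from F.isomorphic_trans[OF unit_N this] show ?thesis
      by (rule iso_closedD[OF PF.right_iso_closed _ PN(3)])
  qed
  ultimately have "A \<in> glued_le D iu ju LF LU" "B \<in> glued_ge D ix ju MF MU"
    using Aobj Bobj unfolding glued_le_def glued_ge_def by blast+
  then show ?thesis using B by blast
qed

lemma glued_le_iso_closed:
  assumes "iso_closed DF LF" and "iso_closed DU LU"
  shows "iso_closed D (glued_le D iu ju LF LU)"
proof (rule iso_closedI)
  show "Y \<in> glued_le D iu ju LF LU" if "isomorphic D X Y" "X \<in> glued_le D iu ju LF LU" for X Y
    using that iso_closedD[OF assms(1) iu.map_isomorphic[OF that(1)]]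
      iso_closedD[OF assms(2) ju.map_isomorphic[OF that(1)]] D.hom_cod
    unfolding glued_le_def isomorphic_def[of D] by blast
qed (auto simp: glued_le_def)

lemma glued_ge_iso_closed:
  assumes "iso_closed DF MF" and "iso_closed DU MU"
  shows "iso_closed D (glued_ge D ix ju MF MU)"
proof (rule iso_closedI)
  show "Y \<in> glued_ge D ix ju MF MU" if "isomorphic D X Y" "X \<in> glued_ge D ix ju MF MU" for X Y
    using that iso_closedD[OF assms(1) ix.map_isomorphic[OF that(1)]]
      iso_closedD[OF assms(2) ju.map_isomorphic[OF that(1)]] D.hom_cod
    unfolding glued_ge_def isomorphic_def[of D] by blast
qed (auto simp: glued_ge_def)

lemma glued_pair:
  assumes "truncation_pair DF LF MF" and "truncation_pair DU LU MU"
  shows "truncation_pair D (glued_le D iu ju LF LU) (glued_ge D ix ju MF MU)"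
proof -
  interpret PF: truncation_pair DF LF MF by (rule assms(1))
  interpret PU: truncation_pair DU LU MU by (rule assms(2))
  show ?thesis
  proof (intro truncation_pair.intro truncation_pair_axioms.intro)
    show "triangulated_category D" by (rule D.triangulated_category_axioms)
    show "iso_closed D (glued_le D iu ju LF LU)"
      by (rule glued_le_iso_closed[OF PF.left_iso_closed PU.left_iso_closed])
    show "iso_closed D (glued_ge D ix ju MF MU)"
      by (rule glued_ge_iso_closed[OF PF.right_iso_closed PU.right_iso_closed])
    show "null D X Y" if "X \<in> glued_le D iu ju LF LU" "Y \<in> glued_ge D ix ju MF MU" for X Y
      by (rule glued_null[OF that PF.pair_null PU.pair_null])
    show "\<exists>A B f g h. D.dtri A K B f g h \<and> A \<in> glued_le D iu ju LF LU \<and> B \<in> glued_ge D ix ju MF MU"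
      if "K \<in> Obj D" for K
      by (rule glued_triangle[OF assms that])
  qed
qed

lemma glued_t_structure:
  assumes "t_structure DF LF GF" and "t_structure DU LU GU"
  shows "t_structure D (glued_le D iu ju LF LU) (glued_ge D ix ju GF GU)"
proof -
  interpret TF: t_structure DF LF GF by (rule assms(1))
  interpret TU: t_structure DU LU GU by (rule assms(2))
  let ?L = "glued_le D iu ju LF LU" and ?G = "glued_ge D ix ju GF GU"
  \<comment> \<open>Gluing acts on pairs, so the glued classes of degrees >= 1 must be the classes
    of degrees >= 1 of the glued \<open>?G\<close>; this holds because \<open>ju\<close> and
    \<open>ix\<close> commute with the shift up to isomorphism.\<close>
  have ge_one: "ge_one D ?G = glued_ge D ix ju (ge_one DF GF) (ge_one DU GU)"
    using D.shift_obj ju.map_obj ix.map_obj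
      ju.map_shift_mem_iff[OF TU.ge_iso_closed]
      ix.map_shift_mem_iff[OF TF.ge_iso_closed]
    unfolding glued_ge_def ge_one_def by blast
  interpret pair: truncation_pair D ?L "ge_one D ?G"
    unfolding ge_one by (rule glued_pair[OF TF.t_structure_pair TU.t_structure_pair])
  show ?thesis
  proof (intro t_structure.intro t_structure_axioms.intro)
    show "triangulated_category D" by (rule D.triangulated_category_axioms)
    show "iso_closed D ?L" by (rule pair.left_iso_closed)
    show "iso_closed D ?G" by (rule glued_ge_iso_closed[OF TF.ge_iso_closed TU.ge_iso_closed])
    show "Hom D X Y = {Zero D X Y}" if "X \<in> ?L" "Y \<in> ge_one D ?G" for X Y
      using pair.pair_null[OF that] D.zero_hom iso_closed_obj[OF pair.left_iso_closed that(1)]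
        iso_closed_obj[OF pair.right_iso_closed that(2)] unfolding null_def by blast
    show "le_minus_one D ?L \<subseteq> ?L"
      using D.shift_obj TU.sh_le TF.sh_le ju.map_shift_mem_iff[OF TU.le_iso_closed]
        iu.map_shift_mem_iff[OF TF.le_iso_closed]
      unfolding le_minus_one_def glued_le_def by auto
    show "ge_one D ?G \<subseteq> ?G"
      unfolding ge_one using TU.ge_shift TF.ge_shift unfolding glued_ge_def by blast
    show "\<exists>f g h. (f, g, h) \<in> Dist D \<and> Dom D f \<in> ?L \<and> Cod D f = K \<and> Cod D g \<in> ge_one D ?G"
      if K: "K \<in> Obj D" for K
    proof -
      obtain A B f g h where t: "D.dtri A K B f g h" "A \<in> ?L" "B \<in> ge_one D ?G"
        using pair.ex_pair_triangle[OF K] by blast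
      have "Dom D f = A" "Cod D f = K" "Cod D g = B"
        using D.dtriD(2,3)[OF t(1)] unfolding Hom_def by blast+
      then show ?thesis using D.dtriD(1)[OF t(1)] t(2,3) by blast
    qed
  qed
qed

lemma glued_torsion_theory:
  assumes "t_structure DF LF GF" and "t_structure DU LU GU"
    and "torsion_theory (heart DF LF GF) TF FF" and "torsion_theory (heart DU LU GU) TU FU"
    and C: "C = heart D (glued_le D iu ju LF LU) (glued_ge D ix ju GF GU)"
  shows "torsion_theory C
    {T \<in> Obj C. Ob (perv DF LF GF iu) T \<in> TF \<and> Ob (perv DU LU GU ju) T \<in> TU}
    {L \<in> Obj C. Ob (perv DF LF GF ix) L \<in> FF \<and> Ob (perv DU LU GU ju) L \<in> FU}"
    (is "torsion_theory C ?T ?F")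
proof -
  interpret TF: tilted_t_structure DF LF GF TF FF
    by (rule tilted_t_structure.intro[OF assms(1,3)])
  interpret TU: tilted_t_structure DU LU GU TU FU
    by (rule tilted_t_structure.intro[OF assms(2,4)])
  let ?L = "glued_le D iu ju LF LU" and ?G = "glued_ge D ix ju GF GU"
  let ?L' = "glued_le D iu ju (tilt_le DF LF FF) (tilt_le DU LU FU)"
  let ?M' = "glued_ge D ix ju (tilt_ge DF GF TF) (tilt_ge DU GU TU)"
  interpret t: t_structure D ?L ?G by (rule glued_t_structure[OF assms(1,2)])
  have perv: "Ob (perv E L G R) X = Ob (H0 E L G) (Ob R X)" for E L G R X
    unfolding perv_def comp_functor_def id_functor_def by simp
  have "?L' \<subseteq> ?L" unfolding glued_le_def tilt_le_def by blast
  moreover have "?M' \<subseteq> ?G" unfolding glued_ge_def tilt_ge_def by blast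
  ultimately have "torsion_theory (heart D ?L ?G) (?L \<inter> ?G \<inter> ?L') (?L \<inter> ?G \<inter> ?M')"
    by (rule t.torsion_theory_if_pair[OF glued_pair[OF TF.tilt_pair TU.tilt_pair]])
  \<comment> \<open>Membership in \<open>?L\<close> puts \<open>iu T\<close> and \<open>ju T\<close>
    in degrees <= 0, which is precisely where torsion of \<open>H0\<close> is expressed by
    \<open>tilt_le\<close>; dually \<open>?G\<close> supplies the degrees >= 0 needed for
    \<open>?F\<close>.\<close>
  moreover have "?T = ?L \<inter> ?G \<inter> ?L'"
    unfolding C t.heart_sel perv
    using TF.H0_torsion_iff TU.H0_torsion_iff unfolding glued_le_def by blast
  moreover have "?F = ?L \<inter> ?G \<inter> ?M'"
    unfolding C t.heart_sel perv
    using TF.H0_free_iff TU.H0_free_iff unfolding glued_ge_def by blast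
  ultimately show ?thesis unfolding C by simp
qed

end

theorem proposition2p30:
  fixes DF :: "('of, 'mf) triang_data" and D :: "('o, 'm) triang_data"
    and DU :: "('ou, 'mu) triang_data"
  assumes "recollement DF D DU iu il ix jx ju jl"
    and "t_structure DF LF GF"
    and "t_structure DU LU GU"
    and "C = heart D (glued_le D iu ju LF LU) (glued_ge D ix ju GF GU)"
    and "torsion_theory (heart DF LF GF) TF FF"
    and "torsion_theory (heart DU LU GU) TU FU"
  shows "torsion_theory C
    {T \<in> Obj C. Ob (perv DF LF GF iu) T \<in> TF \<and> Ob (perv DU LU GU ju) T \<in> TU}
    {L \<in> Obj C. Ob (perv DF LF GF ix) L \<in> FF \<and> Ob (perv DU LU GU ju) L \<in> FU}"
proof -
  interpret recollement DF D DU iu il ix jx ju jl by (rule assms(1))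
  obtain \<eta>i \<epsilon>i \<eta>i' \<epsilon>i' \<eta>j \<epsilon>j \<eta>j' \<epsilon>j' where
    adj: "adjunction D DF iu il \<eta>i \<epsilon>i" "adjunction DF D il ix \<eta>i' \<epsilon>i'"
      "adjunction DU D jx ju \<eta>j \<epsilon>j" "adjunction D DU ju jl \<eta>j' \<epsilon>j'"
    and tri: "\<forall>K \<in> Obj D. (\<exists>h. (\<epsilon>j K, \<eta>i K, h) \<in> Dist D) \<and> (\<exists>h. (\<epsilon>i' K, \<eta>j' K, h) \<in> Dist D)"
    using adjunction_triangles by blast
  interpret recollement_adjunctions DF D DU iu il ix jx ju jl \<eta>i \<epsilon>i \<eta>i' \<epsilon>i' \<eta>j \<epsilon>j \<eta>j' \<epsilon>j'
    by (intro recollement_adjunctions.intro recollement_adjunctions_axioms.intro assms(1) adj)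
      (use tri in blast)
  show ?thesis by (rule glued_torsion_theory[OF assms(2,3,5,6,4)])
qed

end
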